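(* Let $G$ be an amenable locally compact groupoid with Haar system $\lambda$, let $H$ be a closed wide subgroupoid of $G$ with Haar system $\lambda_H$, and let $\mu$ be a full equivariant measure system on $G/H$. Then $G/H$ possesses a topological invariant mean (with respect to $\mu$).
   Context: **Groupoids.** All groupoids are second countable, locally compact and Hausdorff topological groupoids. $G^0$ is the unit space, $r,d:G\to G^0$ are the range and domain maps, $x,y$ are composable iff $d(x)=r(y)$, and $G^u=r^{-1}(u)$. $\lambda(f)(u)=\int_G f\,d\lambda^u$ for $f\in C_c(G)$. A subgroupoid $H\subseteq G$ is wide if it contains $G^0$. **Amenability.** $G$ is amenable if the range map $r:G\to G^0$ admits an approximate invariant continuous mean: a net $\{m_i\}$ of families $m_i=\{m_i^u\}_{u\in G^0}$ of probability measures on $G$, with $m_i^u$ supported in $G^u$ and $u\mapsto\int f\,dm_i^u$ continuous for every $f\in C_c(G)$, such that the total variation norms $\|\gamma^{-1}\cdot m_i^{r(\gamma)}-m_i^{d(\gamma)}\|_1$ tend to $0$ uniformly in $\gamma$ on compact subsets of $G$. (For groupoids with Haar system this is equivalent to topological amenability: existence of a net $\{f_i\}\subset C_c(G)$ with $u\mapsto\int|f_i|^2d\lambda^u$ uniformly bounded and $f_i*f_i^*\to1$ uniformly on compact subsets of $G$, where $f^*(\gamma)=\overline{f(\gamma^{-1})}$.) **The quotient $G/H$.** $G/H$ is the quotient of $G$ by $l\sim g\iff r(l)=r(g)$ and $l^{-1}g\in H$, with the quotient topology (locally compact Hausdorff). Put $r_{G^0}(xH)=r(x)$; $G$ acts on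 the left by $g\cdot xH=(gx)H$ when $d(g)=r(x)$. A full equivariant measure system $\mu=\{\mu^u\}_{u\in G^0}$ on $G/H$ is a family of positive Radon measures on $G/H$ with (i) $\operatorname{supp}\mu^u=r_{G^0}^{-1}(u)$; (ii) $u\mapsto\int f\,d\mu^u$ continuous for all $f\in C_c(G/H)$; (iii) $\int f(\gamma\cdot\omega)\,d\mu^{d(\gamma)}(\omega)=\int f(\omega)\,d\mu^{r(\gamma)}(\omega)$ for all $\gamma\in G$, $f\in C_c(G/H)$. **The space $\mathcal E$.** $\mathcal E=C_0(G^0,L^1(G/H,\mu))$ is the completion of $C_c(G/H)$ in the norm $\|f\|_{\mu,1}=\sup_{u\in G^0}\int_{G/H}|f(\omega)|\,d\mu^u(\omega)$. For $f\in C_c(G)$, $L(f)$ is the bounded operator on $\mathcal E$ extending $L(f)\phi(xH)=\int_G f(y)\phi(y^{-1}xH)\,d\lambda^{r(x)}(y)$, $\phi\in C_c(G/H)$. The dual $\mathcal E^*$ is identified with the space of $\mu$-bounded complex Radon measures on $G/H$; $\nu\ge0$ refers to positivity of the measure. For $m\in\mathcal E^{**}$, $f*m$ is the image of $m$ under the double transpose of $L(f)$. For $k\in C_0(G^0)$, $\nu\in\mathcal E^*$, $m\in\mathcal E^{**}$, $g\in\mathcal E$: $(kg)(\omega)=k(r_{G^0}(\omega))g(\omega)$, $\langle k\cdot\nu,g\rangle=\nu(kg)$, $\langle k\cdot m,\nu\rangle=m(k\cdot\nu)$. For a probability measure $\eta$ on $G^0$, $\eta\circ\mu\in\mathcal E^*$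 is given by $(\eta\circ\mu)(g)=\int_{G^0}\int_{G/H}g\,d\mu^u\,d\eta(u)$. **Topological invariant mean.** A topological invariant mean on $G/H$ with respect to $\mu$ is an element $m\in\mathcal E^{**}$ such that (1) $m(\nu)\ge0$ whenever $\nu\ge0$; (2) $m(\eta\circ\mu)=1$ for every probability measure $\eta$ on $G^0$; (3) $f*m=\lambda(f)\cdot m$ as functionals on $\mathcal E^*$, for every $f\in C_c(G)$. *)

theory Defs
  imports "HOL-Analysis.Analysis"
begin

section \<open>Complex normed spaces, completions and duals\<close>

text \<open>The spaces below depend on a groupoid and a measure system, so they cannot be types;
  they are records with an explicit carrier.\<close>

record 'v cnormed =
  vcarrier :: "'v set"
  vadd :: "'v \<Rightarrow> 'v \<Rightarrow> 'v"
  vscale :: "complex \<Rightarrow> 'v \<Rightarrow> 'v"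
  vnorm :: "'v \<Rightarrow> real"

definition vdist :: "'v cnormed \<Rightarrow> 'v \<Rightarrow> 'v \<Rightarrow> real" where
  "vdist V x y = vnorm V (vadd V x (vscale V (- 1) y))"

definition vCauchy :: "'v cnormed \<Rightarrow> (nat \<Rightarrow> 'v) \<Rightarrow> bool" where
  "vCauchy V X \<longleftrightarrow> (\<forall>n. X n \<in> vcarrier V) \<and>
     (\<forall>e>0. \<exists>N. \<forall>m\<ge>N. \<forall>n\<ge>N. vdist V (X m) (X n) < e)"

definition cauchy_rel :: "'v cnormed \<Rightarrow> ((nat \<Rightarrow> 'v) \<times> (nat \<Rightarrow> 'v)) set" where
  "cauchy_rel V = {(X, Y). vCauchy V X \<and> vCauchy V Y \<and> (\<lambda>n. vdist V (X n) (Y n)) \<longlonglongrightarrow> 0}"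

definition cauchy_class :: "'v cnormed \<Rightarrow> (nat \<Rightarrow> 'v) \<Rightarrow> (nat \<Rightarrow> 'v) set" where
  "cauchy_class V X = cauchy_rel V `` {X}"

definition cauchy_rep :: "(nat \<Rightarrow> 'v) set \<Rightarrow> nat \<Rightarrow> 'v" where
  "cauchy_rep A = (SOME X. X \<in> A)"

definition completion :: "'v cnormed \<Rightarrow> (nat \<Rightarrow> 'v) set cnormed" where
  "completion V = \<lparr>
     vcarrier = Collect (vCauchy V) // cauchy_rel V,
     vadd = (\<lambda>A B. cauchy_class V (\<lambda>n. vadd V (cauchy_rep A n) (cauchy_rep B n))),
     vscale = (\<lambda>c A. cauchy_class V (\<lambda>n. vscale V c (cauchy_rep A n))),
     vnorm = (\<lambda>A. lim (\<lambda>n. vnorm V (cauchy_rep A n))) \<rparr>"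

definition embed :: "'v cnormed \<Rightarrow> 'v \<Rightarrow> (nat \<Rightarrow> 'v) set" where
  "embed V x = cauchy_class V (\<lambda>_. x)"

text \<open>Extensions by continuity of a bounded linear operator \<open>S\<close> on \<open>V\<close>, and of a bounded linear
  functional \<open>\<phi>\<close> on \<open>V\<close>, to the completion of \<open>V\<close>.\<close>

definition extend_op :: "'v cnormed \<Rightarrow> ('v \<Rightarrow> 'v) \<Rightarrow> (nat \<Rightarrow> 'v) set \<Rightarrow> (nat \<Rightarrow> 'v) set" where
  "extend_op V S A = cauchy_class V (\<lambda>n. S (cauchy_rep A n))"

definition extend_functional :: "'v cnormed \<Rightarrow> ('v \<Rightarrow> complex) \<Rightarrow> (nat \<Rightarrow> 'v) set \<Rightarrow> complex" where
  "extend_functional V \<phi> A =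
     (if A \<in> vcarrier (completion V) then lim (\<lambda>n. \<phi> (cauchy_rep A n)) else 0)"

text \<open>Functionals are set to 0 off the carrier, so that equality in the dual is equality of
  functions.\<close>

definition dual :: "'v cnormed \<Rightarrow> ('v \<Rightarrow> complex) cnormed" where
  "dual V = \<lparr>
     vcarrier = {\<phi>.
       (\<forall>x\<in>vcarrier V. \<forall>y\<in>vcarrier V. \<phi> (vadd V x y) = \<phi> x + \<phi> y) \<and>
       (\<forall>c. \<forall>x\<in>vcarrier V. \<phi> (vscale V c x) = c * \<phi> x) \<and>
       (\<exists>C. \<forall>x\<in>vcarrier V. norm (\<phi> x) \<le> C * vnorm V x) \<and>
       (\<forall>x. x \<notin> vcarrier V \<longrightarrow> \<phi> x = 0)},
     vadd = (\<lambda>\<phi> \<psi> x. \<phi> x + \<psi> x),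
     vscale = (\<lambda>c \<phi> x. c * \<phi> x),
     vnorm = (\<lambda>\<phi>. SUP x\<in>{x \<in> vcarrier V. vnorm V x \<le> 1}. norm (\<phi> x)) \<rparr>"

definition transpose_op :: "'v cnormed \<Rightarrow> ('v \<Rightarrow> 'v) \<Rightarrow> ('v \<Rightarrow> complex) \<Rightarrow> 'v \<Rightarrow> complex" where
  "transpose_op V S \<phi> = (\<lambda>x. if x \<in> vcarrier V then \<phi> (S x) else 0)"


section \<open>Quotient topologies, Radon measures, compactly supported functions\<close>

definition quotient_topology :: "'b topology \<Rightarrow> ('b \<times> 'b) set \<Rightarrow> 'b set topology" where
  "quotient_topology X R =
     topology (\<lambda>U. U \<subseteq> topspace X // R \<and> openin X {x \<in> topspace X. R `` {x} \<in> U})"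

lemma openin_quotient_topology:
  "openin (quotient_topology X R) U \<longleftrightarrow>
     U \<subseteq> topspace X // R \<and> openin X {x \<in> topspace X. R `` {x} \<in> U}"
proof -
  let ?L = "\<lambda>U. U \<subseteq> topspace X // R \<and> openin X {x \<in> topspace X. R `` {x} \<in> U}"
  have "istopology ?L"
    unfolding istopology_def
  proof (intro conjI allI impI; (elim conjE)?)
    fix S T assume "openin X {x \<in> topspace X. R `` {x} \<in> S}" "openin X {x \<in> topspace X. R `` {x} \<in> T}"
    then have "openin X ({x \<in> topspace X. R `` {x} \<in> S} \<inter> {x \<in> topspace X. R `` {x} \<in> T})"
      by (rule openin_Int)
    moreover have "{x \<in> topspace X. R `` {x} \<in> S} \<inter> {x \<in> topspace X. R `` {x} \<in> T}
        = {x \<in> topspace X. R `` {x} \<in> S \<inter> T}" by auto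
    ultimately show "openin X {x \<in> topspace X. R `` {x} \<in> S \<inter> T}" by simp
  next
    fix \<K> assume "\<forall>K\<in>\<K>. ?L K"
    then have "openin X (\<Union>K\<in>\<K>. {x \<in> topspace X. R `` {x} \<in> K})" by blast
    moreover have "(\<Union>K\<in>\<K>. {x \<in> topspace X. R `` {x} \<in> K}) = {x \<in> topspace X. R `` {x} \<in> \<Union>\<K>}"
      by auto
    ultimately show "openin X {x \<in> topspace X. R `` {x} \<in> \<Union>\<K>}" by simp
  qed blast+
  then show ?thesis
    by (simp add: quotient_topology_def)
qed

lemma topspace_quotient_topology: "topspace (quotient_topology X R) = topspace X // R"
proof
  show "topspace (quotient_topology X R) \<subseteq> topspace X // R"
    using openin_quotient_topology openin_topspace by blast
  have "{x \<in> topspace X. R `` {x} \<in> topspace X // R} = topspace X"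
    by (auto intro: quotientI)
  then have "openin (quotient_topology X R) (topspace X // R)"
    by (simp add: openin_quotient_topology)
  then show "topspace X // R \<subseteq> topspace (quotient_topology X R)"
    by (rule openin_subset)
qed

lemma quotient_map_quotient_topology: "quotient_map X (quotient_topology X R) (\<lambda>x. R `` {x})"
  unfolding quotient_map_def
  by (auto simp: topspace_quotient_topology openin_quotient_topology quotient_def)

definition borel_of :: "'b topology \<Rightarrow> 'b measure" where
  "borel_of X = sigma (topspace X) {U. openin X U}"

definition msupport :: "'b topology \<Rightarrow> 'b measure \<Rightarrow> 'b set" where
  "msupport X M = {x \<in> topspace X. \<forall>U. openin X U \<and> x \<in> U \<longrightarrow> emeasure M U > 0}"

definition radon_measure :: "'b topology \<Rightarrow> 'b measure \<Rightarrow> bool" where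
  "radon_measure X M \<longleftrightarrow> sets M = sets (borel_of X) \<and>
     (\<forall>K. compactin X K \<longrightarrow> emeasure M K < \<infinity>) \<and>
     (\<forall>A\<in>sets M. emeasure M A = (INF U\<in>{U. openin X U \<and> A \<subseteq> U}. emeasure M U)) \<and>
     (\<forall>U. openin X U \<longrightarrow> emeasure M U = (SUP K\<in>{K. compactin X K \<and> K \<subseteq> U}. emeasure M K))"

definition probability_on :: "'b topology \<Rightarrow> 'b measure \<Rightarrow> bool" where
  "probability_on X M \<longleftrightarrow> sets M = sets (borel_of X) \<and> emeasure M (space M) = 1"

text \<open>Functions on the topological space \<open>X\<close> are represented by functions vanishing off
  \<open>topspace X\<close>.\<close>

definition Cc :: "'b topology \<Rightarrow> ('b \<Rightarrow> complex) set" where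
  "Cc X = {f. continuous_map X euclidean f \<and>
              compactin X (X closure_of {x \<in> topspace X. f x \<noteq> 0}) \<and>
              (\<forall>x. x \<notin> topspace X \<longrightarrow> f x = 0)}"

text \<open>Total variation norm of \<open>M - N\<close>, for finite measures \<open>M\<close>, \<open>N\<close> with the same measurable sets.\<close>

definition tv_norm_diff :: "'b measure \<Rightarrow> 'b measure \<Rightarrow> real" where
  "tv_norm_diff M N = (SUP P\<in>{P. finite P \<and> disjoint P \<and> P \<subseteq> sets M}.
     \<Sum>A\<in>P. \<bar>measure M A - measure N A\<bar>)"


section \<open>Locally compact groupoids\<close>

text \<open>The set of arrows is \<open>topspace (gtop G)\<close>; the operations are only meaningful there.\<close>

record 'a groupoid =
  gtop :: "'a topology"
  gmult :: "'a \<Rightarrow> 'a \<Rightarrow> 'a"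
  ginv :: "'a \<Rightarrow> 'a"
  grng :: "'a \<Rightarrow> 'a"
  gdom :: "'a \<Rightarrow> 'a"

definition arrows :: "'a groupoid \<Rightarrow> 'a set" where
  "arrows G = topspace (gtop G)"

definition gunits :: "'a groupoid \<Rightarrow> 'a set" where
  "gunits G = grng G ` arrows G"

definition unit_top :: "'a groupoid \<Rightarrow> 'a topology" where
  "unit_top G = subtopology (gtop G) (gunits G)"

definition rfibre :: "'a groupoid \<Rightarrow> 'a \<Rightarrow> 'a set" where
  "rfibre G u = {x \<in> arrows G. grng G x = u}"

definition composables :: "'a groupoid \<Rightarrow> ('a \<times> 'a) set" where
  "composables G = {(x, y). x \<in> arrows G \<and> y \<in> arrows G \<and> gdom G x = grng G y}"

locale lc_groupoid =
  fixes G :: "'a groupoid"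
  assumes rng_closed: "x \<in> arrows G \<Longrightarrow> grng G x \<in> arrows G"
    and dom_closed: "x \<in> arrows G \<Longrightarrow> gdom G x \<in> arrows G"
    and inv_closed: "x \<in> arrows G \<Longrightarrow> ginv G x \<in> arrows G"
    and mult_closed: "(x, y) \<in> composables G \<Longrightarrow> gmult G x y \<in> arrows G"
    and rng_rng: "x \<in> arrows G \<Longrightarrow> grng G (grng G x) = grng G x"
    and dom_rng: "x \<in> arrows G \<Longrightarrow> gdom G (grng G x) = grng G x"
    and rng_dom: "x \<in> arrows G \<Longrightarrow> grng G (gdom G x) = gdom G x"
    and dom_dom: "x \<in> arrows G \<Longrightarrow> gdom G (gdom G x) = gdom G x"
    and rng_mult: "(x, y) \<in> composables G \<Longrightarrow> grng G (gmult G x y) = grng G x"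
    and dom_mult: "(x, y) \<in> composables G \<Longrightarrow> gdom G (gmult G x y) = gdom G y"
    and mult_assoc: "(x, y) \<in> composables G \<Longrightarrow> (y, z) \<in> composables G \<Longrightarrow>
          gmult G (gmult G x y) z = gmult G x (gmult G y z)"
    and rng_unit: "x \<in> arrows G \<Longrightarrow> gmult G (grng G x) x = x"
    and dom_unit: "x \<in> arrows G \<Longrightarrow> gmult G x (gdom G x) = x"
    and rng_inv: "x \<in> arrows G \<Longrightarrow> grng G (ginv G x) = gdom G x"
    and dom_inv: "x \<in> arrows G \<Longrightarrow> gdom G (ginv G x) = grng G x"
    and mult_inv: "x \<in> arrows G \<Longrightarrow> gmult G x (ginv G x) = grng G x"
    and inv_mult: "x \<in> arrows G \<Longrightarrow> gmult G (ginv G x) x = gdom G x"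
    and continuous_rng: "continuous_map (gtop G) (gtop G) (grng G)"
    and continuous_dom: "continuous_map (gtop G) (gtop G) (gdom G)"
    and continuous_inv: "continuous_map (gtop G) (gtop G) (ginv G)"
    and continuous_mult: "continuous_map
          (subtopology (prod_topology (gtop G) (gtop G)) (composables G)) (gtop G)
          (\<lambda>(x, y). gmult G x y)"
    and second_countable: "second_countable (gtop G)"
    and locally_compact: "locally_compact_space (gtop G)"
    and Hausdorff: "Hausdorff_space (gtop G)"

text \<open>Integrals of translated functions are taken over the fibre on which the translate is
  defined: off that fibre the integrand is arbitrary and need not be measurable, and the Bochner
  integral of a non-measurable function is 0 even if the function is altered only on a null set.\<close>

definition haar_system :: "'a groupoid \<Rightarrow> ('a \<Rightarrow> 'a measure) \<Rightarrow> bool" where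
  "haar_system G lam \<longleftrightarrow>
     (\<forall>u\<in>gunits G. radon_measure (gtop G) (lam u) \<and> msupport (gtop G) (lam u) = rfibre G u) \<and>
     (\<forall>f\<in>Cc (gtop G). continuous_map (unit_top G) euclidean (\<lambda>u. LINT x|lam u. f x)) \<and>
     (\<forall>g\<in>arrows G. \<forall>f\<in>Cc (gtop G).
        (LINT x:rfibre G (gdom G g)|lam (gdom G g). f (gmult G g x))
        = (LINT x|lam (grng G g). f x))"

definition closed_wide_subgroupoid :: "'a groupoid \<Rightarrow> 'a set \<Rightarrow> bool" where
  "closed_wide_subgroupoid G H \<longleftrightarrow> closedin (gtop G) H \<and> gunits G \<subseteq> H \<and>
     (\<forall>x\<in>H. ginv G x \<in> H) \<and>
     (\<forall>x\<in>H. \<forall>y\<in>H. gdom G x = grng G y \<longrightarrow> gmult G x y \<in> H)"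

definition sub_groupoid :: "'a groupoid \<Rightarrow> 'a set \<Rightarrow> 'a groupoid" where
  "sub_groupoid G H = G\<lparr>gtop := subtopology (gtop G) H\<rparr>"


section \<open>Amenability\<close>

text \<open>The measure \<open>g\<cdot>M\<close>, for \<open>M\<close> concentrated on the fibre over \<open>gdom G g\<close>.\<close>

definition translate_measure :: "'a groupoid \<Rightarrow> 'a \<Rightarrow> 'a measure \<Rightarrow> 'a measure" where
  "translate_measure G g M =
     distr (restrict_space M (rfibre G (gdom G g))) (borel_of (gtop G)) (gmult G g)"

definition continuous_mean :: "'a groupoid \<Rightarrow> ('a \<Rightarrow> 'a measure) \<Rightarrow> bool" where
  "continuous_mean G m \<longleftrightarrow>
     (\<forall>u\<in>gunits G. probability_on (gtop G) (m u) \<and> msupport (gtop G) (m u) \<subseteq> rfibre G u) \<and>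
     (\<forall>f\<in>Cc (gtop G). continuous_map (unit_top G) euclidean (\<lambda>u. LINT x|m u. f x))"

text \<open>A net of means is represented by the filter generated by its tails, on the type of families
  of measures. Conversely every proper filter arises from a net in this way, so nets over arbitrary
  directed index sets are covered.\<close>

definition amenable :: "'a groupoid \<Rightarrow> bool" where
  "amenable G \<longleftrightarrow> (\<exists>F :: ('a \<Rightarrow> 'a measure) filter.
     F \<noteq> bot \<and> (\<forall>\<^sub>F m in F. continuous_mean G m) \<and>
     (\<forall>K. compactin (gtop G) K \<longrightarrow> (\<forall>e>0. \<forall>\<^sub>F m in F. \<forall>g\<in>K.
        tv_norm_diff (translate_measure G (ginv G g) (m (grng G g))) (m (gdom G g)) < e)))"


section \<open>The quotient $G/H$\<close>

definition coset_rel :: "'a groupoid \<Rightarrow> 'a set \<Rightarrow> ('a \<times> 'a) set" where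
  "coset_rel G H = {(l, g). l \<in> arrows G \<and> g \<in> arrows G \<and>
     grng G l = grng G g \<and> gmult G (ginv G l) g \<in> H}"

definition coset_top :: "'a groupoid \<Rightarrow> 'a set \<Rightarrow> 'a set topology" where
  "coset_top G H = quotient_topology (gtop G) (coset_rel G H)"

definition coset_rng :: "'a groupoid \<Rightarrow> 'a set \<Rightarrow> 'a" where
  "coset_rng G \<omega> = the_elem (grng G ` \<omega>)"

definition coset_fibre :: "'a groupoid \<Rightarrow> 'a set \<Rightarrow> 'a \<Rightarrow> 'a set set" where
  "coset_fibre G H u = {\<omega> \<in> topspace (coset_top G H). coset_rng G \<omega> = u}"

text \<open>All members of \<open>xH\<close> have range \<open>grng G x\<close>, hence \<open>g(xH) = {gz | z \<in> xH}\<close> when \<open>g\<close>, \<open>x\<close> are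
  composable.\<close>

definition coset_act :: "'a groupoid \<Rightarrow> 'a \<Rightarrow> 'a set \<Rightarrow> 'a set" where
  "coset_act G g \<omega> = gmult G g ` \<omega>"

definition full_equivariant_system ::
  "'a groupoid \<Rightarrow> 'a set \<Rightarrow> ('a \<Rightarrow> 'a set measure) \<Rightarrow> bool" where
  "full_equivariant_system G H mu \<longleftrightarrow>
     (\<forall>u\<in>gunits G. radon_measure (coset_top G H) (mu u) \<and>
        msupport (coset_top G H) (mu u) = coset_fibre G H u) \<and>
     (\<forall>f\<in>Cc (coset_top G H).
        continuous_map (unit_top G) euclidean (\<lambda>u. LINT \<omega>|mu u. f \<omega>)) \<and>
     (\<forall>g\<in>arrows G. \<forall>f\<in>Cc (coset_top G H).
        (LINT \<omega>:coset_fibre G H (gdom G g)|mu (gdom G g). f (coset_act G g \<omega>))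
        = (LINT \<omega>|mu (grng G g). f \<omega>))"


section \<open>The space $C_0(G^0, L^1(G/H,\mu))$ and its duals\<close>

definition Cc_mu :: "'a groupoid \<Rightarrow> 'a set \<Rightarrow> ('a \<Rightarrow> 'a set measure) \<Rightarrow> ('a set \<Rightarrow> complex) cnormed"
  where
  "Cc_mu G H mu = \<lparr>
     vcarrier = Cc (coset_top G H),
     vadd = (\<lambda>f g \<omega>. f \<omega> + g \<omega>),
     vscale = (\<lambda>c f \<omega>. c * f \<omega>),
     vnorm = (\<lambda>f. SUP u\<in>gunits G. LINT \<omega>|mu u. norm (f \<omega>)) \<rparr>"

definition E_space ::
  "'a groupoid \<Rightarrow> 'a set \<Rightarrow> ('a \<Rightarrow> 'a set measure) \<Rightarrow> (nat \<Rightarrow> 'a set \<Rightarrow> complex) set cnormed" where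
  "E_space G H mu = completion (Cc_mu G H mu)"

type_synonym 'a E_dual = "(nat \<Rightarrow> 'a set \<Rightarrow> complex) set \<Rightarrow> complex"
type_synonym 'a E_bidual = "'a E_dual \<Rightarrow> complex"

definition L_Cc :: "'a groupoid \<Rightarrow> 'a set \<Rightarrow> ('a \<Rightarrow> 'a measure) \<Rightarrow>
    ('a \<Rightarrow> complex) \<Rightarrow> ('a set \<Rightarrow> complex) \<Rightarrow> 'a set \<Rightarrow> complex" where
  "L_Cc G H lam f \<phi> \<omega> = (if \<omega> \<in> topspace (coset_top G H)
     then LINT y:rfibre G (coset_rng G \<omega>)|lam (coset_rng G \<omega>). f y * \<phi> (coset_act G (ginv G y) \<omega>)
     else 0)"

definition L_op :: "'a groupoid \<Rightarrow> 'a set \<Rightarrow> ('a \<Rightarrow> 'a measure) \<Rightarrow> ('a \<Rightarrow> 'a set measure) \<Rightarrow>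
    ('a \<Rightarrow> complex) \<Rightarrow> (nat \<Rightarrow> 'a set \<Rightarrow> complex) set \<Rightarrow> (nat \<Rightarrow> 'a set \<Rightarrow> complex) set" where
  "L_op G H lam mu f = extend_op (Cc_mu G H mu) (L_Cc G H lam f)"

text \<open>\<open>f * m\<close>: the double transpose of \<open>L(f)\<close>.\<close>

definition conv_act :: "'a groupoid \<Rightarrow> 'a set \<Rightarrow> ('a \<Rightarrow> 'a measure) \<Rightarrow> ('a \<Rightarrow> 'a set measure) \<Rightarrow>
    ('a \<Rightarrow> complex) \<Rightarrow> 'a E_bidual \<Rightarrow> 'a E_bidual" where
  "conv_act G H lam mu f m =
     transpose_op (dual (E_space G H mu)) (transpose_op (E_space G H mu) (L_op G H lam mu f)) m"

text \<open>The actions of functions \<open>k\<close> on the unit space on \<open>E\<close>, its dual and its bidual.\<close>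

definition mul_E :: "'a groupoid \<Rightarrow> 'a set \<Rightarrow> ('a \<Rightarrow> 'a set measure) \<Rightarrow>
    ('a \<Rightarrow> complex) \<Rightarrow> (nat \<Rightarrow> 'a set \<Rightarrow> complex) set \<Rightarrow> (nat \<Rightarrow> 'a set \<Rightarrow> complex) set" where
  "mul_E G H mu k = extend_op (Cc_mu G H mu) (\<lambda>g \<omega>. k (coset_rng G \<omega>) * g \<omega>)"

definition mul_dual :: "'a groupoid \<Rightarrow> 'a set \<Rightarrow> ('a \<Rightarrow> 'a set measure) \<Rightarrow>
    ('a \<Rightarrow> complex) \<Rightarrow> 'a E_dual \<Rightarrow> 'a E_dual" where
  "mul_dual G H mu k = transpose_op (E_space G H mu) (mul_E G H mu k)"

definition mul_bidual :: "'a groupoid \<Rightarrow> 'a set \<Rightarrow> ('a \<Rightarrow> 'a set measure) \<Rightarrow>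
    ('a \<Rightarrow> complex) \<Rightarrow> 'a E_bidual \<Rightarrow> 'a E_bidual" where
  "mul_bidual G H mu k = transpose_op (dual (E_space G H mu)) (mul_dual G H mu k)"

definition haar_integral :: "('a \<Rightarrow> 'a measure) \<Rightarrow> ('a \<Rightarrow> complex) \<Rightarrow> 'a \<Rightarrow> complex" where
  "haar_integral lam f u = (LINT x|lam u. f x)"

text \<open>The functional \<open>\<eta> \<circ> \<mu>\<close>.\<close>

definition comp_measure :: "'a groupoid \<Rightarrow> 'a set \<Rightarrow> ('a \<Rightarrow> 'a set measure) \<Rightarrow>
    'a measure \<Rightarrow> 'a E_dual" where
  "comp_measure G H mu \<eta> =
     extend_functional (Cc_mu G H mu) (\<lambda>g. LINT u|\<eta>. (LINT \<omega>|mu u. g \<omega>))"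

text \<open>An element of the dual of \<open>E\<close> is identified with the Radon measure representing its
  restriction to \<open>C\<^sub>c(G/H)\<close>; it is positive if that measure is.\<close>

definition positive_functional :: "'a groupoid \<Rightarrow> 'a set \<Rightarrow> ('a \<Rightarrow> 'a set measure) \<Rightarrow>
    'a E_dual \<Rightarrow> bool" where
  "positive_functional G H mu \<nu> \<longleftrightarrow> (\<exists>M. radon_measure (coset_top G H) M \<and>
     (\<forall>\<phi>\<in>Cc (coset_top G H). \<nu> (embed (Cc_mu G H mu) \<phi>) = (LINT \<omega>|M. \<phi> \<omega>)))"

definition topological_invariant_mean :: "'a groupoid \<Rightarrow> 'a set \<Rightarrow> ('a \<Rightarrow> 'a measure) \<Rightarrow>
    ('a \<Rightarrow> 'a set measure) \<Rightarrow> 'a E_bidual \<Rightarrow> bool" where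
  "topological_invariant_mean G H lam mu m \<longleftrightarrow>
     m \<in> vcarrier (dual (dual (E_space G H mu))) \<and>
     (\<forall>\<nu>\<in>vcarrier (dual (E_space G H mu)).
        positive_functional G H mu \<nu> \<longrightarrow> m \<nu> \<in> \<real>\<^sub>\<ge>\<^sub>0) \<and>
     (\<forall>\<eta>. probability_on (unit_top G) \<eta> \<longrightarrow> m (comp_measure G H mu \<eta>) = 1) \<and>
     (\<forall>f\<in>Cc (gtop G).
        conv_act G H lam mu f m = mul_bidual G H mu (haar_integral lam f) m)"

end

theory Submission
  imports Defs
begin

text \<open>
  Let \<open>m\<close> be one of the almost invariant families of probability measures provided by amenability,
  and let \<open>\<phi> \<ge> 0\<close> be a function on \<open>G/H\<close> whose integral over every fibre is 1. Averaging the
  translates of \<open>\<phi>\<close> over \<open>m\<close> gives the function \<open>g(\<omega>) = \<integral> \<phi>(y\<inverse>\<omega>) dm(y)\<close>, the integral being over the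
  fibre of \<open>G\<close> above the range of \<open>\<omega>\<close>. By the equivariance of \<open>\<mu>\<close> and Tonelli's theorem its fibre
  integrals are again 1. The difference \<open>g(y\<inverse>\<omega>) - g(\<omega>)\<close> is the integral of \<open>\<phi>(w\<inverse>\<omega>)\<close> in \<open>w\<close> against
  the difference of the translate of \<open>m\<close> by \<open>y\<close> and \<open>m\<close> itself, so its \<open>L\<^sup>1\<close> norm is at most the total
  variation of that difference (\<open>almost_invariant_translate\<close>). Integrating against \<open>f\<close> shows that
  \<open>L(f)g - \<lambda>(f)g\<close> is small in norm (\<open>almost_invariant_convolution\<close>).

  To have \<open>g\<close> in \<open>C\<^sub>c(G/H)\<close> one cuts \<open>m\<close> off by some \<open>c \<in> C\<^sub>c(G)\<close> that carries most of its mass above a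
  given compact set (\<open>uniformly_tight\<close>), and normalises \<open>\<phi> \<in> C\<^sub>c(G/H)\<close> over the sources of the support
  of \<open>c\<close> only (\<open>normalised_function\<close>). Thus for each compact \<open>K\<close> in the unit space, finite
  \<open>\<F> \<subseteq> C\<^sub>c(G)\<close> and \<open>e > 0\<close> there is some \<open>g \<ge> 0\<close> of norm at most 1 with fibre integrals at least
  \<open>1 - e\<close> above \<open>K\<close> and with \<open>\<parallel>L(f)g - \<lambda>(f)g\<parallel> \<le> e\<close> for \<open>f \<in> \<F>\<close> (\<open>almost_invariant_nonempty\<close>). As
  evaluation functionals these functions lie in a product of discs, which is compact, and they
  have a cluster point (\<open>cluster_point_exists\<close>). Linearity, positivity, the
  normalisation at a probability measure (which is tight) and invariance are closed conditions on
  the values of a functional that hold, up to small errors, for the functions \<open>g\<close>; so the cluster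
  point is the required mean (\<open>invariant_mean_exists\<close>).

  The argument needs \<open>G/H\<close> to be locally compact, Hausdorff and second countable and \<open>G\<close> to act
  continuously on it. Both follow from the openness of the quotient map, and that is where the Haar
  system of \<open>H\<close> enters: it makes the range map of \<open>H\<close> open (\<open>open_fibre_map\<close>, \<open>open_coset\<close>). It also
  needs convolution to map \<open>C\<^sub>c(G/H)\<close> into itself (\<open>L_Cc_in_Cc\<close>).
\<close>

section \<open>Second countable locally compact Hausdorff spaces\<close>

locale lcsc =
  fixes X :: "'b topology"
  assumes second_countable: "second_countable X"
    and locally_compact: "locally_compact_space X"
    and Hausdorff: "Hausdorff_space X"
begin

lemma regular: "regular_space X"
  using Hausdorff locally_compact locally_compact_Hausdorff_imp_regular_space by blast

lemma normal: "normal_space X"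
  using regular second_countable regular_Lindelof_imp_normal_space
    second_countable_imp_Lindelof_space by blast

lemma completely_regular: "completely_regular_space X"
  using Hausdorff locally_compact locally_compact_regular_imp_completely_regular_space by blast

lemma compactin_imp_closedin: "compactin X K \<Longrightarrow> closedin X K"
  using Hausdorff compactin_imp_closedin by blast

lemma Cc_I:
  assumes "continuous_map X euclidean f" "compactin X K" "\<And>x. x \<notin> K \<Longrightarrow> f x = 0"
  shows "f \<in> Cc X"
proof -
  have "X closure_of {x \<in> topspace X. f x \<noteq> 0} \<subseteq> K"
    using assms compactin_imp_closedin by (intro closure_of_minimal) auto
  then have "compactin X (X closure_of {x \<in> topspace X. f x \<noteq> 0})"
    using assms(2) closed_compactin closedin_closure_of by blast
  then show ?thesis
    using assms compactin_subset_topspace by (fastforce simp: Cc_def)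
qed

lemma Cc_E:
  assumes "f \<in> Cc X"
  obtains K where "continuous_map X euclidean f" "compactin X K" "\<And>x. x \<notin> K \<Longrightarrow> f x = 0"
proof
  show "continuous_map X euclidean f" "compactin X (X closure_of {x \<in> topspace X. f x \<noteq> 0})"
    using assms by (auto simp: Cc_def)
  fix x assume "x \<notin> X closure_of {x \<in> topspace X. f x \<noteq> 0}"
  then have "x \<notin> {x \<in> topspace X. f x \<noteq> 0}"
    by (metis (no_types, lifting) closure_of_subset mem_Collect_eq subset_iff subsetI)
  then show "f x = 0"
    using assms by (auto simp: Cc_def)
qed

lemma Cc_continuous: "f \<in> Cc X \<Longrightarrow> continuous_map X euclidean f"
  by (auto simp: Cc_def)

lemma Cc_add: assumes "f \<in> Cc X" "g \<in> Cc X" shows "(\<lambda>x. f x + g x) \<in> Cc X"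
proof -
  obtain K where K: "compactin X K" "\<And>x. x \<notin> K \<Longrightarrow> f x = 0" by (rule Cc_E[OF assms(1)]) blast
  obtain L where L: "compactin X L" "\<And>x. x \<notin> L \<Longrightarrow> g x = 0" by (rule Cc_E[OF assms(2)]) blast
  show ?thesis
  proof (rule Cc_I)
    show "continuous_map X euclidean (\<lambda>x. f x + g x)"
      using assms by (intro continuous_map_add Cc_continuous)
    show "compactin X (K \<union> L)" using K L by (intro compactin_Un)
  qed (use K L in auto)
qed

lemma Cc_mult_continuous:
  assumes "f \<in> Cc X" "continuous_map X euclidean k" shows "(\<lambda>x. k x * f x) \<in> Cc X"
proof -
  obtain K where K: "compactin X K" "\<And>x. x \<notin> K \<Longrightarrow> f x = 0" by (rule Cc_E[OF assms(1)]) blast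
  show ?thesis
  proof (rule Cc_I)
    show "continuous_map X euclidean (\<lambda>x. k x * f x)"
    proof -
      have "continuous_map X euclidean ((\<lambda>p. fst p * snd p) \<circ> (\<lambda>x. (k x, f x)))"
      proof (rule continuous_map_compose)
        show "continuous_map X (prod_topology euclidean euclidean) (\<lambda>x. (k x, f x))"
          using assms(2) Cc_continuous[OF assms(1)] unfolding continuous_map_pairwise by (simp add: o_def)
        show "continuous_map (prod_topology euclidean euclidean) euclidean (\<lambda>p. fst p * snd p :: complex)"
          by (auto intro!: continuous_intros)
      qed
      then show ?thesis by (simp add: o_def)
    qed
    show "compactin X K" using K by simp
  qed (use K in auto)
qed

lemma Cc_scale: "f \<in> Cc X \<Longrightarrow> (\<lambda>x. c * f x) \<in> Cc X"
  by (intro Cc_mult_continuous) auto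

lemma Cc_diff: assumes "f \<in> Cc X" "g \<in> Cc X" shows "(\<lambda>x. f x - g x) \<in> Cc X"
  using Cc_add[OF assms(1) Cc_scale[OF assms(2), of "- 1"]] by simp

lemma Cc_norm: assumes "f \<in> Cc X" shows "(\<lambda>x. complex_of_real (norm (f x))) \<in> Cc X"
proof -
  obtain K where K: "compactin X K" "\<And>x. x \<notin> K \<Longrightarrow> f x = 0" by (rule Cc_E[OF assms(1)]) blast
  have "continuous_map X euclidean ((\<lambda>z. complex_of_real (norm z)) \<circ> f)"
    by (rule continuous_map_compose[OF Cc_continuous[OF assms]])
      (auto intro!: continuous_intros)
  then show ?thesis
    by (intro Cc_I[of _ "K"]) (use K in \<open>auto simp: o_def\<close>)
qed

lemma Cc_zero: "(\<lambda>x. 0) \<in> Cc X"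
  by (rule Cc_I[of _ "{}"]) auto

lemma Cc_sum: "(\<And>i. i \<in> I \<Longrightarrow> f i \<in> Cc X) \<Longrightarrow> (\<lambda>x. \<Sum>i\<in>I. f i x) \<in> Cc X"
  by (induction I rule: infinite_finite_induct) (auto intro: Cc_zero Cc_add)

text \<open>Complete regularity gives a function that is 1 on \<open>K\<close> and 0 off a neighbourhood of \<open>K\<close>; local
  compactness lets one choose that neighbourhood inside a compact subset of \<open>U\<close>.\<close>

lemma Cc_cutoff:
  assumes "compactin X K" "openin X U" "K \<subseteq> U"
  obtains f where "(\<lambda>x. complex_of_real (f x)) \<in> Cc X" "\<And>x. 0 \<le> f x" "\<And>x. f x \<le> 1"
    "\<And>x. x \<in> K \<Longrightarrow> f x = 1" "\<And>x. x \<notin> U \<Longrightarrow> f x = 0"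
proof -
  have "neighbourhood_base_of (\<lambda>C. compactin X C \<and> closedin X C) X"
    using locally_compact regular locally_compact_regular_space_neighbourhood_base by blast
  then have "\<forall>x\<in>K. \<exists>V C. openin X V \<and> compactin X C \<and> x \<in> V \<and> V \<subseteq> C \<and> C \<subseteq> U"
    using assms unfolding neighbourhood_base_of by (metis subsetD)
  then obtain V C where VC: "\<And>x. x \<in> K \<Longrightarrow> openin X (V x) \<and> compactin X (C x) \<and> x \<in> V x \<and> V x \<subseteq> C x \<and> C x \<subseteq> U"
    by metis
  have "\<exists>\<F>. finite \<F> \<and> \<F> \<subseteq> V ` K \<and> K \<subseteq> \<Union>\<F>"
    by (rule compactinD[OF assms(1)]) (use VC in auto)
  then obtain T where T: "finite T" "T \<subseteq> K" "K \<subseteq> (\<Union>x\<in>T. V x)"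
    by (metis finite_subset_image)
  define W where "W = (\<Union>x\<in>T. V x)"
  define L where "L = (\<Union>x\<in>T. C x)"
  have W: "openin X W" using T VC by (auto simp: W_def)
  have L: "compactin X L" using T VC by (auto simp: L_def intro!: compactin_Union)
  have "W \<subseteq> L" using T VC by (fastforce simp: W_def L_def)
  moreover have "L \<subseteq> U" using T VC by (fastforce simp: L_def)
  ultimately have WL: "W \<subseteq> L" "L \<subseteq> U" "K \<subseteq> W" using T by (auto simp: W_def)
  have "disjnt K (topspace X - W)" using WL by (auto simp: disjnt_def)
  moreover have "closedin X (topspace X - W)" using W by blast
  ultimately obtain f :: "_ \<Rightarrow> real" where f: "continuous_map X (top_of_set {0..1}) f"
      "f ` (topspace X - W) \<subseteq> {0}" "f ` K \<subseteq> {1}"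
    using Urysohn_completely_regular_compact_closed[of 0 1 X K "topspace X - W"]
      completely_regular assms(1) by (metis zero_le_one)
  define g where "g x = (if x \<in> topspace X then f x else 0)" for x
  have 01: "f x \<in> {0..1}" if "x \<in> topspace X" for x
    using f(1) that by (auto simp: continuous_map_in_subtopology)
  have "continuous_map X euclideanreal f"
    using f(1) by (auto simp: continuous_map_in_subtopology)
  then have "continuous_map X euclideanreal g"
    by (rule continuous_map_eq) (auto simp: g_def)
  then have "continuous_map X euclidean (complex_of_real \<circ> g)"
    by (rule continuous_map_compose) (auto intro!: continuous_intros)
  then have "(\<lambda>x. complex_of_real (g x)) \<in> Cc X"
    by (intro Cc_I[OF _ L]) (use f WL in \<open>force simp: o_def g_def\<close>)+
  moreover have "g x = 1" if "x \<in> K" for x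
    using that f compactin_subset_topspace[OF assms(1)] by (auto simp: g_def)
  moreover have "g x = 0" if "x \<notin> U" for x
    using that f WL by (force simp: g_def)
  ultimately show ?thesis
    using 01 by (intro that[of g]) (auto simp: g_def)
qed

text \<open>A second countable space is Lindelof, so countably many of the compact neighbourhoods provided by
  local compactness cover it.\<close>

lemma sigma_compact:
  obtains K :: "nat \<Rightarrow> 'b set" where "\<And>n. compactin X (K n)" "(\<Union>n. K n) = topspace X" "incseq K"
proof -
  obtain U C where UC: "\<And>x. x \<in> topspace X \<Longrightarrow> openin X (U x) \<and> compactin X (C x) \<and> x \<in> U x \<and> U x \<subseteq> C x"
    using locally_compact unfolding locally_compact_space_def by metis
  have "\<Union>(U ` topspace X) = topspace X" using UC openin_subset by fast
  then have "\<exists>\<V>. countable \<V> \<and> \<V> \<subseteq> U ` topspace X \<and> \<Union>\<V> = topspace X"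
    by (intro Lindelof_spaceD second_countable_imp_Lindelof_space second_countable) (use UC in auto)
  then obtain T where T: "countable T" "T \<subseteq> topspace X" "\<Union>(U ` T) = topspace X"
    by (metis countable_subset_image)
  define e where "e = from_nat_into (insert {} (C ` T))"
  have e: "range e = insert {} (C ` T)"
    unfolding e_def by (rule range_from_nat_into) (use T in auto)
  define K where "K n = (\<Union>i\<le>n. e i)" for n
  have ce: "compactin X (e n)" for n
  proof -
    have "e n \<in> insert {} (C ` T)" using e by blast
    then show ?thesis using UC T by auto
  qed
  show ?thesis
  proof
    show "compactin X (K n)" for n
      unfolding K_def by (rule compactin_Union) (use ce in auto)
    have "(\<Union>n. K n) = (\<Union>n. e n)" by (auto simp: K_def)
    also have "\<dots> = (\<Union>x\<in>T. C x)" using e by auto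
    also have "\<dots> = topspace X"
    proof
      show "(\<Union>x\<in>T. C x) \<subseteq> topspace X"
        by (rule UN_least) (use T(2) UC compactin_subset_topspace in blast)
      show "topspace X \<subseteq> (\<Union>x\<in>T. C x)"
        unfolding T(3)[symmetric] by (rule UN_mono) (use T(2) UC in auto)
    qed
    finally show "(\<Union>n. K n) = topspace X" .
    show "incseq K" by (fastforce simp: K_def incseq_def)
  qed
qed

end

lemma lcsc_closed_subtopology:
  assumes "lcsc X" "closedin X S" shows "lcsc (subtopology X S)"
  using assms unfolding lcsc_def
  by (auto intro: second_countable_subtopology locally_compact_space_closed_subset
      Hausdorff_space_subtopology)

section \<open>Borel sets and product spaces\<close>

lemma space_borel_of [simp]: "space (borel_of X) = topspace X"
  unfolding borel_of_def by (rule space_measure_of) (auto dest: openin_subset)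

lemma sets_borel_of: "sets (borel_of X) = sigma_sets (topspace X) {U. openin X U}"
  unfolding borel_of_def by (rule sets_measure_of) (auto dest: openin_subset)

lemma openin_sets_borel_of: "openin X U \<Longrightarrow> U \<in> sets (borel_of X)"
  by (auto simp: sets_borel_of)

lemma closedin_sets_borel_of: "closedin X U \<Longrightarrow> U \<in> sets (borel_of X)"
proof -
  assume "closedin X U"
  then have "openin X (topspace X - U)" "topspace X - (topspace X - U) = U"
    by (auto simp: closedin_def)
  then show ?thesis
    by (metis openin_sets_borel_of sets.compl_sets space_borel_of)
qed

lemma measurable_borel_of_continuous_map:
  assumes "continuous_map X Y f"
  shows "f \<in> measurable (borel_of X) (borel_of Y)"
  unfolding borel_of_def[of Y]
proof (rule measurable_measure_of)
  show "{U. openin Y U} \<subseteq> Pow (topspace Y)" by (auto dest: openin_subset)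
  show "f \<in> space (borel_of X) \<rightarrow> topspace Y"
    using assms by (auto simp: continuous_map_def)
  fix U assume "U \<in> {U. openin Y U}"
  then have "openin X {x \<in> topspace X. f x \<in> U}"
    using assms by (simp add: continuous_map_def)
  moreover have "f -` U \<inter> space (borel_of X) = {x \<in> topspace X. f x \<in> U}" by auto
  ultimately show "f -` U \<inter> space (borel_of X) \<in> sets (borel_of X)"
    using openin_sets_borel_of by metis
qed

lemma borel_of_euclidean: "sets (borel_of euclidean) = sets borel"
  by (simp add: sets_borel_of borel_def)

lemma borel_measurable_continuous_map:
  assumes "continuous_map X euclidean f"
  shows "f \<in> borel_measurable (borel_of X)"
  by (subst measurable_cong_sets[OF refl borel_of_euclidean[symmetric]])
    (rule measurable_borel_of_continuous_map[OF assms])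

text \<open>Second countability makes the Borel sets of a product belong to the product sigma-algebra,
  which is what Tonelli's theorem asks for.\<close>

lemma openin_prod_sets_pair:
  assumes X: "second_countable X" and Y: "second_countable Y" and U: "openin (prod_topology X Y) U"
  shows "U \<in> sets (borel_of X \<Otimes>\<^sub>M borel_of Y)"
proof -
  from X[unfolded second_countable_def] obtain BX where BX: "countable BX" "\<forall>V\<in>BX. openin X V"
    "\<forall>U x. openin X U \<and> x \<in> U \<longrightarrow> (\<exists>V\<in>BX. x \<in> V \<and> V \<subseteq> U)"
    by (elim exE conjE)
  from Y[unfolded second_countable_def] obtain BY where BY: "countable BY" "\<forall>V\<in>BY. openin Y V"
    "\<forall>U x. openin Y U \<and> x \<in> U \<longrightarrow> (\<exists>V\<in>BY. x \<in> V \<and> V \<subseteq> U)"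
    by (elim exE conjE)
  define P where "P = {(A, B). A \<in> BX \<and> B \<in> BY \<and> A \<times> B \<subseteq> U}"
  have "U = (\<Union>(A,B)\<in>P. A \<times> B)"
  proof
    show "U \<subseteq> (\<Union>(A,B)\<in>P. A \<times> B)"
    proof clarify
      fix x y assume "(x, y) \<in> U"
      then obtain S T where "openin X S" "openin Y T" "x \<in> S" "y \<in> T" "S \<times> T \<subseteq> U"
        using U unfolding openin_prod_topology_alt by metis
      moreover obtain A where "A \<in> BX" "x \<in> A" "A \<subseteq> S" using BX(3) calculation by meson
      moreover obtain B where "B \<in> BY" "y \<in> B" "B \<subseteq> T" using BY(3) calculation by meson
      ultimately have "(A,B) \<in> P" "(x,y) \<in> A \<times> B" by (auto simp: P_def)
      then show "(x, y) \<in> (\<Union>(A,B)\<in>P. A \<times> B)" by blast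
    qed
  qed (auto simp: P_def)
  moreover have "countable P"
    by (rule countable_subset[of _ "BX \<times> BY"]) (use BX BY in \<open>auto simp: P_def\<close>)
  moreover have "(case p of (A,B) \<Rightarrow> A \<times> B) \<in> sets (borel_of X \<Otimes>\<^sub>M borel_of Y)" if "p \<in> P" for p
    using that BX BY by (auto simp: P_def intro!: pair_measureI openin_sets_borel_of)
  ultimately show ?thesis
    by (metis (no_types, lifting) sets.countable_UN'')
qed

lemma borel_measurable_closed_extension:
  fixes F :: "'b \<Rightarrow> 'd::topological_space"
  assumes Z: "closedin X Z"
    and F: "continuous_map (subtopology X Z) euclidean F"
    and off: "\<And>p. p \<in> topspace X \<Longrightarrow> p \<notin> Z \<Longrightarrow> F p = c"
  shows "F \<in> borel_measurable (borel_of X)"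
proof (rule borel_measurableI)
  fix S :: "'d set" assume S: "open S"
  have Zs: "Z \<subseteq> topspace X" using closedin_subset[OF Z] .
  have "openin (subtopology X Z) {p \<in> topspace (subtopology X Z). F p \<in> S}"
    using F S by (simp add: continuous_map_def)
  then obtain T where T: "openin X T"
      "{p \<in> topspace (subtopology X Z). F p \<in> S} = T \<inter> Z"
    unfolding openin_subtopology by metis
  have "F -` S \<inter> space (borel_of X) = (T \<inter> Z) \<union> (if c \<in> S then topspace X - Z else {})"
    using T(2) off Zs by auto
  moreover have "topspace X - Z \<in> sets (borel_of X)"
    using Z by (intro openin_sets_borel_of) auto
  ultimately show "F -` S \<inter> space (borel_of X) \<in> sets (borel_of X)"
    using closedin_sets_borel_of[OF Z] openin_sets_borel_of[OF T(1)] by auto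
qed

text \<open>Meant for kernels on a fibred product that are extended by a constant to the whole product.\<close>

lemma borel_measurable_pair_closed_extension:
  fixes F :: "'b \<times> 'c \<Rightarrow> 'd::topological_space"
  assumes X: "second_countable X" and Y: "second_countable Y"
    and Z: "closedin (prod_topology X Y) Z"
    and F: "continuous_map (subtopology (prod_topology X Y) Z) euclidean F"
    and off: "\<And>p. p \<in> topspace X \<times> topspace Y \<Longrightarrow> p \<notin> Z \<Longrightarrow> F p = c"
  shows "F \<in> borel_measurable (borel_of X \<Otimes>\<^sub>M borel_of Y)"
proof -
  have sp: "space (borel_of X \<Otimes>\<^sub>M borel_of Y) = topspace X \<times> topspace Y"
    by (simp add: space_pair_measure)
  have "sets (borel_of (prod_topology X Y)) \<subseteq> sets (borel_of X \<Otimes>\<^sub>M borel_of Y)"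
    unfolding sets_borel_of topspace_prod_topology sp[symmetric]
    by (rule sets.sigma_sets_subset) (use openin_prod_sets_pair[OF X Y] in auto)
  moreover have "F \<in> borel_measurable (borel_of (prod_topology X Y))"
    by (rule borel_measurable_closed_extension[OF Z F]) (use off in auto)
  ultimately show ?thesis
    using measurable_mono[of borel borel "borel_of (prod_topology X Y)" "borel_of X \<Otimes>\<^sub>M borel_of Y"] sp by auto
qed

lemma continuous_map_dist_I:
  fixes h :: "'b \<Rightarrow> 'd::metric_space"
  assumes "\<And>x e. x \<in> topspace X \<Longrightarrow> 0 < e \<Longrightarrow> \<exists>U. openin X U \<and> x \<in> U \<and> (\<forall>y\<in>U. dist (h y) (h x) < e)"
  shows "continuous_map X euclidean h"
  unfolding continuous_map_def
proof (intro conjI allI impI)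
  fix S :: "'d set" assume "openin euclidean S"
  then have S: "open S" by simp
  show "openin X {x \<in> topspace X. h x \<in> S}"
  proof (subst openin_subopen, intro ballI)
    fix x assume x: "x \<in> {x \<in> topspace X. h x \<in> S}"
    then obtain e where e: "e > 0" "ball (h x) e \<subseteq> S" using S open_contains_ball by blast
    obtain U where U: "openin X U" "x \<in> U" "\<forall>y\<in>U. dist (h y) (h x) < e" using assms[OF _ e(1)] x by blast
    have "U \<subseteq> {x \<in> topspace X. h x \<in> S}"
      using U(3) e(2) openin_subset[OF U(1)] by (auto simp: ball_def dist_commute)
    then show "\<exists>T. openin X T \<and> x \<in> T \<and> T \<subseteq> {x \<in> topspace X. h x \<in> S}" using U by blast
  qed
qed auto

section \<open>Integration along fibres\<close>

lemma (in lcsc) Cc_bounded: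
  assumes "f \<in> Cc X"
  obtains B where "0 \<le> B" "\<And>x. norm (f x) \<le> B"
proof -
  obtain K where K: "compactin X K" "\<And>x. x \<notin> K \<Longrightarrow> f x = 0" by (rule Cc_E[OF assms]) blast
  have "compactin euclidean (f ` K)"
    by (rule image_compactin[OF K(1) Cc_continuous[OF assms]])
  then have "bounded (f ` K)" by (simp add: compact_imp_bounded)
  then obtain B where B: "\<And>x. x \<in> K \<Longrightarrow> norm (f x) \<le> B" unfolding bounded_iff by auto
  show ?thesis
  proof (rule that[of "max B 0"])
    fix x show "norm (f x) \<le> max B 0"
      using B[of x] K(2)[of x] by (cases "x \<in> K") (auto simp: le_max_iff_disj)
  qed simp
qed

text \<open>The complement of the support is a union of open null sets, and a countable base reduces it to a
  countable union.\<close>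

lemma AE_msupport:
  assumes X: "second_countable X" and M: "sets M = sets (borel_of X)"
  shows "AE x in M. x \<in> msupport X M"
proof -
  from X[unfolded second_countable_def] obtain \<B> where B: "countable \<B>" "\<forall>V\<in>\<B>. openin X V"
    "\<forall>U x. openin X U \<and> x \<in> U \<longrightarrow> (\<exists>V\<in>\<B>. x \<in> V \<and> V \<subseteq> U)"
    by (elim exE conjE)
  let ?\<N> = "{V\<in>\<B>. emeasure M V = 0}"
  have sp: "space M = topspace X" using sets_eq_imp_space_eq[OF M] by simp
  have "\<Union>?\<N> \<in> null_sets M"
    by (rule null_sets_UN'[of ?\<N> "\<lambda>V. V", simplified])
      (use B openin_sets_borel_of[of X] M in \<open>auto intro: countable_subset[of _ \<B>] null_setsI\<close>)
  moreover have "{x \<in> space M. x \<notin> msupport X M} \<subseteq> \<Union>?\<N>"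
  proof
    fix x assume "x \<in> {x \<in> space M. x \<notin> msupport X M}"
    then obtain U where U: "openin X U" "x \<in> U" "emeasure M U = 0"
      by (auto simp: msupport_def sp)
    then obtain V where V: "V \<in> \<B>" "x \<in> V" "V \<subseteq> U" using B(3) by meson
    have "emeasure M V \<le> emeasure M U"
      using V U openin_sets_borel_of M by (intro emeasure_mono) auto
    then show "x \<in> \<Union>?\<N>" using V U by auto
  qed
  ultimately show ?thesis by (rule AE_I'[of _ M])
qed

text \<open>The common features of Haar systems, continuous means and equivariant systems. In place of a
  condition on supports, each measure is required to be concentrated on its fibre, which is the form
  in which supports enter integrals.\<close>

definition fibred_system ::
  "'b topology \<Rightarrow> ('b \<Rightarrow> 'a) \<Rightarrow> 'a topology \<Rightarrow> ('a \<Rightarrow> 'b measure) \<Rightarrow> bool" where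
  "fibred_system X p Y m \<longleftrightarrow>
     (\<forall>u\<in>topspace Y. sets (m u) = sets (borel_of X) \<and>
        (\<forall>K. compactin X K \<longrightarrow> emeasure (m u) K < \<infinity>) \<and> (AE x in m u. p x = u)) \<and>
     (\<forall>f\<in>Cc X. continuous_map Y euclidean (\<lambda>u. LINT x|m u. f x))"

locale fibred = lcsc X for X :: "'b topology" +
  fixes p :: "'b \<Rightarrow> 'a" and Y :: "'a topology" and m :: "'a \<Rightarrow> 'b measure"
  assumes system: "fibred_system X p Y m"
    and continuous_p: "continuous_map X Y p"
begin

lemma sets_m: "u \<in> topspace Y \<Longrightarrow> sets (m u) = sets (borel_of X)"
  using system by (simp add: fibred_system_def)

lemma space_m: "u \<in> topspace Y \<Longrightarrow> space (m u) = topspace X"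
  using sets_eq_imp_space_eq[OF sets_m] by simp

lemma emeasure_compact: "u \<in> topspace Y \<Longrightarrow> compactin X K \<Longrightarrow> emeasure (m u) K < \<infinity>"
  using system by (simp add: fibred_system_def)

lemma AE_fibre: "u \<in> topspace Y \<Longrightarrow> AE x in m u. p x = u"
  using system by (simp add: fibred_system_def)

lemma continuous_integral:
  "f \<in> Cc X \<Longrightarrow> continuous_map Y euclidean (\<lambda>u. LINT x|m u. f x)"
  using system by (simp add: fibred_system_def)

lemma measurable_m:
  assumes "u \<in> topspace Y" shows "measurable (m u) N = measurable (borel_of X) N"
  by (rule measurable_cong_sets) (use sets_m[OF assms] in auto)

lemma sigma_finite: assumes "u \<in> topspace Y" shows "sigma_finite_measure (m u)"
proof -
  obtain K :: "nat \<Rightarrow> 'b set" where K: "\<And>n. compactin X (K n)" "(\<Union>n. K n) = topspace X"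
    by (rule sigma_compact) blast
  show ?thesis
  proof
    show "\<exists>A. countable A \<and> A \<subseteq> sets (m u) \<and> \<Union>A = space (m u) \<and> (\<forall>a\<in>A. emeasure (m u) a \<noteq> \<infinity>)"
      using K emeasure_compact[OF assms K(1)] compactin_imp_closedin[OF K(1)]
      by (intro exI[of _ "range K"])
        (auto simp: sets_m[OF assms] space_m[OF assms] intro!: closedin_sets_borel_of simp: less_top)
  qed
qed

lemma Cc_measurable: "u \<in> topspace Y \<Longrightarrow> f \<in> Cc X \<Longrightarrow> f \<in> borel_measurable (m u)"
  using borel_measurable_continuous_map[OF Cc_continuous] by (simp add: measurable_m)

lemma Cc_integrable: assumes u: "u \<in> topspace Y" and f: "f \<in> Cc X" shows "integrable (m u) f"
proof -
  obtain K where K: "compactin X K" "\<And>x. x \<notin> K \<Longrightarrow> f x = 0" by (rule Cc_E[OF f]) blast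
  obtain B where "\<And>x. norm (f x) \<le> B" by (rule Cc_bounded[OF f]) blast
  then show ?thesis
    using K u emeasure_compact[OF u K(1)] compactin_imp_closedin[OF K(1)] f
    by (intro integrableI_bounded_set[of K _ _ B])
      (auto simp: sets_m intro: closedin_sets_borel_of Cc_measurable)
qed

lemma continuous_integral_norm:
  assumes "f \<in> Cc X"
  shows "continuous_map Y euclideanreal (\<lambda>u. LINT x|m u. norm (f x))"
proof -
  have "continuous_map Y euclidean (Re \<circ> (\<lambda>u. LINT x|m u. complex_of_real (norm (f x))))"
    by (rule continuous_map_compose[OF continuous_integral[OF Cc_norm[OF assms]]])
      (auto intro: continuous_intros)
  then show ?thesis by (simp add: o_def)
qed

lemma integral_norm_outside:
  assumes "u \<in> topspace Y" "\<And>x. x \<notin> K \<Longrightarrow> f x = (0::complex)" "u \<notin> p ` K"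
  shows "(LINT x|m u. norm (f x)) = 0"
proof -
  have "AE x in m u. norm (f x) = 0"
    using AE_fibre[OF assms(1)] by eventually_elim (use assms in auto)
  then show ?thesis by (simp add: integral_eq_zero_AE)
qed

lemma integral_norm_bounded:
  assumes "f \<in> Cc X"
  obtains C where "0 \<le> C" "\<And>u. u \<in> topspace Y \<Longrightarrow> (LINT x|m u. norm (f x)) \<le> C"
proof -
  obtain K where K: "compactin X K" "\<And>x. x \<notin> K \<Longrightarrow> f x = 0" by (rule Cc_E[OF assms]) blast
  let ?I = "\<lambda>u. LINT x|m u. norm (f x)"
  have "compactin euclidean (?I ` (p ` K))"
    by (intro image_compactin[of Y] image_compactin[OF K(1) continuous_p] continuous_integral_norm assms)
  then have "bounded (?I ` (p ` K))" by (simp add: compact_imp_bounded)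
  then obtain B where B: "\<And>u. u \<in> p ` K \<Longrightarrow> norm (?I u) \<le> B" unfolding bounded_iff by blast
  have "?I u \<le> max B 0" if "u \<in> topspace Y" for u
  proof (cases "u \<in> p ` K")
    case True
    then show ?thesis using B[of u] by (auto simp: max_def)
  next
    case False
    then show ?thesis using integral_norm_outside[OF that K(2)] by simp
  qed
  then show ?thesis by (intro that[of "max B 0"]) auto
qed

lemma nn_integral_norm_Cc:
  assumes "u \<in> topspace Y" "f \<in> Cc X"
  shows "(\<integral>\<^sup>+x. ennreal (norm (f x)) \<partial>m u) = ennreal (LINT x|m u. norm (f x))"
  using Cc_integrable[OF assms] by (intro nn_integral_eq_integral) auto

end

lemma fibred_systemI_msupport:
  assumes "lcsc X" "\<And>u. u \<in> topspace Y \<Longrightarrow> sets (m u) = sets (borel_of X)"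
    "\<And>u K. u \<in> topspace Y \<Longrightarrow> compactin X K \<Longrightarrow> emeasure (m u) K < \<infinity>"
    "\<And>u. u \<in> topspace Y \<Longrightarrow> msupport X (m u) \<subseteq> {x. p x = u}"
    "\<And>f. f \<in> Cc X \<Longrightarrow> continuous_map Y euclidean (\<lambda>u. LINT x|m u. f x)"
  shows "fibred_system X p Y m"
proof -
  have "AE x in m u. p x = u" if "u \<in> topspace Y" for u
    using AE_msupport[OF lcsc.second_countable[OF assms(1)] assms(2)[OF that]]
    by eventually_elim (use assms(4)[OF that] in auto)
  then show ?thesis using assms by (auto simp: fibred_system_def)
qed

text \<open>A function that does not vanish at a point of the support is bounded away from 0 on an open set of
  positive measure.\<close>

lemma (in fibred) integral_norm_pos:
  assumes f: "f \<in> Cc X" and v: "v \<in> topspace Y" and x: "x \<in> msupport X (m v)" "f x \<noteq> 0"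
  shows "0 < (LINT y|m v. norm (f y))"
proof -
  have "(LINT y|m v. norm (f y)) \<noteq> 0"
  proof
    assume "(LINT y|m v. norm (f y)) = 0"
    then have "AE y in m v. norm (f y) = 0"
      by (subst (asm) integral_nonneg_eq_0_iff_AE)
        (use integrable_norm[OF Cc_integrable[OF v f]] in auto)
    then have ae: "AE y in m v. f y = 0" by simp
    let ?W = "{y \<in> topspace X. f y \<in> - {0}}"
    have W: "openin X ?W"
      by (rule openin_continuous_map_preimage[OF Cc_continuous[OF f]]) auto
    have "x \<in> ?W" using x by (auto simp: msupport_def)
    then have "emeasure (m v) ?W > 0" using W x unfolding msupport_def by blast
    moreover have "AE y in m v. y \<notin> ?W" using ae by eventually_elim auto
    then have "emeasure (m v) ?W = 0"
      using AE_iff_measurable[of ?W "m v" "\<lambda>y. y \<notin> ?W"] openin_sets_borel_of[OF W]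
        sets_m[OF v] space_m[OF v] by auto
    ultimately show False by simp
  qed
  moreover have "(LINT y|m v. norm (f y)) \<ge> 0" by (rule integral_nonneg_AE) auto
  ultimately show ?thesis by (simp add: less_le)
qed

text \<open>A fibred system whose members have full support in the fibres forces the fibre map to be
  open: a bump function supported in \<open>U\<close> has an integral that is positive near \<open>p x\<close>, and a
  fibre on which the integral is positive meets \<open>U\<close>.\<close>

lemma (in fibred) open_fibre_map:
  assumes supp: "\<And>u. u \<in> topspace Y \<Longrightarrow> {x \<in> topspace X. p x = u} \<subseteq> msupport X (m u)"
    and U: "openin X U"
  shows "openin Y (p ` U)"
proof (subst openin_subopen, intro ballI)
  fix v assume "v \<in> p ` U"
  then obtain x where x: "x \<in> U" "v = p x" by blast
  have xX: "x \<in> topspace X" using openin_subset[OF U] x by blast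
  have vY: "v \<in> topspace Y" using continuous_p xX x(2) by (auto simp: continuous_map_def)
  have "compactin X {x}" using xX by simp
  then obtain f where f: "(\<lambda>x. complex_of_real (f x)) \<in> Cc X" "\<And>y. 0 \<le> f y"
      "\<And>y. y \<in> {x} \<Longrightarrow> f y = 1" "\<And>y. y \<notin> U \<Longrightarrow> f y = 0"
    by (rule Cc_cutoff[OF _ U, of "{x}"]) (use x(1) in auto)
  let ?I = "\<lambda>u. LINT y|m u. norm (complex_of_real (f y))"
  have cI: "continuous_map Y euclideanreal ?I" by (rule continuous_integral_norm[OF f(1)])
  let ?V = "{u \<in> topspace Y. ?I u \<in> {0<..}}"
  have "openin Y ?V" using cI by (rule openin_continuous_map_preimage) simp
  moreover have "?V \<subseteq> p ` U"
  proof (rule ccontr)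
    assume "\<not> ?V \<subseteq> p ` U"
    then obtain u where "u \<in> topspace Y" "?I u > 0" "u \<notin> p ` U" by auto
    then show False using integral_norm_outside[of u U "\<lambda>x. complex_of_real (f x)"] f(4) by simp
  qed
  moreover have "v \<in> ?V"
    using integral_norm_pos[OF f(1) vY, of x] supp[OF vY] x xX vY f(3)[of x] by auto
  ultimately show "\<exists>T. openin Y T \<and> v \<in> T \<and> T \<subseteq> p ` U" by blast
qed

section \<open>The triangle inequality and total variation\<close>

text \<open>The triangle inequality for integrals of functions with values in \<open>L\<^sup>1(N)\<close>.\<close>

lemma nn_integral_norm_integral_le:
  fixes k :: "'b \<times> 'c \<Rightarrow> complex"
  assumes M: "sigma_finite_measure M" and N: "sigma_finite_measure N"
    and k: "k \<in> borel_measurable (M \<Otimes>\<^sub>M N)"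
  shows "(\<integral>\<^sup>+\<omega>. ennreal (norm (LINT y|M. k (y, \<omega>))) \<partial>N)
     \<le> (\<integral>\<^sup>+y. (\<integral>\<^sup>+\<omega>. ennreal (norm (k (y, \<omega>))) \<partial>N) \<partial>M)"
proof -
  interpret M: sigma_finite_measure M by fact
  interpret N: sigma_finite_measure N by fact
  interpret pair_sigma_finite M N ..
  \<comment> \<open>a section that is not integrable has integral 0\<close>
  have "ennreal (norm (LINT y|M. k (y, \<omega>))) \<le> (\<integral>\<^sup>+y. ennreal (norm (k (y, \<omega>))) \<partial>M)" for \<omega>
    by (cases "integrable M (\<lambda>y. k (y, \<omega>))")
      (auto simp: not_integrable_integral_eq intro: integral_norm_bound_ennreal)
  then have "(\<integral>\<^sup>+\<omega>. ennreal (norm (LINT y|M. k (y, \<omega>))) \<partial>N)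
      \<le> (\<integral>\<^sup>+\<omega>. (\<integral>\<^sup>+y. ennreal (norm (k (y, \<omega>))) \<partial>M) \<partial>N)"
    by (intro nn_integral_mono)
  also have "\<dots> = (\<integral>\<^sup>+y. (\<integral>\<^sup>+\<omega>. ennreal (norm (k (y, \<omega>))) \<partial>N) \<partial>M)"
    by (rule Fubini') (use k in simp)
  finally show ?thesis .
qed

text \<open>Two finite measures have densities with respect to a common one, and the total variation
  norm of their difference dominates the \<open>L\<^sup>1\<close> distance of the densities: the partition into the
  set where one density exceeds the other and its complement realises it.\<close>

lemma tv_norm_diff_densities:
  assumes M: "finite_measure M" and N: "finite_measure N" and sets: "sets N = sets M"
  obtains Q a b where "finite_measure Q" "sets Q = sets M"
    "a \<in> borel_measurable Q" "b \<in> borel_measurable Q" "\<And>x. 0 \<le> a x" "\<And>x. (0::real) \<le> b x"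
    "M = density Q a" "N = density Q b" "integrable Q a" "integrable Q b"
    "(LINT x|Q. \<bar>a x - b x\<bar>) \<le> tv_norm_diff M N"
proof -
  interpret M: finite_measure M by fact
  interpret N: finite_measure N by fact
  note [measurable_cong] = sets
  have sp: "space N = space M" using sets by (rule sets_eq_imp_space_eq)
  \<comment> \<open>the least upper bound dominates both measures and has mass at most the sum of their masses\<close>
  define Q where "Q = sup_measure' M N"
  have sQ: "sets Q = sets M" and spQ: "space Q = space M"
    by (auto simp: Q_def sup_measure'_def)
  have le1: "emeasure M X \<le> emeasure Q X" and le2: "emeasure N X \<le> emeasure Q X" if "X \<in> sets M" for X
    unfolding Q_def using that sets
    by (auto intro: le_emeasure_sup_measure'1 le_emeasure_sup_measure'2)
  have Q: "finite_measure Q"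
  proof
    have "emeasure Q (space Q) \<le> emeasure M (space M) + emeasure N (space M)"
      unfolding spQ unfolding Q_def
      by (subst emeasure_sup_measure'[OF sets])
        (auto intro!: SUP_least add_mono emeasure_mono dest: sets.sets_into_space simp: sets)
    also have "\<dots> < \<infinity>"
      using M.emeasure_finite[of "space M"] N.emeasure_finite[of "space M"]
      by (simp add: less_top[symmetric])
    finally show "emeasure Q (space Q) \<noteq> \<infinity>" by simp
  qed
  interpret Q: finite_measure Q by fact
  have "\<exists>a. a \<in> borel_measurable Q \<and> (\<forall>x. 0 \<le> a x) \<and> R = density Q (\<lambda>x. ennreal (a x)) \<and> integrable Q a"
    if R: "finite_measure R" "sets R = sets M" "\<And>X. X \<in> sets M \<Longrightarrow> emeasure R X \<le> emeasure Q X" for R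
  proof -
    have ac: "absolutely_continuous Q R"
      unfolding absolutely_continuous_def using R(2,3) sQ by (auto simp: null_sets_def) (metis le_zero_eq)
    have sR: "sets R = sets Q" using R(2) sQ by simp
    obtain D where D: "D \<in> borel_measurable Q" "AE x in Q. RN_deriv Q R x = ennreal (D x)"
        "\<And>x. 0 \<le> D x"
      using Q.real_RN_deriv[OF R(1) ac sR] by metis
    have "density Q (\<lambda>x. ennreal (D x)) = density Q (RN_deriv Q R)"
      by (rule density_cong) (use D in \<open>auto elim: eventually_mono\<close>)
    also have "\<dots> = R" by (rule Q.density_RN_deriv[OF ac sR])
    finally have eq: "R = density Q (\<lambda>x. ennreal (D x))" by simp
    have "(\<integral>\<^sup>+x. ennreal (D x) \<partial>Q) = emeasure R (space R)"
      unfolding eq using D(1) by (simp add: emeasure_density cong: nn_integral_cong)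
    also have "\<dots> < \<infinity>" using finite_measure.finite_emeasure_space[OF R(1)] by (simp add: less_top[symmetric])
    finally have "integrable Q D"
      using D by (intro integrableI_nonneg) auto
    then show ?thesis using D eq by blast
  qed note dens = this
  obtain a where a: "a \<in> borel_measurable Q" "\<And>x. 0 \<le> a x" "M = density Q (\<lambda>x. ennreal (a x))" "integrable Q a"
    using dens[OF M refl le1] by blast
  obtain b where b: "b \<in> borel_measurable Q" "\<And>x. 0 \<le> b x" "N = density Q (\<lambda>x. ennreal (b x))" "integrable Q b"
    using dens[OF N sets le2] by blast
  have mM: "measure M S = (LINT x|Q. indicator S x * a x)" if "S \<in> sets Q" for S
  proof -
    have "measure M S = (LINT x|M. indicator S x)" using that sQ by simp
    also have "\<dots> = (LINT x|Q. a x *\<^sub>R indicator S x)"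
      by (subst a(3), rule integral_density) (use that a in auto)
    finally show ?thesis by (simp add: mult.commute)
  qed
  have mN: "measure N S = (LINT x|Q. indicator S x * b x)" if "S \<in> sets Q" for S
  proof -
    have "measure N S = (LINT x|N. indicator S x)" using that sQ sets by simp
    also have "\<dots> = (LINT x|Q. b x *\<^sub>R indicator S x)"
      by (subst b(3), rule integral_density) (use that b in auto)
    finally show ?thesis by (simp add: mult.commute)
  qed
  define S where "S = {x \<in> space Q. b x \<le> a x}"
  define T where "T = {x \<in> space Q. \<not> b x \<le> a x}"
  have [measurable]: "S \<in> sets Q" "T \<in> sets Q" using a(1) b(1) by (auto simp: S_def T_def)
  have int: "integrable Q (\<lambda>x. indicator U x * a x)" "integrable Q (\<lambda>x. indicator U x * b x)"
    if "U \<in> sets Q" for U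
    using integrable_real_mult_indicator[OF that a(4)] integrable_real_mult_indicator[OF that b(4)]
    by (simp_all add: mult.commute)
  have "(LINT x|Q. \<bar>a x - b x\<bar>) = (LINT x|Q. (indicator S x * a x - indicator S x * b x)
      + (indicator T x * b x - indicator T x * a x))"
    by (rule Bochner_Integration.integral_cong) (auto simp: S_def T_def indicator_def)
  also have "\<dots> = (measure M S - measure N S) + (measure N T - measure M T)"
    by (subst Bochner_Integration.integral_add Bochner_Integration.integral_diff,
        (intro Bochner_Integration.integrable_diff int; simp)+)+ (simp add: mM mN)
  also have "\<dots> \<le> (\<Sum>U\<in>{S, T}. \<bar>measure M U - measure N U\<bar>)"
  proof (cases "S = T")
    case True
    then have "S = {}" by (auto simp: S_def T_def)
    then show ?thesis using True by simp
  qed auto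
  also have "\<dots> \<le> tv_norm_diff M N"
    unfolding tv_norm_diff_def
  proof (rule cSUP_upper)
    show "{S, T} \<in> {P. finite P \<and> disjoint P \<and> P \<subseteq> sets M}"
      using sQ \<open>S \<in> sets Q\<close> \<open>T \<in> sets Q\<close> by (auto simp: disjoint_def S_def T_def)
    show "bdd_above ((\<lambda>P. \<Sum>U\<in>P. \<bar>measure M U - measure N U\<bar>) ` {P. finite P \<and> disjoint P \<and> P \<subseteq> sets M})"
    proof (rule bdd_aboveI2)
      fix P assume P: "P \<in> {P. finite P \<and> disjoint P \<and> P \<subseteq> sets M}"
      have "(\<Sum>U\<in>P. \<bar>measure M U - measure N U\<bar>) \<le> (\<Sum>U\<in>P. measure M U + measure N U)"
        by (rule sum_mono) (smt (verit) measure_nonneg)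
      also have "\<dots> = (\<Sum>U\<in>P. measure M U) + (\<Sum>U\<in>P. measure N U)" by (rule sum.distrib)
      also have "(\<Sum>U\<in>P. measure M U) = measure M (\<Union>P)"
        using P by (intro M.finite_measure_finite_Union[of P id, simplified, symmetric])
          (auto simp: disjoint_family_on_def disjoint_def)
      also have "(\<Sum>U\<in>P. measure N U) = measure N (\<Union>P)"
        using P sets by (intro N.finite_measure_finite_Union[of P id, simplified, symmetric])
          (auto simp: disjoint_family_on_def disjoint_def)
      also have "measure M (\<Union>P) + measure N (\<Union>P) \<le> measure M (space M) + measure N (space N)"
        by (intro add_mono M.bounded_measure N.bounded_measure)
      finally show "(\<Sum>U\<in>P. \<bar>measure M U - measure N U\<bar>) \<le> measure M (space M) + measure N (space N)" .
    qed
  qed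
  finally have "(LINT x|Q. \<bar>a x - b x\<bar>) \<le> tv_norm_diff M N" .
  then show ?thesis
    using that[of Q a b] Q sQ a b by blast
qed

section \<open>Groupoids and their coset spaces\<close>

context lc_groupoid
begin

lemma lcsc_gtop: "lcsc (gtop G)"
  using second_countable locally_compact Hausdorff by (simp add: lcsc_def)

lemma topspace_gtop: "topspace (gtop G) = arrows G"
  by (simp add: arrows_def)

lemma mult_cl [simp]: "x \<in> arrows G \<Longrightarrow> y \<in> arrows G \<Longrightarrow> gdom G x = grng G y \<Longrightarrow> gmult G x y \<in> arrows G"
  by (rule mult_closed) (simp add: composables_def)

lemma rng_mul [simp]: "x \<in> arrows G \<Longrightarrow> y \<in> arrows G \<Longrightarrow> gdom G x = grng G y \<Longrightarrow> grng G (gmult G x y) = grng G x"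
  by (rule rng_mult) (simp add: composables_def)

lemma dom_mul [simp]: "x \<in> arrows G \<Longrightarrow> y \<in> arrows G \<Longrightarrow> gdom G x = grng G y \<Longrightarrow> gdom G (gmult G x y) = gdom G y"
  by (rule dom_mult) (simp add: composables_def)

lemma assoc: "x \<in> arrows G \<Longrightarrow> y \<in> arrows G \<Longrightarrow> z \<in> arrows G \<Longrightarrow> gdom G x = grng G y \<Longrightarrow>
    gdom G y = grng G z \<Longrightarrow> gmult G (gmult G x y) z = gmult G x (gmult G y z)"
  by (rule mult_assoc) (simp_all add: composables_def)

lemmas cl [simp] = rng_closed dom_closed inv_closed rng_inv dom_inv rng_rng dom_rng rng_dom dom_dom

text \<open>Both \<open>x\<close> and the inverse of its inverse are left inverse to the inverse of \<open>x\<close>.\<close>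

lemma inv_inv [simp]: assumes x: "x \<in> arrows G" shows "ginv G (ginv G x) = x"
proof -
  let ?y = "ginv G x"
  have "ginv G ?y = gmult G (ginv G ?y) (gdom G (ginv G ?y))"
    using dom_unit[of "ginv G ?y"] x by simp
  also have "\<dots> = gmult G (ginv G ?y) (gmult G ?y x)"
    using x inv_mult[OF x] by simp
  also have "\<dots> = gmult G (gmult G (ginv G ?y) ?y) x"
    using x by (subst assoc) auto
  also have "\<dots> = x" using x inv_mult[of ?y] rng_unit[OF x] by simp
  finally show ?thesis .
qed

lemma inv_mult_cancel [simp]:
  assumes "x \<in> arrows G" "y \<in> arrows G" "gdom G x = grng G y"
  shows "gmult G (ginv G x) (gmult G x y) = y"
  using assms assoc[of "ginv G x" x y] inv_mult[of x] rng_unit[of y] by simp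

lemma mult_inv_cancel [simp]:
  assumes "x \<in> arrows G" "y \<in> arrows G" "grng G x = grng G y"
  shows "gmult G x (gmult G (ginv G x) y) = y"
  using inv_mult_cancel[of "ginv G x" y] assms by simp

lemma inv_mult_distrib:
  assumes x: "x \<in> arrows G" and y: "y \<in> arrows G" and xy: "gdom G x = grng G y"
  shows "ginv G (gmult G x y) = gmult G (ginv G y) (ginv G x)"
proof -
  let ?z = "gmult G x y"
  have z: "?z \<in> arrows G" using assms by simp
  have "gmult G ?z (gmult G (ginv G y) (ginv G x)) = grng G x"
    using assms by (subst assoc) (auto simp: mult_inv)
  then have "gmult G (ginv G ?z) (grng G x) = gmult G (ginv G y) (ginv G x)"
    using inv_mult_cancel[of ?z "gmult G (ginv G y) (ginv G x)"] assms by simp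
  then show ?thesis using dom_unit[of "ginv G ?z"] assms by simp
qed

lemma gunits_arrows: "u \<in> gunits G \<Longrightarrow> u \<in> arrows G"
  by (auto simp: gunits_def)

lemma gunits_rng [simp]: "u \<in> gunits G \<Longrightarrow> grng G u = u"
  and gunits_dom [simp]: "u \<in> gunits G \<Longrightarrow> gdom G u = u"
  by (auto simp: gunits_def)

lemma rng_gunits [simp]: "x \<in> arrows G \<Longrightarrow> grng G x \<in> gunits G"
  unfolding gunits_def by (rule imageI)

lemma dom_gunits [simp]: "x \<in> arrows G \<Longrightarrow> gdom G x \<in> gunits G"
  using rng_gunits[of "ginv G x"] by simp

lemma topspace_unit_top [simp]: "topspace (unit_top G) = gunits G"
  using gunits_arrows by (auto simp: unit_top_def topspace_gtop)

lemma continuous_rng_unit: "continuous_map (gtop G) (unit_top G) (grng G)"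
  using continuous_rng unfolding unit_top_def by (auto simp: continuous_map_in_subtopology topspace_gtop)

lemma continuous_dom_unit: "continuous_map (gtop G) (unit_top G) (gdom G)"
  using continuous_dom unfolding unit_top_def by (auto simp: continuous_map_in_subtopology topspace_gtop)

lemma closedin_gunits: "closedin (gtop G) (gunits G)"
proof -
  have "gunits G = {x \<in> topspace (gtop G). grng G x = x}"
    using gunits_arrows rng_gunits by (fastforce simp: topspace_gtop)
  also have "closedin (gtop G) \<dots>"
    by (rule closedin_continuous_maps_eq[OF Hausdorff]) (auto simp: continuous_rng)
  finally show ?thesis .
qed

lemma lcsc_unit_top: "lcsc (unit_top G)"
  unfolding unit_top_def by (rule lcsc_closed_subtopology[OF lcsc_gtop closedin_gunits])

definition same_rng :: "('a \<times> 'a) set" where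
  "same_rng = {(x, y). x \<in> arrows G \<and> y \<in> arrows G \<and> grng G x = grng G y}"

lemma closedin_same_rng: "closedin (prod_topology (gtop G) (gtop G)) same_rng"
proof -
  have "same_rng = {p \<in> topspace (prod_topology (gtop G) (gtop G)). (grng G \<circ> fst) p = (grng G \<circ> snd) p}"
    by (auto simp: same_rng_def topspace_gtop)
  also have "closedin (prod_topology (gtop G) (gtop G)) \<dots>"
    by (rule closedin_continuous_maps_eq[OF Hausdorff])
      (rule continuous_map_compose[OF _ continuous_rng] continuous_map_fst continuous_map_snd)+
  finally show ?thesis .
qed

lemma continuous_inv_mult:
  "continuous_map (subtopology (prod_topology (gtop G) (gtop G)) same_rng) (gtop G)
     (\<lambda>p. gmult G (ginv G (fst p)) (snd p))"
proof -
  let ?P = "prod_topology (gtop G) (gtop G)"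
  have "continuous_map (subtopology ?P same_rng) ?P (\<lambda>p. (ginv G (fst p), snd p))"
    unfolding continuous_map_pairwise o_def
    using continuous_map_compose[OF continuous_map_from_subtopology[OF continuous_map_fst] continuous_inv]
    by (auto simp: o_def continuous_map_from_subtopology[OF continuous_map_snd])
  then have "continuous_map (subtopology ?P same_rng) (subtopology ?P (composables G))
      (\<lambda>p. (ginv G (fst p), snd p))"
    by (auto simp: continuous_map_in_subtopology same_rng_def composables_def)
  from continuous_map_compose[OF this continuous_mult] show ?thesis
    by (simp add: o_def)
qed

end

lemma (in lc_groupoid) fibred_haar:
  assumes "haar_system G lam" shows "fibred (gtop G) (grng G) (unit_top G) lam"
proof (intro fibred.intro fibred_axioms.intro lcsc_gtop continuous_rng_unit)
  show "fibred_system (gtop G) (grng G) (unit_top G) lam"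
    by (rule fibred_systemI_msupport[OF lcsc_gtop])
      (use assms in \<open>auto simp: haar_system_def radon_measure_def rfibre_def\<close>)
qed

locale coset_space = lc_groupoid G for G :: "'a groupoid" +
  fixes H :: "'a set" and lamH :: "'a \<Rightarrow> 'a measure"
  assumes subgroupoid: "closed_wide_subgroupoid G H"
    and haarH: "haar_system (sub_groupoid G H) lamH"
begin

lemma H_closed: "closedin (gtop G) H"
  and H_units: "u \<in> gunits G \<Longrightarrow> u \<in> H"
  and H_inv: "x \<in> H \<Longrightarrow> ginv G x \<in> H"
  and H_mult: "x \<in> H \<Longrightarrow> y \<in> H \<Longrightarrow> gdom G x = grng G y \<Longrightarrow> gmult G x y \<in> H"
  using subgroupoid by (auto simp: closed_wide_subgroupoid_def)

lemma H_arrows: "x \<in> H \<Longrightarrow> x \<in> arrows G"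
  using closedin_subset[OF H_closed] by (auto simp: topspace_gtop)

text \<open>The Haar system of \<open>H\<close> is a fibred system with full supports over the unit space of \<open>G\<close>.\<close>

lemma openin_rng_H:
  assumes "openin (gtop G) W" shows "openin (unit_top G) (grng G ` (W \<inter> H))"
proof -
  let ?X = "subtopology (gtop G) H"
  have arr: "arrows (sub_groupoid G H) = H"
    using H_arrows by (auto simp: arrows_def sub_groupoid_def)
  have rng: "grng (sub_groupoid G H) = grng G" and top: "gtop (sub_groupoid G H) = ?X"
    by (simp_all add: sub_groupoid_def)
  have un: "gunits (sub_groupoid G H) = gunits G"
    unfolding gunits_def[of "sub_groupoid G H"] arr rng
    using H_arrows H_units by (auto simp: image_iff) (metis gunits_rng)
  have "unit_top (sub_groupoid G H) = subtopology (gtop G) (H \<inter> gunits G)"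
    by (simp add: unit_top_def[of "sub_groupoid G H"] un top subtopology_subtopology)
  also have "H \<inter> gunits G = gunits G" using H_units by blast
  finally have ut: "unit_top (sub_groupoid G H) = unit_top G" by (simp add: unit_top_def)
  have rf: "rfibre (sub_groupoid G H) u = {x \<in> H. grng G x = u}" for u
    by (simp add: rfibre_def arr rng)
  have lc: "lcsc ?X" by (rule lcsc_closed_subtopology[OF lcsc_gtop H_closed])
  interpret F: fibred ?X "grng G" "unit_top G" lamH
  proof (intro fibred.intro fibred_axioms.intro lc)
    show "continuous_map ?X (unit_top G) (grng G)"
      by (rule continuous_map_from_subtopology[OF continuous_rng_unit])
    show "fibred_system ?X (grng G) (unit_top G) lamH"
      by (rule fibred_systemI_msupport[OF lc])
        (use haarH in \<open>auto simp: haar_system_def radon_measure_def un top ut rf\<close>)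
  qed
  have "openin ?X (W \<inter> H)" using assms by (auto simp: openin_subtopology)
  then show ?thesis
    by (intro F.open_fibre_map)
      (use haarH in \<open>auto simp: haar_system_def un top ut rf\<close>)
qed

abbreviation CT where "CT \<equiv> coset_top G H"

abbreviation coset :: "'a \<Rightarrow> 'a set" where "coset x \<equiv> coset_rel G H `` {x}"

lemma coset_rel_iff: "(x, y) \<in> coset_rel G H \<longleftrightarrow>
    x \<in> arrows G \<and> y \<in> arrows G \<and> grng G x = grng G y \<and> gmult G (ginv G x) y \<in> H"
  by (simp add: coset_rel_def)

lemma equiv_coset_rel: "equiv (arrows G) (coset_rel G H)"
proof (rule equivI)
  show "coset_rel G H \<subseteq> arrows G \<times> arrows G" by (auto simp: coset_rel_iff)
  show "refl_on (arrows G) (coset_rel G H)"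
    by (auto simp: refl_on_def coset_rel_iff inv_mult H_units)
  show "sym (coset_rel G H)"
  proof (rule symI)
    fix x y assume xy: "(x, y) \<in> coset_rel G H"
    then have "ginv G (gmult G (ginv G x) y) \<in> H" by (auto simp: coset_rel_iff intro: H_inv)
    then show "(y, x) \<in> coset_rel G H"
      using xy by (auto simp: coset_rel_iff inv_mult_distrib)
  qed
  show "trans (coset_rel G H)"
  proof (rule transI)
    fix x y z assume a: "(x, y) \<in> coset_rel G H" "(y, z) \<in> coset_rel G H"
    then have "gmult G (gmult G (ginv G x) y) (gmult G (ginv G y) z) \<in> H"
      by (auto simp: coset_rel_iff intro!: H_mult)
    also have "gmult G (gmult G (ginv G x) y) (gmult G (ginv G y) z) = gmult G (ginv G x) z"
      using a by (subst assoc) (auto simp: coset_rel_iff)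
    finally show "(x, z) \<in> coset_rel G H" using a by (auto simp: coset_rel_iff)
  qed
qed

lemma topspace_CT: "topspace CT = arrows G // coset_rel G H"
  by (simp add: coset_top_def topspace_quotient_topology topspace_gtop)

lemma coset_in [simp]: "x \<in> arrows G \<Longrightarrow> coset x \<in> topspace CT"
  by (simp add: topspace_CT quotientI)

lemma coset_cases:
  assumes "\<omega> \<in> topspace CT" obtains x where "x \<in> arrows G" "\<omega> = coset x"
  using assms by (auto simp: topspace_CT quotient_def)

lemma coset_eq_iff: "x \<in> arrows G \<Longrightarrow> y \<in> arrows G \<Longrightarrow> coset x = coset y \<longleftrightarrow> (x, y) \<in> coset_rel G H"
  using eq_equiv_class_iff[OF equiv_coset_rel] by blast

lemma coset_self: "x \<in> arrows G \<Longrightarrow> x \<in> coset x"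
  using equiv_class_self[OF equiv_coset_rel] by blast

lemma coset_rng_coset [simp]: assumes "x \<in> arrows G" shows "coset_rng G (coset x) = grng G x"
proof -
  have "grng G ` coset x = {grng G x}"
    using coset_self[OF assms] by (auto simp: coset_rel_iff)
  then show ?thesis by (simp add: coset_rng_def)
qed

lemma coset_act_coset [simp]:
  assumes g: "g \<in> arrows G" and x: "x \<in> arrows G" and gx: "gdom G g = grng G x"
  shows "coset_act G g (coset x) = coset (gmult G g x)"
proof
  show "coset_act G g (coset x) \<subseteq> coset (gmult G g x)"
  proof
    fix w assume "w \<in> coset_act G g (coset x)"
    then obtain z where z: "(x, z) \<in> coset_rel G H" "w = gmult G g z" by (auto simp: coset_act_def)
    have "gmult G (ginv G (gmult G g x)) (gmult G g z) = gmult G (ginv G x) z"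
      using z g x gx by (simp add: inv_mult_distrib coset_rel_iff assoc)
    then show "w \<in> coset (gmult G g x)" using z g x gx by (simp add: coset_rel_iff)
  qed
  show "coset (gmult G g x) \<subseteq> coset_act G g (coset x)"
  proof
    fix w assume w: "w \<in> coset (gmult G g x)"
    let ?z = "gmult G (ginv G g) w"
    have w': "w \<in> arrows G" "grng G w = grng G g" "gmult G (ginv G (gmult G g x)) w \<in> H"
      using w g x gx by (auto simp: coset_rel_iff)
    then have "gmult G (ginv G x) ?z \<in> H"
      using g x gx by (simp add: inv_mult_distrib assoc)
    then have "(x, ?z) \<in> coset_rel G H" using w' g x gx by (simp add: coset_rel_iff)
    moreover have "w = gmult G g ?z" using w' g by simp
    ultimately show "w \<in> coset_act G g (coset x)" by (auto simp: coset_act_def)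
  qed
qed

lemma coset_rng_units [simp]: "\<omega> \<in> topspace CT \<Longrightarrow> coset_rng G \<omega> \<in> gunits G"
  by (erule coset_cases) simp

lemma coset_act_closed [simp]:
  "g \<in> arrows G \<Longrightarrow> \<omega> \<in> topspace CT \<Longrightarrow> gdom G g = coset_rng G \<omega> \<Longrightarrow> coset_act G g \<omega> \<in> topspace CT"
  by (erule coset_cases) simp

lemma coset_rng_act [simp]:
  "g \<in> arrows G \<Longrightarrow> \<omega> \<in> topspace CT \<Longrightarrow> gdom G g = coset_rng G \<omega> \<Longrightarrow> coset_rng G (coset_act G g \<omega>) = grng G g"
  by (erule coset_cases) simp

lemma coset_act_act:
  "g \<in> arrows G \<Longrightarrow> h \<in> arrows G \<Longrightarrow> \<omega> \<in> topspace CT \<Longrightarrow> gdom G h = coset_rng G \<omega> \<Longrightarrow>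
   gdom G g = grng G h \<Longrightarrow> coset_act G g (coset_act G h \<omega>) = coset_act G (gmult G g h) \<omega>"
  by (erule coset_cases) (simp add: assoc)

lemma coset_act_inv [simp]:
  "g \<in> arrows G \<Longrightarrow> \<omega> \<in> topspace CT \<Longrightarrow> gdom G g = coset_rng G \<omega> \<Longrightarrow>
   coset_act G (ginv G g) (coset_act G g \<omega>) = \<omega>"
  by (erule coset_cases) simp

lemma quotient_map_coset: "quotient_map (gtop G) CT coset"
  unfolding coset_top_def by (rule quotient_map_quotient_topology)

lemma continuous_coset: "continuous_map (gtop G) CT coset"
  using quotient_map_coset by (rule quotient_imp_continuous_map)

text \<open>The range map of \<open>H\<close> is open because \<open>H\<close> has a Haar system; hence saturations \<open>UH\<close> of open
  sets are open.\<close>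

lemma open_coset: assumes U: "openin (gtop G) U" shows "openin CT (coset ` U)"
proof -
  have UA: "U \<subseteq> arrows G" using openin_subset[OF U] by (simp add: topspace_gtop)
  let ?S = "{x \<in> topspace (gtop G). coset x \<in> coset ` U}"
  have "openin (gtop G) ?S"
  proof (subst openin_subopen, intro ballI)
    fix x assume "x \<in> ?S"
    then obtain g where x: "x \<in> arrows G" and g: "g \<in> U" "coset x = coset g"
      by (auto simp: topspace_gtop)
    then have gA: "g \<in> arrows G" and xg: "(x, g) \<in> coset_rel G H"
      using UA coset_eq_iff by auto
    \<comment> \<open>\<open>x h = g \<in> U\<close> with \<open>h \<in> H\<close>; nearby \<open>x'\<close> have products \<open>x' h' \<in> U\<close> with \<open>h' \<in> H\<close> near \<open>h\<close>, because
      the ranges of such \<open>h'\<close> fill a neighbourhood of the source of \<open>x\<close>\<close>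
    define h where "h = gmult G (ginv G x) g"
    have h: "h \<in> H" "gmult G x h = g" "gdom G x = grng G h" "h \<in> arrows G"
      using xg by (auto simp: h_def coset_rel_iff)
    let ?P = "prod_topology (gtop G) (gtop G)"
    have "openin (subtopology ?P (composables G))
        {p \<in> topspace (subtopology ?P (composables G)). (\<lambda>(x, y). gmult G x y) p \<in> U}"
      by (rule openin_continuous_map_preimage[OF continuous_mult U])
    then obtain T where T: "openin ?P T"
        "{p \<in> topspace (subtopology ?P (composables G)). (\<lambda>(x, y). gmult G x y) p \<in> U} = T \<inter> composables G"
      unfolding openin_subtopology by metis
    have "(x, h) \<in> T"
      using T(2) x h g(1) by (auto simp: composables_def topspace_gtop set_eq_iff)
    then obtain N W where NW: "openin (gtop G) N" "openin (gtop G) W" "x \<in> N" "h \<in> W" "N \<times> W \<subseteq> T"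
      using T(1) unfolding openin_prod_topology_alt by metis
    let ?V = "{x' \<in> topspace (gtop G). gdom G x' \<in> grng G ` (W \<inter> H)}"
    have V: "openin (gtop G) ?V"
      by (rule openin_continuous_map_preimage[OF continuous_dom_unit openin_rng_H[OF NW(2)]])
    have "N \<inter> ?V \<subseteq> ?S"
    proof
      fix x' assume x': "x' \<in> N \<inter> ?V"
      then obtain h' where h': "h' \<in> W" "h' \<in> H" "gdom G x' = grng G h'" by auto
      have x'A: "x' \<in> arrows G" using x' by (simp add: topspace_gtop)
      have c: "(x', h') \<in> T \<inter> composables G"
        using x' x'A h' NW(5) H_arrows by (auto simp: composables_def)
      then have "gmult G x' h' \<in> U" unfolding T(2)[symmetric] by simp
      moreover have "coset x' = coset (gmult G x' h')"
        using x'A h' H_arrows by (subst coset_eq_iff) (auto simp: coset_rel_iff)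
      ultimately show "x' \<in> ?S" using x'A by (auto simp: topspace_gtop)
    qed
    moreover have "x \<in> N \<inter> ?V" using x h NW by (auto simp: topspace_gtop)
    ultimately show "\<exists>T. openin (gtop G) T \<and> x \<in> T \<and> T \<subseteq> ?S"
      using V NW(1) openin_Int by (intro exI[of _ "N \<inter> ?V"]) auto
  qed
  then show ?thesis
    unfolding coset_top_def openin_quotient_topology
    using UA by (auto simp: topspace_gtop quotientI)
qed

lemma coset_image: "coset ` topspace (gtop G) = topspace CT"
  by (auto simp: topspace_gtop elim: coset_cases)

lemma open_map_coset: "open_map (gtop G) CT coset"
  using open_coset by (simp add: open_map_def)

lemma closedin_coset_rel: "closedin (prod_topology (gtop G) (gtop G)) (coset_rel G H)"
proof -
  let ?P = "prod_topology (gtop G) (gtop G)"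
  have "closedin (subtopology ?P same_rng)
      {p \<in> topspace (subtopology ?P same_rng). gmult G (ginv G (fst p)) (snd p) \<in> H}"
    by (rule closedin_continuous_map_preimage[OF continuous_inv_mult H_closed])
  also have "{p \<in> topspace (subtopology ?P same_rng). gmult G (ginv G (fst p)) (snd p) \<in> H} = coset_rel G H"
    by (auto simp: same_rng_def coset_rel_iff topspace_gtop)
  finally show ?thesis using closedin_same_rng closedin_trans_full by blast
qed

text \<open>The quotient map is open and its kernel is closed: a box around \<open>(x, y)\<close> that misses the kernel
  maps to disjoint open sets.\<close>

lemma Hausdorff_CT: "Hausdorff_space CT"
  unfolding Hausdorff_space_def
proof (intro allI impI, elim conjE)
  fix a b assume a: "a \<in> topspace CT" and b: "b \<in> topspace CT" and "a \<noteq> b"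
  obtain x where x: "x \<in> arrows G" "a = coset x" using a by (rule coset_cases)
  obtain y where y: "y \<in> arrows G" "b = coset y" using b by (rule coset_cases)
  let ?P = "prod_topology (gtop G) (gtop G)"
  have "openin ?P (topspace ?P - coset_rel G H)" using closedin_coset_rel by blast
  moreover have "(x, y) \<in> topspace ?P - coset_rel G H"
    using x y \<open>a \<noteq> b\<close> coset_eq_iff by (auto simp: topspace_gtop)
  ultimately obtain N W where NW: "openin (gtop G) N" "openin (gtop G) W" "x \<in> N" "y \<in> W"
      "N \<times> W \<subseteq> topspace ?P - coset_rel G H"
    unfolding openin_prod_topology_alt by metis
  have "disjnt (coset ` N) (coset ` W)"
    unfolding disjnt_iff
  proof (intro allI notI, elim conjE imageE)
    fix c n w assume c: "n \<in> N" "w \<in> W" "c = coset n" "c = coset w"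
    have "n \<in> arrows G" "w \<in> arrows G" using c openin_subset[OF NW(1)] openin_subset[OF NW(2)] by (auto simp: topspace_gtop)
    then have "(n, w) \<in> coset_rel G H" using c coset_eq_iff by metis
    then show False using NW(5) c by auto
  qed
  then show "\<exists>U V. openin CT U \<and> openin CT V \<and> a \<in> U \<and> b \<in> V \<and> disjnt U V"
    using NW x y open_coset by (intro exI[of _ "coset ` N"] exI[of _ "coset ` W"]) auto
qed

lemma lcsc_CT: "lcsc CT"
proof
  show "second_countable CT"
    by (rule second_countable_open_map_image[OF continuous_coset open_map_coset coset_image second_countable])
  show "locally_compact_space CT"
    by (rule locally_compact_space_continuous_open_map_image[OF continuous_coset open_map_coset
          coset_image locally_compact])
qed (rule Hausdorff_CT)

lemma continuous_coset_rng: "continuous_map CT (unit_top G) (coset_rng G)"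
proof (rule continuous_compose_quotient_map[OF quotient_map_coset])
  show "continuous_map (gtop G) (unit_top G) (coset_rng G \<circ> coset)"
    by (rule continuous_map_eq[OF continuous_rng_unit]) (auto simp: topspace_gtop)
qed

text \<open>The pairs \<open>(y, \<omega>)\<close> for which the translate of \<open>\<omega>\<close> by the inverse of \<open>y\<close> is defined.\<close>

definition fibprod :: "('a \<times> 'a set) set" where
  "fibprod = {(y, \<omega>). y \<in> arrows G \<and> \<omega> \<in> topspace CT \<and> coset_rng G \<omega> = grng G y}"

lemma closedin_fibprod: "closedin (prod_topology (gtop G) CT) fibprod"
proof -
  have "fibprod = {p \<in> topspace (prod_topology (gtop G) CT). (coset_rng G \<circ> snd) p = (grng G \<circ> fst) p}"
    by (auto simp: fibprod_def topspace_gtop)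
  also have "closedin (prod_topology (gtop G) CT) \<dots>"
    by (rule closedin_continuous_maps_eq[OF lcsc.Hausdorff[OF lcsc_unit_top]])
      (rule continuous_map_compose[OF _ continuous_rng_unit] continuous_map_compose[OF _ continuous_coset_rng]
        continuous_map_fst continuous_map_snd)+
  finally show ?thesis .
qed

text \<open>Since the quotient map is open, a neighbourhood of \<open>(y, x)\<close> in \<open>G \<times> G\<close> maps to one of \<open>(y, xH)\<close>, and the
  action lifts to the continuous map \<open>(y, x) \<mapsto> y\<inverse>x\<close>.\<close>

lemma continuous_act_inv:
  "continuous_map (subtopology (prod_topology (gtop G) CT) fibprod) CT
     (\<lambda>p. coset_act G (ginv G (fst p)) (snd p))"
  unfolding continuous_map_def
proof (intro conjI allI impI)
  let ?P = "prod_topology (gtop G) CT" and ?Q = "prod_topology (gtop G) (gtop G)"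
  let ?a = "\<lambda>p. coset_act G (ginv G (fst p)) (snd p)"
  have ts: "topspace (subtopology ?P fibprod) = fibprod" by (auto simp: fibprod_def topspace_gtop)
  show "?a \<in> topspace (subtopology ?P fibprod) \<rightarrow> topspace CT"
    unfolding ts by (auto simp: fibprod_def)
  fix W assume W: "openin CT W"
  have W': "openin (gtop G) {x \<in> topspace (gtop G). coset x \<in> W}"
    by (rule openin_continuous_map_preimage[OF continuous_coset W])
  have "openin (subtopology ?Q same_rng) {p \<in> topspace (subtopology ?Q same_rng).
      gmult G (ginv G (fst p)) (snd p) \<in> {x \<in> topspace (gtop G). coset x \<in> W}}"
    by (rule openin_continuous_map_preimage[OF continuous_inv_mult W'])
  then obtain T where T: "openin ?Q T" "{p \<in> topspace (subtopology ?Q same_rng).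
      gmult G (ginv G (fst p)) (snd p) \<in> {x \<in> topspace (gtop G). coset x \<in> W}} = T \<inter> same_rng"
    unfolding openin_subtopology by metis
  have T': "p \<in> T \<longleftrightarrow> coset (gmult G (ginv G (fst p)) (snd p)) \<in> W" if "p \<in> same_rng" for p
    using T(2)[unfolded set_eq_iff, rule_format, of p] that by (auto simp: same_rng_def topspace_gtop)
  let ?V = "{p \<in> fibprod. ?a p \<in> W}"
  have "\<exists>S. openin ?P S \<and> p \<in> S \<and> S \<inter> fibprod \<subseteq> ?V" if p: "p \<in> ?V" for p
  proof -
    obtain y \<omega> where y: "p = (y, \<omega>)" "y \<in> arrows G" "\<omega> \<in> topspace CT" "coset_rng G \<omega> = grng G y"
      using p by (auto simp: fibprod_def)
    obtain x where x: "x \<in> arrows G" "\<omega> = coset x" using y(3) by (rule coset_cases)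
    have "(y, x) \<in> same_rng" using x y by (simp add: same_rng_def)
    then have "(y, x) \<in> T" using p x y T'[of "(y, x)"] by (simp add: same_rng_def)
    then obtain N M where NM: "openin (gtop G) N" "openin (gtop G) M" "y \<in> N" "x \<in> M" "N \<times> M \<subseteq> T"
      using T(1) unfolding openin_prod_topology_alt by metis
    have "openin ?P (N \<times> coset ` M)" using NM open_coset by (simp add: openin_prod_Times_iff)
    moreover have "p \<in> N \<times> coset ` M" using NM x y by auto
    moreover have "(N \<times> coset ` M) \<inter> fibprod \<subseteq> ?V"
    proof
      fix p' assume p': "p' \<in> (N \<times> coset ` M) \<inter> fibprod"
      then obtain n k where n: "p' = (n, coset k)" "n \<in> N" "k \<in> M" "p' \<in> fibprod" by auto
      have k: "k \<in> arrows G" using n(3) openin_subset[OF NM(2)] by (auto simp: topspace_gtop)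
      then have "(n, k) \<in> same_rng" using n by (auto simp: fibprod_def same_rng_def)
      then have "coset (gmult G (ginv G n) k) \<in> W" using T'[of "(n, k)"] n NM(5) by auto
      then show "p' \<in> ?V" using n k by (auto simp: fibprod_def)
    qed
    ultimately show ?thesis by blast
  qed
  note nbhd = this
  have "openin (subtopology ?P fibprod) ?V"
  proof (subst openin_subopen, intro ballI)
    fix p assume "p \<in> ?V"
    then obtain S where S: "openin ?P S" "p \<in> S" "S \<inter> fibprod \<subseteq> ?V" "p \<in> fibprod"
      using nbhd by blast
    then show "\<exists>T. openin (subtopology ?P fibprod) T \<and> p \<in> T \<and> T \<subseteq> ?V"
      by (intro exI[of _ "S \<inter> fibprod"] conjI openin_subtopology_Int) auto
  qed
  then show "openin (subtopology ?P fibprod) {p \<in> topspace (subtopology ?P fibprod). ?a p \<in> W}"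
    unfolding ts .
qed

end

section \<open>Convolution over the fibres\<close>

sublocale lc_groupoid \<subseteq> T: lcsc "gtop G" by (rule lcsc_gtop)
sublocale coset_space \<subseteq> C: lcsc CT by (rule lcsc_CT)

context coset_space
begin

text \<open>The translate \<open>\<phi>(y\<inverse>\<omega>)\<close>, extended by 0. The extension is Borel on the whole product because the fibred
  product is closed, and it turns integrals over a fibre of \<open>G\<close> or of \<open>G/H\<close> into integrals over the whole
  space.\<close>

definition ktr :: "('a set \<Rightarrow> complex) \<Rightarrow> 'a \<Rightarrow> 'a set \<Rightarrow> complex" where
  "ktr \<phi> y \<omega> = (if (y, \<omega>) \<in> fibprod then \<phi> (coset_act G (ginv G y) \<omega>) else 0)"

lemma fibprod_iff: "(y, \<omega>) \<in> fibprod \<longleftrightarrow> y \<in> arrows G \<and> \<omega> \<in> topspace CT \<and> coset_rng G \<omega> = grng G y"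
  by (simp add: fibprod_def)

lemma continuous_ktr:
  assumes "\<phi> \<in> Cc CT"
  shows "continuous_map (subtopology (prod_topology (gtop G) CT) fibprod) euclidean
    (\<lambda>p. ktr \<phi> (fst p) (snd p))"
  by (rule continuous_map_eq[OF continuous_map_compose[OF continuous_act_inv C.Cc_continuous[OF assms]]])
    (auto simp: ktr_def)

lemma measurable_ktr:
  assumes "\<phi> \<in> Cc CT"
  shows "(\<lambda>p. ktr \<phi> (fst p) (snd p)) \<in> borel_measurable (borel_of (gtop G) \<Otimes>\<^sub>M borel_of CT)"
  by (rule borel_measurable_pair_closed_extension[OF T.second_countable C.second_countable
        closedin_fibprod continuous_ktr[OF assms], of 0])
    (auto simp: ktr_def)

lemma measurable_ktr1:
  assumes "\<phi> \<in> Cc CT" "\<omega> \<in> topspace CT"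
  shows "(\<lambda>y. ktr \<phi> y \<omega>) \<in> borel_measurable (borel_of (gtop G))"
  using measurable_Pair1[OF measurable_ktr[OF assms(1)], of \<omega>] assms(2) by simp

lemma measurable_ktr2:
  assumes "\<phi> \<in> Cc CT" "y \<in> arrows G"
  shows "ktr \<phi> y \<in> borel_measurable (borel_of CT)"
  using measurable_Pair2[OF measurable_ktr[OF assms(1)], of y] assms(2) by (simp add: topspace_gtop)

lemma ktr_bounded:
  assumes "\<phi> \<in> Cc CT"
  obtains B where "0 \<le> B" "\<And>y \<omega>. norm (ktr \<phi> y \<omega>) \<le> B"
proof -
  obtain B where "0 \<le> B" "\<And>x. norm (\<phi> x) \<le> B" by (rule C.Cc_bounded[OF assms]) blast
  then show ?thesis by (intro that[of B]) (auto simp: ktr_def)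
qed

lemma L_Cc_eq:
  assumes "\<omega> \<in> topspace CT"
  shows "L_Cc G H m \<theta> \<phi> \<omega> = (LINT y|m (coset_rng G \<omega>). \<theta> y * ktr \<phi> y \<omega>)"
proof -
  have "(\<lambda>y. indicator (rfibre G (coset_rng G \<omega>)) y *\<^sub>R (\<theta> y * \<phi> (coset_act G (ginv G y) \<omega>)))
      = (\<lambda>y. \<theta> y * ktr \<phi> y \<omega>)"
  proof
    fix y show "indicator (rfibre G (coset_rng G \<omega>)) y *\<^sub>R (\<theta> y * \<phi> (coset_act G (ginv G y) \<omega>)) = \<theta> y * ktr \<phi> y \<omega>"
      using assms by (cases "(y, \<omega>) \<in> fibprod") (auto simp: rfibre_def ktr_def fibprod_iff)
  qed
  then show ?thesis using assms by (simp add: L_Cc_def set_lebesgue_integral_def)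
qed

text \<open>The product \<open>AB\<close> of \<open>A \<subseteq> G\<close> and \<open>B \<subseteq> G/H\<close>. It is described through inverses so that it is the image of
  a compact set under the map of \<open>continuous_act_inv\<close>.\<close>

definition translates :: "'a set \<Rightarrow> 'a set set \<Rightarrow> 'a set set" where
  "translates A B = (\<lambda>p. coset_act G (ginv G (fst p)) (snd p)) ` (ginv G ` A \<times> B \<inter> fibprod)"

lemma compactin_translates:
  assumes A: "compactin (gtop G) A" and B: "compactin CT B"
  shows "compactin CT (translates A B)"
proof -
  let ?P = "prod_topology (gtop G) CT"
  have "compactin ?P (ginv G ` A \<times> B)"
    using image_compactin[OF A continuous_inv] B by (simp add: compactin_Times)
  then have "compactin ?P (ginv G ` A \<times> B \<inter> fibprod)"
    using closed_Int_compactin[OF closedin_fibprod] by (metis inf_commute)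
  then have "compactin (subtopology ?P fibprod) (ginv G ` A \<times> B \<inter> fibprod)"
    by (simp add: compactin_subtopology)
  then show ?thesis
    unfolding translates_def by (rule image_compactin[OF _ continuous_act_inv])
qed

lemma ktr_zero_outside:
  assumes B: "\<And>\<omega>. \<omega> \<notin> B \<Longrightarrow> \<phi> \<omega> = 0" and "y \<in> A" "\<omega> \<notin> translates A B"
  shows "ktr \<phi> y \<omega> = 0"
proof (rule ccontr)
  assume nz: "ktr \<phi> y \<omega> \<noteq> 0"
  then have f: "y \<in> arrows G" "\<omega> \<in> topspace CT" "coset_rng G \<omega> = grng G y"
    by (auto simp: ktr_def fibprod_iff split: if_splits)
  let ?b = "coset_act G (ginv G y) \<omega>"
  have "?b \<in> B" using nz B f by (auto simp: ktr_def fibprod_iff)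
  moreover have "(ginv G y, ?b) \<in> fibprod" using f by (simp add: fibprod_iff)
  moreover have "coset_act G (ginv G (ginv G y)) ?b = \<omega>"
    using coset_act_inv[of "ginv G y" \<omega>] f by simp
  ultimately have "\<omega> \<in> translates A B"
    unfolding translates_def using assms(2) by (intro image_eqI[of _ _ "(ginv G y, ?b)"]) auto
  then show False using assms by simp
qed

lemma integrable_mult_ktr:
  assumes F: "fibred (gtop G) (grng G) (unit_top G) m"
    and \<theta>: "\<theta> \<in> Cc (gtop G)" and \<phi>: "\<phi> \<in> Cc CT" and \<omega>: "\<omega> \<in> topspace CT" and u: "u \<in> gunits G"
  shows "integrable (m u) (\<lambda>y. \<theta> y * ktr \<phi> y \<omega>)"
proof -
  interpret F: fibred "gtop G" "grng G" "unit_top G" m by (rule F)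
  obtain b where b: "0 \<le> b" "\<And>y \<omega>. norm (ktr \<phi> y \<omega>) \<le> b" by (rule ktr_bounded[OF \<phi>]) blast
  show ?thesis
  proof (rule Bochner_Integration.integrable_bound)
    show "integrable (m u) (\<lambda>y. \<theta> y * of_real b)"
      using F.Cc_integrable[OF _ \<theta>, of u] u by simp
    show "AE y in m u. norm (\<theta> y * ktr \<phi> y \<omega>) \<le> norm (\<theta> y * of_real b)"
      using b by (auto simp: norm_mult intro!: mult_left_mono)
    show "(\<lambda>y. \<theta> y * ktr \<phi> y \<omega>) \<in> borel_measurable (m u)"
      using measurable_ktr1[OF \<phi> \<omega>] F.Cc_measurable[OF _ \<theta>, of u] u
      by (auto simp: F.measurable_m)
  qed
qed

text \<open>Fix \<open>\<omega>\<^sub>0\<close> and extend the integrand from the closed fibre of its range to all of \<open>G\<close> by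
  Tietze's theorem. The integral of the extension depends continuously on the base point, and the
  extension is uniformly close to the true integrand for \<open>\<omega>\<close> near \<open>\<omega>\<^sub>0\<close>, since projection along
  the compact support of \<open>\<theta>\<close> is a closed map.\<close>

lemma L_Cc_in_Cc:
  assumes F: "fibred (gtop G) (grng G) (unit_top G) m"
    and \<theta>: "\<theta> \<in> Cc (gtop G)" and \<phi>: "\<phi> \<in> Cc CT"
  shows "L_Cc G H m \<theta> \<phi> \<in> Cc CT"
proof -
  interpret F: fibred "gtop G" "grng G" "unit_top G" m by (rule F)
  let ?P = "prod_topology (gtop G) CT"
  obtain A where A: "compactin (gtop G) A" "\<And>x. x \<notin> A \<Longrightarrow> \<theta> x = 0" by (rule T.Cc_E[OF \<theta>]) blast
  obtain B where B: "compactin CT B" "\<And>x. x \<notin> B \<Longrightarrow> \<phi> x = 0" by (rule C.Cc_E[OF \<phi>]) blast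
  note ik = integrable_mult_ktr[OF F \<theta> \<phi>]
  have "continuous_map CT euclidean (L_Cc G H m \<theta> \<phi>)"
  proof (rule continuous_map_dist_I)
    fix w0 and e :: real assume w0: "w0 \<in> topspace CT" and e: "0 < e"
    define u0 where "u0 = coset_rng G w0"
    have u0: "u0 \<in> gunits G" using w0 by (simp add: u0_def)
    define N where "N u = (LINT y|m u. norm (\<theta> y))" for u
    have N0: "N u0 \<ge> 0" by (simp add: N_def)
    \<comment> \<open>near \<open>w0\<close> the integral of \<open>\<bar>\<theta>\<bar>\<close> is below \<open>N u0 + 1\<close>, so an integrand error of \<open>d\<close> costs less than \<open>e / 2\<close>\<close>
    define d where "d = e / 2 / (N u0 + 2)"
    have d: "d > 0" using e N0 by (simp add: d_def)
    have dN: "d * (N u0 + 1) < e / 2"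
    proof -
      have "d * (N u0 + 1) < d * (N u0 + 2)" using d by simp
      also have "\<dots> = e / 2" using N0 nonzero_eq_divide_eq[of "N u0 + 2" d "e / 2"] d_def by linarith
      finally show ?thesis .
    qed
    let ?S = "{y \<in> topspace (gtop G). grng G y = u0}"
    have S: "closedin (gtop G) ?S"
      by (rule closedin_continuous_maps_eq[OF Hausdorff continuous_rng]) (use u0 gunits_arrows in \<open>simp add: topspace_gtop\<close>)
    have "continuous_map (subtopology (gtop G) ?S) (subtopology ?P fibprod) (\<lambda>y. (y, w0))"
      using w0 by (auto simp: continuous_map_in_subtopology continuous_map_pairwise o_def fibprod_iff
          topspace_gtop u0_def continuous_map_from_subtopology)
    from continuous_map_compose[OF this continuous_ktr[OF \<phi>]]
    have cS: "continuous_map (subtopology (gtop G) ?S) euclidean (\<lambda>y. ktr \<phi> y w0)"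
      by (simp add: o_def)
    have cR: "continuous_map (subtopology (gtop G) ?S) euclidean (\<lambda>y. Re (ktr \<phi> y w0))"
      using continuous_map_compose[OF cS, of euclidean Re] by (simp add: o_def continuous_on_Re)
    have cI: "continuous_map (subtopology (gtop G) ?S) euclidean (\<lambda>y. Im (ktr \<phi> y w0))"
      using continuous_map_compose[OF cS, of euclidean Im] by (simp add: o_def continuous_on_Im)
    obtain gr where gr: "continuous_map (gtop G) euclidean gr" "\<And>y. y \<in> ?S \<Longrightarrow> gr y = Re (ktr \<phi> y w0)"
      by (rule Tietze_extension_realinterval[OF T.normal S is_interval_univ UNIV_not_empty cR subset_UNIV]) blast
    obtain gi where gi: "continuous_map (gtop G) euclidean gi" "\<And>y. y \<in> ?S \<Longrightarrow> gi y = Im (ktr \<phi> y w0)"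
      by (rule Tietze_extension_realinterval[OF T.normal S is_interval_univ UNIV_not_empty cI subset_UNIV]) blast
    define \<psi> where "\<psi> y = Complex (gr y) (gi y)" for y
    have "continuous_map (gtop G) (prod_topology euclidean euclidean) (\<lambda>y. (gr y, gi y))"
      unfolding continuous_map_pairwise using gr(1) gi(1) by (simp add: o_def)
    from continuous_map_compose[OF this, of euclidean "\<lambda>p. Complex (fst p) (snd p)"]
    have \<psi>c: "continuous_map (gtop G) euclidean \<psi>"
      by (simp add: o_def \<psi>_def[abs_def] continuous_on_Complex continuous_on_fst continuous_on_snd)
    have \<psi>S: "\<psi> y = ktr \<phi> y w0" if "y \<in> ?S" for y
      using gr(2)[OF that] gi(2)[OF that] by (simp add: \<psi>_def complex_eq_iff)
    have FC: "(\<lambda>y. \<psi> y * \<theta> y) \<in> Cc (gtop G)" by (rule T.Cc_mult_continuous[OF \<theta> \<psi>c])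
    define I where "I u = (LINT y|m u. \<psi> y * \<theta> y)" for u
    \<comment> \<open>the points where the integrand and its extension differ noticeably; their projection to \<open>G/H\<close> is
      closed and avoids \<open>w0\<close>\<close>
    define bad where "bad = {p \<in> fibprod. fst p \<in> A \<and> d \<le> norm (ktr \<phi> (fst p) (snd p) - \<psi> (fst p))}"
    have bad_closed: "closedin ?P bad"
    proof -
      have ts: "topspace (subtopology ?P fibprod) = fibprod" by (auto simp: fibprod_def topspace_gtop)
      have "continuous_map (subtopology ?P fibprod) euclidean (\<lambda>p. ktr \<phi> (fst p) (snd p) - \<psi> (fst p))"
      proof (rule continuous_map_diff[OF continuous_ktr[OF \<phi>]])
        show "continuous_map (subtopology ?P fibprod) euclidean (\<lambda>p. \<psi> (fst p))"
          using continuous_map_compose[OF continuous_map_from_subtopology[OF continuous_map_fst] \<psi>c]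
          by (simp add: o_def)
      qed
      then have "closedin (subtopology ?P fibprod)
         {p \<in> topspace (subtopology ?P fibprod). ktr \<phi> (fst p) (snd p) - \<psi> (fst p) \<in> {z. d \<le> norm z}}"
        by (rule closedin_continuous_map_preimage) (simp add: closed_Collect_le continuous_on_norm continuous_on_id)
      then have "closedin ?P {p \<in> fibprod. d \<le> norm (ktr \<phi> (fst p) (snd p) - \<psi> (fst p))}"
        unfolding ts using closedin_trans_full[OF _ closedin_fibprod] by simp
      moreover have "closedin ?P (A \<times> topspace CT)"
        using T.compactin_imp_closedin[OF A(1)] by (simp add: closedin_prod_Times_iff)
      ultimately have "closedin ?P ({p \<in> fibprod. d \<le> norm (ktr \<phi> (fst p) (snd p) - \<psi> (fst p))} \<inter> (A \<times> topspace CT))"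
        by (rule closedin_Int)
      also have "\<dots> = bad" by (auto simp: bad_def fibprod_def)
      finally show ?thesis .
    qed
    have bad_proj: "closedin CT (snd ` bad)"
    proof -
      have "closedin (prod_topology (subtopology (gtop G) A) CT) bad"
      proof -
        have "prod_topology (subtopology (gtop G) A) CT = subtopology ?P (A \<times> topspace CT)"
          using prod_topology_subtopology(1)[of "gtop G" A CT] by simp
        moreover have "bad \<subseteq> A \<times> topspace CT" by (auto simp: bad_def fibprod_def)
        ultimately show ?thesis using bad_closed by (simp add: closedin_subset_topspace)
      qed
      moreover have "closed_map (prod_topology (subtopology (gtop G) A) CT) CT snd"
        by (rule closed_map_snd) (use A in \<open>simp add: compact_space_subtopology\<close>)
      ultimately show ?thesis by (simp add: closed_map_def)
    qed
    define U where "U = (topspace CT - snd ` bad) \<inter>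
      {w \<in> topspace CT. coset_rng G w \<in> {u \<in> topspace (unit_top G). I u \<in> ball (I u0) (e / 2)}} \<inter>
      {w \<in> topspace CT. coset_rng G w \<in> {u \<in> topspace (unit_top G). N u \<in> {..<N u0 + 1}}}"
    have "openin CT U"
      unfolding U_def
    proof (intro openin_Int openin_diff openin_topspace bad_proj
        openin_continuous_map_preimage[OF continuous_coset_rng])
      show "openin (unit_top G) {u \<in> topspace (unit_top G). I u \<in> ball (I u0) (e / 2)}"
        by (rule openin_continuous_map_preimage[of _ euclidean])
          (use F.continuous_integral[OF FC] in \<open>simp_all add: I_def[abs_def]\<close>)
      show "openin (unit_top G) {u \<in> topspace (unit_top G). N u \<in> {..<N u0 + 1}}"
        by (rule openin_continuous_map_preimage[of _ euclidean])
          (use F.continuous_integral_norm[OF \<theta>] in \<open>simp_all add: N_def[abs_def]\<close>)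
    qed
    moreover have "w0 \<in> U"
    proof -
      have "w0 \<notin> snd ` bad"
      proof
        assume "w0 \<in> snd ` bad"
        then obtain y where y: "(y, w0) \<in> bad" by auto
        then have "y \<in> ?S" by (auto simp: bad_def fibprod_def u0_def topspace_gtop)
        then show False using y \<psi>S[of y] d by (simp add: bad_def)
      qed
      then show ?thesis using w0 u0 e by (simp add: U_def u0_def)
    qed
    moreover have "dist (L_Cc G H m \<theta> \<phi> w) (L_Cc G H m \<theta> \<phi> w0) < e" if w: "w \<in> U" for w
    proof -
      define u where "u = coset_rng G w"
      have wT: "w \<in> topspace CT" and wb: "w \<notin> snd ` bad" and wI: "dist (I u) (I u0) < e / 2"
        and wN: "N u < N u0 + 1"
        using w by (auto simp: U_def u_def dist_commute)
      have u: "u \<in> gunits G" using wT by (simp add: u_def)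
      have iF: "integrable (m v) (\<lambda>y. \<psi> y * \<theta> y)" if "v \<in> gunits G" for v
        by (rule F.Cc_integrable[OF _ FC]) (use that in simp)
      have "L_Cc G H m \<theta> \<phi> w - I u = (LINT y|m u. \<theta> y * ktr \<phi> y w - \<psi> y * \<theta> y)"
        unfolding L_Cc_eq[OF wT] I_def u_def[symmetric]
        by (rule Bochner_Integration.integral_diff[symmetric, OF ik[OF wT u] iF[OF u]])
      also have "norm \<dots> \<le> (LINT y|m u. norm (\<theta> y * ktr \<phi> y w - \<psi> y * \<theta> y))"
        by (rule integral_norm_bound)
      also have "\<dots> \<le> (LINT y|m u. d * norm (\<theta> y))"
      proof (rule integral_mono_AE)
        show "integrable (m u) (\<lambda>y. norm (\<theta> y * ktr \<phi> y w - \<psi> y * \<theta> y))"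
          by (intro integrable_norm Bochner_Integration.integrable_diff ik[OF wT u] iF[OF u])
        show "integrable (m u) (\<lambda>y. d * norm (\<theta> y))"
          using F.Cc_integrable[OF _ \<theta>, of u] u by simp
        have "AE y in m u. grng G y = u" using F.AE_fibre[of u] u by simp
        moreover have "AE y in m u. y \<in> arrows G"
          using F.space_m[of u] u by (intro AE_I2) (simp add: topspace_gtop)
        ultimately show "AE y in m u. norm (\<theta> y * ktr \<phi> y w - \<psi> y * \<theta> y) \<le> d * norm (\<theta> y)"
        proof eventually_elim
          case (elim y)
          show ?case
          proof (cases "y \<in> A")
            case True
            have "(y, w) \<in> fibprod" using elim wT by (simp add: fibprod_iff u_def)
            moreover have "(y, w) \<notin> bad" using wb image_eqI[of w snd "(y, w)" bad] by auto
            ultimately have "norm (ktr \<phi> y w - \<psi> y) \<le> d" using True by (simp add: bad_def)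
            then have "norm (\<theta> y) * norm (ktr \<phi> y w - \<psi> y) \<le> norm (\<theta> y) * d"
              by (intro mult_left_mono) auto
            then show ?thesis
              by (simp add: norm_mult[symmetric] right_diff_distrib mult.commute)
          qed (simp add: A(2))
        qed
      qed
      also have "\<dots> = d * N u" by (simp add: N_def)
      also have "\<dots> \<le> d * (N u0 + 1)" using wN d by (intro mult_left_mono) auto
      also have "\<dots> < e / 2" by (rule dN)
      finally have 1: "norm (L_Cc G H m \<theta> \<phi> w - I u) < e / 2" .
      have "L_Cc G H m \<theta> \<phi> w0 = I u0"
        unfolding L_Cc_eq[OF w0] I_def u0_def[symmetric]
      proof (rule integral_cong_AE)
        show "(\<lambda>y. \<theta> y * ktr \<phi> y w0) \<in> borel_measurable (m u0)" using ik[OF w0 u0] by (rule borel_measurable_integrable)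
        show "(\<lambda>y. \<psi> y * \<theta> y) \<in> borel_measurable (m u0)" using iF[OF u0] by auto
        have "AE y in m u0. grng G y = u0" using F.AE_fibre[of u0] u0 by simp
        moreover have "AE y in m u0. y \<in> arrows G"
          using F.space_m[of u0] u0 by (intro AE_I2) (simp add: topspace_gtop)
        ultimately show "AE y in m u0. \<theta> y * ktr \<phi> y w0 = \<psi> y * \<theta> y"
          by eventually_elim (use \<psi>S in \<open>simp add: topspace_gtop\<close>)
      qed
      then have "dist (L_Cc G H m \<theta> \<phi> w) (L_Cc G H m \<theta> \<phi> w0)
          \<le> norm (L_Cc G H m \<theta> \<phi> w - I u) + dist (I u) (I u0)"
        using dist_triangle[of "L_Cc G H m \<theta> \<phi> w" "I u0" "I u"] by (simp add: dist_norm)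
      then show ?thesis using 1 wI by simp
    qed
    ultimately show "\<exists>U. openin CT U \<and> w0 \<in> U \<and> (\<forall>y\<in>U. dist (L_Cc G H m \<theta> \<phi> y) (L_Cc G H m \<theta> \<phi> w0) < e)"
      by blast
  qed
  moreover have "L_Cc G H m \<theta> \<phi> \<omega> = 0" if "\<omega> \<notin> translates A B" for \<omega>
  proof (cases "\<omega> \<in> topspace CT")
    case True
    have z: "\<theta> y * ktr \<phi> y \<omega> = 0" for y
      using A(2)[of y] ktr_zero_outside[OF B(2) _ that] by (cases "y \<in> A") auto
    show ?thesis unfolding L_Cc_eq[OF True] z by simp
  qed (simp add: L_Cc_def)
  ultimately show ?thesis by (rule C.Cc_I[OF _ compactin_translates[OF A(1) B(1)]])
qed

end

section \<open>Estimates for convolutions\<close>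

locale coset_system = coset_space G H lamH
  for G :: "'a groupoid" and H :: "'a set" and lamH :: "'a \<Rightarrow> 'a measure" +
  fixes mu :: "'a \<Rightarrow> 'a set measure"
  assumes equivariant_system: "full_equivariant_system G H mu"
begin

lemma fibred_mu: "fibred CT (coset_rng G) (unit_top G) mu"
proof (intro fibred.intro fibred_axioms.intro lcsc_CT continuous_coset_rng)
  show "fibred_system CT (coset_rng G) (unit_top G) mu"
    by (rule fibred_systemI_msupport[OF lcsc_CT])
      (use equivariant_system in \<open>auto simp: full_equivariant_system_def radon_measure_def coset_fibre_def\<close>)
qed

end

sublocale coset_system \<subseteq> Mu: fibred CT "coset_rng G" "unit_top G" mu
  by (rule fibred_mu)

context coset_system
begin

text \<open>This is the equivariance of \<open>\<mu>\<close> applied to \<open>\<bar>\<phi>\<bar>\<close>. The equivariance is an identity of Bochner integrals;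
  the translate is bounded with relatively compact support, hence integrable, and so the identity
  carries over to the extended integral.\<close>

lemma nn_integral_ktr:
  assumes y: "y \<in> arrows G" and \<phi>: "\<phi> \<in> Cc CT"
  shows "(\<integral>\<^sup>+\<omega>. ennreal (norm (ktr \<phi> y \<omega>)) \<partial>mu (grng G y))
    = ennreal (LINT \<omega>|mu (gdom G y). norm (\<phi> \<omega>))"
proof -
  let ?u = "grng G y"
  define f where "f = (\<lambda>\<omega>. complex_of_real (norm (\<phi> \<omega>)))"
  have f: "f \<in> Cc CT" unfolding f_def by (rule C.Cc_norm[OF \<phi>])
  have ru: "?u \<in> topspace (unit_top G)" using y by simp
  obtain B where B: "compactin CT B" "\<And>x. x \<notin> B \<Longrightarrow> \<phi> x = 0" by (rule C.Cc_E[OF \<phi>]) blast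
  obtain b where b: "0 \<le> b" "\<And>y \<omega>. norm (ktr \<phi> y \<omega>) \<le> b" by (rule ktr_bounded[OF \<phi>]) blast
  have K: "compactin CT (translates {y} B)"
    by (rule compactin_translates[OF _ B(1)]) (use y in \<open>simp add: topspace_gtop\<close>)
  have int: "integrable (mu ?u) (ktr \<phi> y)"
  proof (rule integrableI_bounded_set[where A="translates {y} B" and B=b])
    show "translates {y} B \<in> sets (mu ?u)"
      using C.compactin_imp_closedin[OF K] by (simp add: Mu.sets_m[OF ru] closedin_sets_borel_of)
    show "ktr \<phi> y \<in> borel_measurable (mu ?u)"
      using measurable_ktr2[OF \<phi> y] by (simp add: Mu.measurable_m[OF ru])
    show "emeasure (mu ?u) (translates {y} B) < \<infinity>" by (rule Mu.emeasure_compact[OF ru K])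
    show "AE \<omega> in mu ?u. \<omega> \<notin> translates {y} B \<longrightarrow> ktr \<phi> y \<omega> = 0"
      by (intro AE_I2 impI ktr_zero_outside[where A="{y}" and B=B, OF B(2)]) auto
  qed (use b in auto)
  have kf: "ktr f y \<omega> = complex_of_real (norm (ktr \<phi> y \<omega>))" for \<omega>
    by (simp add: ktr_def f_def)
  have "\<forall>g\<in>arrows G. \<forall>f\<in>Cc CT. (LINT \<omega>:coset_fibre G H (gdom G g)|mu (gdom G g). f (coset_act G g \<omega>))
        = (LINT \<omega>|mu (grng G g). f \<omega>)"
    using equivariant_system by (simp add: full_equivariant_system_def)
  from this[rule_format, of "ginv G y" f]
  have "(LINT \<omega>:coset_fibre G H ?u|mu ?u. f (coset_act G (ginv G y) \<omega>)) = (LINT \<omega>|mu (gdom G y). f \<omega>)"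
    using y f by simp
  moreover have "indicator (coset_fibre G H ?u) \<omega> *\<^sub>R f (coset_act G (ginv G y) \<omega>) = ktr f y \<omega>" for \<omega>
    using y by (cases "(y, \<omega>) \<in> fibprod") (auto simp: coset_fibre_def ktr_def fibprod_iff)
  ultimately have "(LINT \<omega>|mu ?u. ktr f y \<omega>) = (LINT \<omega>|mu (gdom G y). f \<omega>)"
    by (simp add: set_lebesgue_integral_def)
  then have "(LINT \<omega>|mu ?u. complex_of_real (norm (ktr \<phi> y \<omega>)))
      = (LINT \<omega>|mu (gdom G y). complex_of_real (norm (\<phi> \<omega>)))"
    unfolding kf by (simp only: f_def)
  then have "(LINT \<omega>|mu ?u. norm (ktr \<phi> y \<omega>)) = (LINT \<omega>|mu (gdom G y). norm (\<phi> \<omega>))"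
    by (simp only: integral_complex_of_real of_real_eq_iff)
  then show ?thesis
    using nn_integral_eq_integral[OF integrable_norm[OF int]] by simp
qed

lemma nn_integral_ktr_le:
  assumes \<phi>: "\<phi> \<in> Cc CT" and le: "\<And>v. v \<in> gunits G \<Longrightarrow> (LINT \<omega>|mu v. norm (\<phi> \<omega>)) \<le> 1"
    and w: "w \<in> arrows G" and u: "u \<in> gunits G"
  shows "(\<integral>\<^sup>+\<omega>. ennreal (norm (ktr \<phi> w \<omega>)) \<partial>mu u) \<le> 1"
proof (cases "grng G w = u")
  case True
  then show ?thesis using nn_integral_ktr[OF w \<phi>] le[of "gdom G w"] w by simp
next
  case False
  have "AE \<omega> in mu u. coset_rng G \<omega> = u" using Mu.AE_fibre u by simp
  then have "AE \<omega> in mu u. ennreal (norm (ktr \<phi> w \<omega>)) = 0"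
    by eventually_elim (use False in \<open>auto simp: ktr_def fibprod_iff\<close>)
  then have "(\<integral>\<^sup>+\<omega>. ennreal (norm (ktr \<phi> w \<omega>)) \<partial>mu u) = (\<integral>\<^sup>+\<omega>. 0 \<partial>mu u)"
    by (rule nn_integral_cong_AE)
  then show ?thesis by simp
qed

lemma measurable_pair_mult_ktr:
  assumes u: "u \<in> gunits G" and \<theta>: "\<theta> \<in> borel_measurable (borel_of (gtop G))"
    and \<phi>: "\<phi> \<in> Cc CT" and Q: "sets Q = sets (borel_of (gtop G))"
  shows "(\<lambda>p. \<theta> (fst p) * ktr \<phi> (fst p) (snd p)) \<in> borel_measurable (Q \<Otimes>\<^sub>M mu u)"
proof -
  have "sets (Q \<Otimes>\<^sub>M mu u) = sets (borel_of (gtop G) \<Otimes>\<^sub>M borel_of CT)"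
    by (rule sets_pair_measure_cong[OF Q]) (use Mu.sets_m u in simp)
  then have eq: "borel_measurable (Q \<Otimes>\<^sub>M mu u) = borel_measurable (borel_of (gtop G) \<Otimes>\<^sub>M borel_of CT)"
    by (rule measurable_cong_sets) simp
  have "(\<lambda>p. \<theta> (fst p)) \<in> borel_measurable (borel_of (gtop G) \<Otimes>\<^sub>M borel_of CT)"
    using measurable_compose[OF measurable_fst \<theta>] .
  then have "(\<lambda>p. \<theta> (fst p) * ktr \<phi> (fst p) (snd p))
      \<in> borel_measurable (borel_of (gtop G) \<Otimes>\<^sub>M borel_of CT)"
    by (intro borel_measurable_times measurable_ktr[OF \<phi>])
  then show ?thesis unfolding eq .
qed

lemma nn_integral_norm_L_Cc_cong:
  assumes u: "u \<in> gunits G"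
  shows "(\<integral>\<^sup>+\<omega>. ennreal (norm (L_Cc G H m \<theta> \<phi> \<omega>)) \<partial>mu u)
    = (\<integral>\<^sup>+\<omega>. ennreal (norm (LINT y|m u. \<theta> y * ktr \<phi> y \<omega>)) \<partial>mu u)"
proof (rule nn_integral_cong_AE)
  have "AE \<omega> in mu u. coset_rng G \<omega> = u" using Mu.AE_fibre u by simp
  moreover have "AE \<omega> in mu u. \<omega> \<in> topspace CT" using Mu.space_m[of u] u by (intro AE_I2) simp
  ultimately show "AE \<omega> in mu u. ennreal (norm (L_Cc G H m \<theta> \<phi> \<omega>))
      = ennreal (norm (LINT y|m u. \<theta> y * ktr \<phi> y \<omega>))"
    by eventually_elim (simp add: L_Cc_eq)
qed

lemma nn_integral_iterated_ktr:
  assumes F: "fibred (gtop G) (grng G) (unit_top G) m" and \<phi>: "\<phi> \<in> Cc CT" and u: "u \<in> gunits G"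
  shows "(\<integral>\<^sup>+y. (\<integral>\<^sup>+\<omega>. ennreal (norm (\<theta> y * ktr \<phi> y \<omega>)) \<partial>mu u) \<partial>m u)
    = (\<integral>\<^sup>+y. ennreal (norm (\<theta> y) * (LINT \<omega>|mu (gdom G y). norm (\<phi> \<omega>))) \<partial>m u)"
proof (rule nn_integral_cong_AE)
  interpret F: fibred "gtop G" "grng G" "unit_top G" m by (rule F)
  have "AE y in m u. grng G y = u" using F.AE_fibre[of u] u by simp
  moreover have "AE y in m u. y \<in> arrows G"
    using F.space_m[of u] u by (intro AE_I2) (simp add: topspace_gtop)
  ultimately show "AE y in m u. (\<integral>\<^sup>+\<omega>. ennreal (norm (\<theta> y * ktr \<phi> y \<omega>)) \<partial>mu u)
      = ennreal (norm (\<theta> y) * (LINT \<omega>|mu (gdom G y). norm (\<phi> \<omega>)))"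
  proof eventually_elim
    case (elim y)
    have "(\<integral>\<^sup>+\<omega>. ennreal (norm (\<theta> y * ktr \<phi> y \<omega>)) \<partial>mu u)
        = (\<integral>\<^sup>+\<omega>. ennreal (norm (\<theta> y)) * ennreal (norm (ktr \<phi> y \<omega>)) \<partial>mu u)"
      by (simp add: norm_mult ennreal_mult)
    also have "\<dots> = ennreal (norm (\<theta> y)) * (\<integral>\<^sup>+\<omega>. ennreal (norm (ktr \<phi> y \<omega>)) \<partial>mu u)"
    proof (rule nn_integral_cmult)
      have "ktr \<phi> y \<in> borel_measurable (mu u)"
        using measurable_ktr2[OF \<phi> elim(2)] u by (simp add: Mu.measurable_m)
      then show "(\<lambda>\<omega>. ennreal (norm (ktr \<phi> y \<omega>))) \<in> borel_measurable (mu u)" by simp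
    qed
    also have "(\<integral>\<^sup>+\<omega>. ennreal (norm (ktr \<phi> y \<omega>)) \<partial>mu u) = ennreal (LINT \<omega>|mu (gdom G y). norm (\<phi> \<omega>))"
      using nn_integral_ktr[OF elim(2) \<phi>] elim(1) by simp
    finally show ?case by (simp add: ennreal_mult)
  qed
qed

text \<open>The triangle inequality for the \<open>L\<^sup>1\<close> norm, followed by the equivariance of \<open>\<mu>\<close>.\<close>

lemma nn_integral_L_Cc_le:
  assumes F: "fibred (gtop G) (grng G) (unit_top G) m"
    and \<theta>: "\<theta> \<in> Cc (gtop G)" and \<phi>: "\<phi> \<in> Cc CT" and u: "u \<in> gunits G"
  shows "(\<integral>\<^sup>+\<omega>. ennreal (norm (L_Cc G H m \<theta> \<phi> \<omega>)) \<partial>mu u)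
    \<le> (\<integral>\<^sup>+y. ennreal (norm (\<theta> y) * (LINT \<omega>|mu (gdom G y). norm (\<phi> \<omega>))) \<partial>m u)"
proof -
  interpret F: fibred "gtop G" "grng G" "unit_top G" m by (rule F)
  have meas: "(\<lambda>p. \<theta> (fst p) * ktr \<phi> (fst p) (snd p)) \<in> borel_measurable (m u \<Otimes>\<^sub>M mu u)"
    by (rule measurable_pair_mult_ktr[OF u _ \<phi>])
      (use F.sets_m[of u] F.Cc_measurable[OF _ \<theta>, of u] F.measurable_m[of u] u in auto)
  have "(\<integral>\<^sup>+\<omega>. ennreal (norm (LINT y|m u. \<theta> y * ktr \<phi> y \<omega>)) \<partial>mu u)
      \<le> (\<integral>\<^sup>+y. (\<integral>\<^sup>+\<omega>. ennreal (norm (\<theta> y * ktr \<phi> y \<omega>)) \<partial>mu u) \<partial>m u)"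
    using nn_integral_norm_integral_le[OF F.sigma_finite Mu.sigma_finite meas] u by simp
  then show ?thesis
    unfolding nn_integral_norm_L_Cc_cong[OF u] nn_integral_iterated_ktr[OF F \<phi> u] .
qed

text \<open>For nonnegative functions the triangle inequality is an equality, by Tonelli's theorem.\<close>

lemma L_Cc_nonneg:
  assumes F: "fibred (gtop G) (grng G) (unit_top G) m"
    and \<theta>: "\<theta> \<in> Cc (gtop G)" "\<And>y. \<theta> y = complex_of_real (norm (\<theta> y))"
    and \<phi>: "\<phi> \<in> Cc CT" "\<And>\<omega>. \<phi> \<omega> = complex_of_real (norm (\<phi> \<omega>))"
  shows L_Cc_eq_norm: "L_Cc G H m \<theta> \<phi> \<omega> = complex_of_real (norm (L_Cc G H m \<theta> \<phi> \<omega>))"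
    and nn_integral_L_Cc_eq: "u \<in> gunits G \<Longrightarrow> (\<integral>\<^sup>+\<omega>. ennreal (norm (L_Cc G H m \<theta> \<phi> \<omega>)) \<partial>mu u)
      = (\<integral>\<^sup>+y. ennreal (norm (\<theta> y) * (LINT \<omega>|mu (gdom G y). norm (\<phi> \<omega>))) \<partial>m u)"
proof -
  interpret F: fibred "gtop G" "grng G" "unit_top G" m by (rule F)
  have k: "ktr \<phi> y \<omega> = complex_of_real (norm (ktr \<phi> y \<omega>))" for y \<omega>
    using \<phi>(2) by (simp add: ktr_def)
  have pos: "\<theta> y * ktr \<phi> y \<omega> = complex_of_real (norm (\<theta> y * ktr \<phi> y \<omega>))" for y \<omega>
    by (subst \<theta>(2), subst k) (simp add: norm_mult)
  have int: "(LINT y|m u. \<theta> y * ktr \<phi> y \<omega>) = complex_of_real (LINT y|m u. norm (\<theta> y * ktr \<phi> y \<omega>))" for u \<omega>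
    by (subst pos) (rule integral_complex_of_real)
  have nint: "norm (LINT y|m u. \<theta> y * ktr \<phi> y \<omega>) = (LINT y|m u. norm (\<theta> y * ktr \<phi> y \<omega>))" for u \<omega>
    unfolding int by simp
  show "L_Cc G H m \<theta> \<phi> \<omega> = complex_of_real (norm (L_Cc G H m \<theta> \<phi> \<omega>))"
  proof (cases "\<omega> \<in> topspace CT")
    case True
    show ?thesis unfolding L_Cc_eq[OF True] nint by (rule int)
  qed (simp add: L_Cc_def)
  assume u: "u \<in> gunits G"
  interpret M1: sigma_finite_measure "m u" using F.sigma_finite u by simp
  interpret M2: sigma_finite_measure "mu u" using Mu.sigma_finite u by simp
  interpret pair_sigma_finite "m u" "mu u" ..
  have meas: "(\<lambda>p. \<theta> (fst p) * ktr \<phi> (fst p) (snd p)) \<in> borel_measurable (m u \<Otimes>\<^sub>M mu u)"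
    by (rule measurable_pair_mult_ktr[OF u _ \<phi>(1)])
      (use F.sets_m[of u] F.Cc_measurable[OF _ \<theta>(1), of u] F.measurable_m[of u] u in auto)
  have "(\<integral>\<^sup>+\<omega>. ennreal (norm (LINT y|m u. \<theta> y * ktr \<phi> y \<omega>)) \<partial>mu u)
      = (\<integral>\<^sup>+\<omega>. (\<integral>\<^sup>+y. ennreal (norm (\<theta> y * ktr \<phi> y \<omega>)) \<partial>m u) \<partial>mu u)"
  proof (rule nn_integral_cong)
    fix \<omega> assume "\<omega> \<in> space (mu u)"
    then have "\<omega> \<in> topspace CT" using Mu.space_m[of u] u by simp
    then show "ennreal (norm (LINT y|m u. \<theta> y * ktr \<phi> y \<omega>)) = (\<integral>\<^sup>+y. ennreal (norm (\<theta> y * ktr \<phi> y \<omega>)) \<partial>m u)"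
      unfolding nint
      using nn_integral_eq_integral[OF integrable_norm[OF integrable_mult_ktr[OF F \<theta>(1) \<phi>(1) _ u]]] by simp
  qed
  also have "\<dots> = (\<integral>\<^sup>+y. (\<integral>\<^sup>+\<omega>. ennreal (norm (\<theta> y * ktr \<phi> y \<omega>)) \<partial>mu u) \<partial>m u)"
    using Fubini'[of "\<lambda>y \<omega>. ennreal (norm (\<theta> y * ktr \<phi> y \<omega>))"] meas
    by (simp add: case_prod_unfold)
  finally show "(\<integral>\<^sup>+\<omega>. ennreal (norm (L_Cc G H m \<theta> \<phi> \<omega>)) \<partial>mu u)
      = (\<integral>\<^sup>+y. ennreal (norm (\<theta> y) * (LINT \<omega>|mu (gdom G y). norm (\<phi> \<omega>))) \<partial>m u)"
    unfolding nn_integral_norm_L_Cc_cong[OF u] nn_integral_iterated_ktr[OF F \<phi>(1) u] .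
qed

end

section \<open>Translates of measures\<close>

context lc_groupoid
begin

lemma closedin_rfibre: "u \<in> gunits G \<Longrightarrow> closedin (gtop G) (rfibre G u)"
proof -
  assume u: "u \<in> gunits G"
  have "closedin (gtop G) {x \<in> topspace (gtop G). grng G x = u}"
    by (rule closedin_continuous_maps_eq[OF Hausdorff continuous_rng])
      (use u gunits_arrows in \<open>simp add: topspace_gtop\<close>)
  then show ?thesis by (simp add: rfibre_def topspace_gtop)
qed

lemma continuous_mult_left:
  assumes y: "y \<in> arrows G"
  shows "continuous_map (subtopology (gtop G) (rfibre G (gdom G y))) (gtop G) (gmult G y)"
proof -
  have "continuous_map (subtopology (gtop G) (rfibre G (gdom G y)))
      (subtopology (prod_topology (gtop G) (gtop G)) (composables G)) (\<lambda>z. (y, z))"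
    using y by (auto simp: continuous_map_in_subtopology continuous_map_pairwise o_def composables_def
        rfibre_def topspace_gtop continuous_map_from_subtopology)
  from continuous_map_compose[OF this continuous_mult] show ?thesis by (simp add: o_def)
qed

lemma measurable_mult_left:
  assumes y: "y \<in> arrows G" and M: "sets M = sets (borel_of (gtop G))"
  shows "gmult G y \<in> measurable (restrict_space M (rfibre G (gdom G y))) (borel_of (gtop G))"
  unfolding borel_of_def[of "gtop G"]
proof (rule measurable_measure_of)
  let ?R = "rfibre G (gdom G y)"
  have spM: "space M = arrows G" using sets_eq_imp_space_eq[OF M] by (simp add: topspace_gtop)
  have R: "?R \<in> sets M" "?R \<subseteq> space M"
    using closedin_rfibre[of "gdom G y"] y M by (auto intro: closedin_sets_borel_of simp: spM rfibre_def)
  then have sp: "space (restrict_space M ?R) = ?R" by (auto simp: space_restrict_space)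
  show "{U. openin (gtop G) U} \<subseteq> Pow (topspace (gtop G))" by (auto dest: openin_subset)
  show "gmult G y \<in> space (restrict_space M ?R) \<rightarrow> topspace (gtop G)"
    unfolding sp using y by (auto simp: rfibre_def topspace_gtop)
  fix U assume "U \<in> {U. openin (gtop G) U}"
  then have "openin (subtopology (gtop G) ?R) {z \<in> topspace (subtopology (gtop G) ?R). gmult G y z \<in> U}"
    by (intro openin_continuous_map_preimage[OF continuous_mult_left[OF y]]) simp
  then obtain T where T: "openin (gtop G) T"
      "{z \<in> topspace (subtopology (gtop G) ?R). gmult G y z \<in> U} = T \<inter> ?R"
    unfolding openin_subtopology by metis
  have "gmult G y -` U \<inter> space (restrict_space M ?R) = T \<inter> ?R"
    unfolding sp T(2)[symmetric] by (auto simp: rfibre_def topspace_gtop)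
  also have "\<dots> \<in> sets (restrict_space M ?R)"
    using R openin_sets_borel_of[OF T(1)] M by (subst sets_restrict_space_iff) auto
  finally show "gmult G y -` U \<inter> space (restrict_space M ?R) \<in> sets (restrict_space M ?R)" .
qed

lemma sets_translate_measure: "sets (translate_measure G y M) = sets (borel_of (gtop G))"
  by (simp add: translate_measure_def)

lemma integral_translate_measure:
  fixes h :: "'a \<Rightarrow> 'd::{banach, second_countable_topology}"
  assumes y: "y \<in> arrows G" and M: "sets M = sets (borel_of (gtop G))"
    and h: "h \<in> borel_measurable (borel_of (gtop G))"
  shows "(LINT w|translate_measure G y M. h w)
    = (LINT z|M. indicator (rfibre G (gdom G y)) z *\<^sub>R h (gmult G y z))"
proof -
  have "rfibre G (gdom G y) \<in> sets M"
    using closedin_rfibre[of "gdom G y"] y M by (auto intro: closedin_sets_borel_of)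
  then have "rfibre G (gdom G y) \<inter> space M \<in> sets M" by auto
  then show ?thesis
    unfolding translate_measure_def
    by (simp add: integral_distr[OF measurable_mult_left[OF y M] h] integral_restrict_space)
qed

lemma emeasure_translate_measure_space:
  assumes y: "y \<in> arrows G" and M: "sets M = sets (borel_of (gtop G))"
    and ae: "AE z in M. grng G z = gdom G y"
  shows "emeasure (translate_measure G y M) (space (translate_measure G y M)) = emeasure M (space M)"
proof -
  let ?R = "rfibre G (gdom G y)"
  have spM: "space M = arrows G" using sets_eq_imp_space_eq[OF M] by (simp add: topspace_gtop)
  have R: "?R \<in> sets M" "?R \<subseteq> space M"
    using closedin_rfibre[of "gdom G y"] y M by (auto intro: closedin_sets_borel_of simp: spM rfibre_def)
  have "emeasure (translate_measure G y M) (space (translate_measure G y M))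
      = emeasure (restrict_space M ?R) (gmult G y -` arrows G \<inter> space (restrict_space M ?R))"
    unfolding translate_measure_def
    using openin_sets_borel_of[OF openin_topspace, of "gtop G"]
    by (simp add: emeasure_distr[OF measurable_mult_left[OF y M]] topspace_gtop)
  also have "gmult G y -` arrows G \<inter> space (restrict_space M ?R) = ?R"
    using y R by (auto simp: space_restrict_space rfibre_def)
  also have "emeasure (restrict_space M ?R) ?R = emeasure M ?R"
    using R by (intro emeasure_restrict_space) auto
  also have "\<dots> = emeasure M (space M)"
  proof (rule emeasure_eq_AE)
    have "AE z in M. z \<in> arrows G" using spM by (intro AE_I2) simp
    then show "AE z in M. (z \<in> ?R) = (z \<in> space M)"
      using ae by eventually_elim (auto simp: rfibre_def spM)
  qed (use R in auto)
  finally show ?thesis .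
qed

end

section \<open>Almost invariant functions on the coset space\<close>

context fibred
begin

lemma Re_continuous:
  assumes "(\<lambda>x. complex_of_real (c x)) \<in> Cc X"
  shows "continuous_map X euclideanreal c"
  using continuous_map_compose[OF Cc_continuous[OF assms], of euclidean Re]
  by (simp add: o_def continuous_on_Re continuous_on_id)

lemma Cc_real_integrable:
  assumes "(\<lambda>x. complex_of_real (c x)) \<in> Cc X" "u \<in> topspace Y"
  shows "integrable (m u) c"
  using integrable_Re[OF Cc_integrable[OF assms(2,1)]] by simp

lemma continuous_integral_real:
  assumes "(\<lambda>x. complex_of_real (c x)) \<in> Cc X"
  shows "continuous_map Y euclideanreal (\<lambda>u. LINT x|m u. c x)"
  using continuous_map_compose[OF continuous_integral[OF assms], of euclidean Re]
  by (simp add: o_def continuous_on_Re continuous_on_id)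

text \<open>A cut-off that captures most of the mass at one base point also does so at nearby ones, because its
  integral depends continuously on the base point; compactness of \<open>K\<close> leaves finitely many cut-offs to
  be dominated by a single one.\<close>

lemma uniformly_tight:
  assumes prob: "\<And>u. u \<in> topspace Y \<Longrightarrow> emeasure (m u) (space (m u)) = 1"
    and K: "compactin Y K" and d: "0 < d"
  obtains c where "(\<lambda>x. complex_of_real (c x)) \<in> Cc X" "\<And>x. 0 \<le> c x" "\<And>x. c x \<le> 1"
    "\<And>u. u \<in> K \<Longrightarrow> 1 - d < (LINT x|m u. c x)"
proof -
  have KY: "K \<subseteq> topspace Y" by (rule compactin_subset_topspace[OF K])
  have "\<exists>c. (\<lambda>x. complex_of_real (c x)) \<in> Cc X \<and> (\<forall>x. 0 \<le> c x) \<and> (\<forall>x. c x \<le> 1) \<and>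
      1 - d < (LINT x|m u. c x)" if u: "u \<in> K" for u
  proof -
    have uY: "u \<in> topspace Y" using u KY by blast
    interpret P: finite_measure "m u" by (rule finite_measureI) (simp add: prob[OF uY])
    obtain C :: "nat \<Rightarrow> 'b set" where C: "\<And>n. compactin X (C n)" "(\<Union>n. C n) = topspace X" "incseq C"
      by (rule sigma_compact) blast
    have Cs: "C n \<in> sets (m u)" for n
      using compactin_imp_closedin[OF C(1)] by (simp add: sets_m[OF uY] closedin_sets_borel_of)
    have "(\<lambda>n. measure (m u) (C n)) \<longlonglongrightarrow> measure (m u) (\<Union>n. C n)"
      by (rule P.finite_Lim_measure_incseq) (use Cs C in auto)
    also have "measure (m u) (\<Union>n. C n) = 1"
      using prob[OF uY] C(2) space_m[OF uY] by (simp add: measure_def)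
    finally have "\<forall>\<^sub>F n in sequentially. 1 - d < measure (m u) (C n)"
      by (rule order_tendstoD) (use d in simp)
    then obtain n where n: "1 - d < measure (m u) (C n)"
      by (meson eventually_happens' sequentially_bot)
    obtain c where c: "(\<lambda>x. complex_of_real (c x)) \<in> Cc X" "\<And>x. 0 \<le> c x" "\<And>x. c x \<le> 1"
      "\<And>x. x \<in> C n \<Longrightarrow> c x = 1"
      by (rule Cc_cutoff[OF C(1) openin_topspace, of n]) (use compactin_subset_topspace[OF C(1)] in auto)
    have "measure (m u) (C n) = (LINT x|m u. indicator (C n) x)"
      using Cs by simp
    also have "\<dots> \<le> (LINT x|m u. c x)"
    proof (rule integral_mono)
      show "integrable (m u) (indicator (C n) :: _ \<Rightarrow> real)" using Cs by (simp add: P.emeasure_finite less_top[symmetric])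
      show "integrable (m u) c" by (rule Cc_real_integrable[OF c(1) uY])
    qed (use c in \<open>auto simp: indicator_def\<close>)
    finally show ?thesis using n c by (intro exI[of _ c]) auto
  qed
  then obtain c where c: "\<And>u. u \<in> K \<Longrightarrow> (\<lambda>x. complex_of_real (c u x)) \<in> Cc X"
      "\<And>u x. u \<in> K \<Longrightarrow> 0 \<le> c u x" "\<And>u x. u \<in> K \<Longrightarrow> c u x \<le> 1"
      "\<And>u. u \<in> K \<Longrightarrow> 1 - d < (LINT x|m u. c u x)" by metis
  define V where "V u = {v \<in> topspace Y. (LINT x|m v. c u x) \<in> {1 - d<..}}" for u
  have V: "openin Y (V u)" "u \<in> V u" if "u \<in> K" for u
    using openin_continuous_map_preimage[OF continuous_integral_real[OF c(1)[OF that]], of "{1 - d<..}"]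
      c(4)[OF that] that KY by (auto simp: V_def)
  have "\<exists>\<F>. finite \<F> \<and> \<F> \<subseteq> V ` K \<and> K \<subseteq> \<Union>\<F>"
    by (rule compactinD[OF K]) (use V in auto)
  then obtain T where T: "finite T" "T \<subseteq> K" "K \<subseteq> (\<Union>u\<in>T. V u)"
    by (metis finite_subset_image)
  have "\<exists>L. compactin X L \<and> (\<forall>x. x \<notin> L \<longrightarrow> c u x = 0)" if "u \<in> K" for u
    by (rule Cc_E[OF c(1)[OF that]]) auto
  then obtain L where L: "\<And>u. u \<in> K \<Longrightarrow> compactin X (L u)" "\<And>u x. u \<in> K \<Longrightarrow> x \<notin> L u \<Longrightarrow> c u x = 0"
    by metis
  have LL: "compactin X (\<Union>u\<in>T. L u)" using T L by (intro compactin_Union) auto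
  obtain e where e: "(\<lambda>x. complex_of_real (e x)) \<in> Cc X" "\<And>x. 0 \<le> e x" "\<And>x. e x \<le> 1"
      "\<And>x. x \<in> (\<Union>u\<in>T. L u) \<Longrightarrow> e x = 1"
    by (rule Cc_cutoff[OF LL openin_topspace compactin_subset_topspace[OF LL]]) auto
  show ?thesis
  proof (rule that[OF e(1-3)])
    fix v assume v: "v \<in> K"
    then obtain u where u: "u \<in> T" "v \<in> V u" using T by blast
    have uK: "u \<in> K" and vY: "v \<in> topspace Y" using u v T(2) KY by auto
    have "1 - d < (LINT x|m v. c u x)" using u(2) by (simp add: V_def)
    also have "\<dots> \<le> (LINT x|m v. e x)"
    proof (rule integral_mono)
      show "integrable (m v) (c u)" "integrable (m v) e"
        using Cc_real_integrable[OF c(1)[OF uK] vY] Cc_real_integrable[OF e(1) vY] by auto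
      fix x show "c u x \<le> e x"
        using L(2)[OF uK, of x] e(2)[of x] e(4)[OF UN_I[OF u(1)], of x] c(3)[OF uK, of x]
        by (cases "x \<in> L u") auto
    qed
    finally show "1 - d < (LINT x|m v. e x)" .
  qed
qed

text \<open>A function with positive integrals over a compact set of fibres, divided by the larger of its
  own integral and a lower bound for these integrals.\<close>

lemma normalised_function:
  assumes supp: "\<And>u. u \<in> topspace Y \<Longrightarrow> msupport X (m u) \<noteq> {}" and D: "compactin Y D"
  obtains f where "(\<lambda>x. complex_of_real (f x)) \<in> Cc X" "\<And>x. 0 \<le> f x"
    "\<And>u. u \<in> topspace Y \<Longrightarrow> (LINT x|m u. f x) \<le> 1" "\<And>u. u \<in> D \<Longrightarrow> (LINT x|m u. f x) = 1"
proof -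
  have DY: "D \<subseteq> topspace Y" by (rule compactin_subset_topspace[OF D])
  have "\<exists>c. (\<lambda>x. complex_of_real (c x)) \<in> Cc X \<and> (\<forall>x. 0 \<le> c x) \<and> 0 < (LINT x|m u. c x)"
    if u: "u \<in> D" for u
  proof -
    have uY: "u \<in> topspace Y" using u DY by blast
    then obtain x where x: "x \<in> msupport X (m u)" using supp by blast
    have xc: "compactin X {x}" using x by (simp add: msupport_def)
    obtain c where c: "(\<lambda>x. complex_of_real (c x)) \<in> Cc X" "\<And>x. 0 \<le> c x" "\<And>y. y \<in> {x} \<Longrightarrow> c y = 1"
      by (rule Cc_cutoff[OF xc openin_topspace compactin_subset_topspace[OF xc]]) auto
    have "0 < (LINT y|m u. norm (complex_of_real (c y)))"
      by (rule integral_norm_pos[OF c(1) uY x]) (use c(3)[of x] in simp)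
    then show ?thesis using c by (intro exI[of _ c]) simp
  qed
  then obtain c where c: "\<And>u. u \<in> D \<Longrightarrow> (\<lambda>x. complex_of_real (c u x)) \<in> Cc X"
      "\<And>u x. u \<in> D \<Longrightarrow> 0 \<le> c u x" "\<And>u. u \<in> D \<Longrightarrow> 0 < (LINT x|m u. c u x)" by metis
  define V where "V u = {v \<in> topspace Y. (LINT x|m v. c u x) \<in> {0<..}}" for u
  have V: "openin Y (V u)" "u \<in> V u" if "u \<in> D" for u
    using openin_continuous_map_preimage[OF continuous_integral_real[OF c(1)[OF that]], of "{0<..}"]
      c(3)[OF that] that DY by (auto simp: V_def)
  have "\<exists>\<F>. finite \<F> \<and> \<F> \<subseteq> V ` D \<and> D \<subseteq> \<Union>\<F>"
    by (rule compactinD[OF D]) (use V in auto)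
  then obtain T where T: "finite T" "T \<subseteq> D" "D \<subseteq> (\<Union>u\<in>T. V u)"
    by (metis finite_subset_image)
  define \<psi> where "\<psi> x = (\<Sum>u\<in>T. c u x)" for x
  have \<psi>0: "0 \<le> \<psi> x" for x unfolding \<psi>_def using c(2) T by (intro sum_nonneg) auto
  have \<psi>C: "(\<lambda>x. complex_of_real (\<psi> x)) \<in> Cc X"
    unfolding \<psi>_def of_real_sum by (rule Cc_sum) (use c T in auto)
  define \<Psi> where "\<Psi> v = (LINT x|m v. \<psi> x)" for v
  have \<Psi>c: "continuous_map Y euclideanreal \<Psi>"
    unfolding \<Psi>_def[abs_def] by (rule continuous_integral_real[OF \<psi>C])
  have \<Psi>pos: "0 < \<Psi> v" if "v \<in> D" for v
  proof -
    from that T(3) obtain u where u: "u \<in> T" "v \<in> V u" by blast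
    have vY: "v \<in> topspace Y" using that DY by blast
    have "0 < (LINT x|m v. c u x)" using u by (simp add: V_def)
    also have "\<dots> \<le> \<Psi> v"
      unfolding \<Psi>_def
    proof (rule integral_mono)
      show "integrable (m v) (c u)" "integrable (m v) \<psi>"
        using Cc_real_integrable[OF c(1) vY] Cc_real_integrable[OF \<psi>C vY] u T by auto
      fix x show "c u x \<le> \<psi> x"
        unfolding \<psi>_def using u T c(2) by (intro member_le_sum) auto
    qed
    finally show ?thesis .
  qed
  have "\<exists>s>0. \<forall>v\<in>D. s \<le> \<Psi> v"
  proof (cases "D = {}")
    case False
    have "compact (\<Psi> ` D)" using image_compactin[OF D \<Psi>c] by simp
    then obtain s where "s \<in> \<Psi> ` D" "\<forall>t\<in>\<Psi> ` D. s \<le> t"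
      using compact_attains_inf[of "\<Psi> ` D"] False by auto
    then show ?thesis using \<Psi>pos by (intro exI[of _ s]) auto
  qed (auto intro: exI[of _ 1])
  then obtain s where s: "s > 0" "\<And>v. v \<in> D \<Longrightarrow> s \<le> \<Psi> v" by blast
  define h where "h v = 1 / max (\<Psi> v) s" for v
  have h: "0 \<le> h v" for v using s by (simp add: h_def)
  have nz: "max t s \<noteq> 0" for t using s(1) by (simp add: max_def)
  have "continuous_on UNIV (\<lambda>t. complex_of_real (1 / max t s))"
    by (intro continuous_intros ballI nz)
  then have "continuous_map Y euclidean ((\<lambda>t. complex_of_real (1 / max t s)) \<circ> \<Psi>)"
    by (intro continuous_map_compose[OF \<Psi>c]) simp
  from continuous_map_compose[OF continuous_p this]
  have hc: "continuous_map X euclidean (\<lambda>x. complex_of_real (h (p x)))"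
    by (simp add: o_def h_def)
  define f where "f x = h (p x) * \<psi> x" for x
  have fC: "(\<lambda>x. complex_of_real (f x)) \<in> Cc X"
    using Cc_mult_continuous[OF \<psi>C hc] by (simp add: f_def)
  have fI: "(LINT x|m v. f x) = h v * \<Psi> v" if v: "v \<in> topspace Y" for v
  proof -
    have "(LINT x|m v. f x) = (LINT x|m v. h v * \<psi> x)"
    proof (rule integral_cong_AE)
      show "f \<in> borel_measurable (m v)" "(\<lambda>x. h v * \<psi> x) \<in> borel_measurable (m v)"
        using Cc_real_integrable[OF fC v] Cc_real_integrable[OF \<psi>C v] by auto
      show "AE x in m v. f x = h v * \<psi> x"
        using AE_fibre[OF v] by eventually_elim (simp add: f_def)
    qed
    then show ?thesis by (simp add: \<Psi>_def)
  qed
  show ?thesis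
  proof (rule that[OF fC])
    fix x show "0 \<le> f x" using h \<psi>0 by (simp add: f_def)
  next
    fix v assume "v \<in> topspace Y"
    then show "(LINT x|m v. f x) \<le> 1"
      unfolding fI[OF \<open>v \<in> topspace Y\<close>] h_def using s by (simp add: field_simps less_max_iff_disj)
  next
    fix v assume v: "v \<in> D"
    then show "(LINT x|m v. f x) = 1"
      using fI[of v] DY s(2)[OF v] s(1) by (auto simp: h_def max_def)
  qed
qed

end

context coset_system
begin

text \<open>With \<open>u\<close>, \<open>v\<close> the range and source of \<open>y\<close>, both \<open>g(y\<inverse>\<omega>)\<close> and \<open>g(\<omega>)\<close> are integrals of \<open>\<phi>(w\<inverse>\<omega>)\<close> in \<open>w\<close>, the
  first against the translate of \<open>c m\<^sup>v\<close> by \<open>y\<close> and the second against \<open>c m\<^sup>u\<close>. Writing both measures with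
  densities over a common measure, the triangle inequality bounds the \<open>L\<^sup>1\<close> norm of the difference by
  the distance of the densities. This is the total variation for \<open>c = 1\<close>, and each cut-off adds
  the mass that it removes.\<close>

lemma almost_invariant_translate:
  assumes F: "fibred (gtop G) (grng G) (unit_top G) m"
    and prob: "\<And>u. u \<in> gunits G \<Longrightarrow> emeasure (m u) (space (m u)) = 1"
    and c: "(\<lambda>x. complex_of_real (c x)) \<in> Cc (gtop G)" "\<And>x. 0 \<le> c x" "\<And>x. c x \<le> 1"
    and \<phi>: "\<phi> \<in> Cc CT" "\<And>v. v \<in> gunits G \<Longrightarrow> (LINT \<omega>|mu v. norm (\<phi> \<omega>)) \<le> 1"
    and y: "y \<in> arrows G"
  defines "g \<equiv> L_Cc G H m (\<lambda>x. complex_of_real (c x)) \<phi>"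
  shows "(\<integral>\<^sup>+\<omega>. ennreal (norm (ktr g y \<omega> - g \<omega>)) \<partial>mu (grng G y))
    \<le> ennreal ((1 - (LINT x|m (gdom G y). c x))
        + tv_norm_diff (translate_measure G y (m (gdom G y))) (m (grng G y))
        + (1 - (LINT x|m (grng G y). c x)))"
proof -
  interpret F: fibred "gtop G" "grng G" "unit_top G" m by (rule F)
  define u where "u = grng G y"
  define v where "v = gdom G y"
  have u: "u \<in> gunits G" and v: "v \<in> gunits G" using y by (auto simp: u_def v_def)
  define M where "M = translate_measure G y (m v)"
  have sv: "sets (m v) = sets (borel_of (gtop G))" and su: "sets (m u) = sets (borel_of (gtop G))"
    using F.sets_m u v by auto
  have sM: "sets M = sets (borel_of (gtop G))" by (simp add: M_def sets_translate_measure)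
  have aev: "AE z in m v. grng G z = gdom G y" using F.AE_fibre[of v] v by (simp add: v_def)
  have M1: "emeasure M (space M) = 1"
    using emeasure_translate_measure_space[OF y sv aev] prob[OF v] by (simp add: M_def)
  interpret M: finite_measure M by (rule finite_measureI) (simp add: M1)
  interpret N: finite_measure "m u" by (rule finite_measureI) (simp add: prob[OF u])
  have mass: "measure M (space M) = 1" "measure (m u) (space (m u)) = 1"
    using M1 prob[OF u] by (simp_all add: measure_def)
  have "sets (m u) = sets M" using sM su by simp
  then obtain Q a b where Q: "finite_measure Q" "sets Q = sets M"
    "a \<in> borel_measurable Q" "b \<in> borel_measurable Q" "\<And>x. 0 \<le> a x" "\<And>x. (0::real) \<le> b x"
    "M = density Q a" "m u = density Q b" "integrable Q a" "integrable Q b"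
    "(LINT x|Q. \<bar>a x - b x\<bar>) \<le> tv_norm_diff M (m u)"
    by (rule tv_norm_diff_densities[OF M.finite_measure_axioms N.finite_measure_axioms]) blast
  have sQ: "sets Q = sets (borel_of (gtop G))" using Q(2) sM by simp
  have mQ: "measurable Q N = measurable (borel_of (gtop G)) N" for N
    by (rule measurable_cong_sets) (use sQ in auto)
  have mM: "measurable M N = measurable (borel_of (gtop G)) N" for N
    by (rule measurable_cong_sets) (use sM in auto)
  interpret Q: finite_measure Q by (rule Q(1))
  have cm: "c \<in> borel_measurable (borel_of (gtop G))"
    by (rule borel_measurable_continuous_map[OF F.Re_continuous[OF c(1)]])
  \<comment> \<open>the cut-off of the translated measure, so that \<open>c'(y z) = c(z)\<close>\<close>
  define c' where "c' w = (if w \<in> rfibre G u then c (gmult G (ginv G y) w) else 0)" for w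
  have c': "0 \<le> c' w" "c' w \<le> 1" for w using c by (auto simp: c'_def)
  have c'm: "c' \<in> borel_measurable (borel_of (gtop G))"
  proof (rule borel_measurable_closed_extension[OF closedin_rfibre[OF u], of _ 0])
    have "continuous_map (subtopology (gtop G) (rfibre G u)) (gtop G) (gmult G (ginv G y))"
      using continuous_mult_left[of "ginv G y"] y by (simp add: u_def)
    from continuous_map_compose[OF this F.Re_continuous[OF c(1)]]
    show "continuous_map (subtopology (gtop G) (rfibre G u)) euclidean c'"
      by (rule continuous_map_eq) (auto simp: c'_def)
  qed (simp add: c'_def)
  have c'y: "c' (gmult G y z) = c z" if "z \<in> rfibre G v" for z
    using that y by (auto simp: c'_def rfibre_def u_def v_def)
  obtain B where B: "0 \<le> B" "\<And>y \<omega>. norm (ktr \<phi> y \<omega>) \<le> B" by (rule ktr_bounded[OF \<phi>(1)]) blast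
  have int: "integrable Q (\<lambda>w. r w *\<^sub>R (complex_of_real (s w) * ktr \<phi> w \<omega>))"
    if r: "integrable Q r" "\<And>w. 0 \<le> r w" and s: "s \<in> borel_measurable (borel_of (gtop G))" "\<And>w. 0 \<le> s w" "\<And>w. s w \<le> 1"
      and \<omega>: "\<omega> \<in> topspace CT" for r s \<omega>
  proof (rule Bochner_Integration.integrable_bound)
    show "integrable Q (\<lambda>w. r w * B)" using r by simp
    show "(\<lambda>w. r w *\<^sub>R (complex_of_real (s w) * ktr \<phi> w \<omega>)) \<in> borel_measurable Q"
      using borel_measurable_integrable[OF r(1)] s(1) measurable_ktr1[OF \<phi>(1) \<omega>] unfolding mQ by simp
    show "AE w in Q. norm (r w *\<^sub>R (complex_of_real (s w) * ktr \<phi> w \<omega>)) \<le> norm (r w * B)"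
    proof (rule AE_I2)
      fix w
      have "s w * norm (ktr \<phi> w \<omega>) \<le> 1 * B" using s B by (intro mult_mono) auto
      then show "norm (r w *\<^sub>R (complex_of_real (s w) * ktr \<phi> w \<omega>)) \<le> norm (r w * B)"
        using r(2)[of w] s(2)[of w] B(1) by (simp add: norm_mult abs_mult mult_left_mono)
    qed
  qed
  define k where "k w = complex_of_real (a w * c' w - b w * c w)" for w
  have km: "k \<in> borel_measurable (borel_of (gtop G))"
    unfolding k_def using Q(3,4) c'm cm unfolding mQ by simp
  have eq: "ktr g y \<omega> - g \<omega> = (LINT w|Q. k w * ktr \<phi> w \<omega>)"
    if \<omega>: "\<omega> \<in> topspace CT" "coset_rng G \<omega> = u" for \<omega>
  proof -
    let ?\<omega> = "coset_act G (ginv G y) \<omega>"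
    have \<omega>': "?\<omega> \<in> topspace CT" "coset_rng G ?\<omega> = v" using \<omega> y by (auto simp: u_def v_def)
    have "ktr g y \<omega> = g ?\<omega>" using \<omega> y by (simp add: ktr_def fibprod_iff u_def)
    also have "\<dots> = (LINT z|m v. complex_of_real (c z) * ktr \<phi> z ?\<omega>)"
      unfolding g_def L_Cc_eq[OF \<omega>'(1)] \<omega>'(2) ..
    also have "\<dots> = (LINT z|m v. indicator (rfibre G v) z *\<^sub>R
        (complex_of_real (c' (gmult G y z)) * ktr \<phi> (gmult G y z) \<omega>))"
    proof (rule Bochner_Integration.integral_cong[OF refl])
      fix z assume "z \<in> space (m v)"
      show "complex_of_real (c z) * ktr \<phi> z ?\<omega> = indicator (rfibre G v) z *\<^sub>R
          (complex_of_real (c' (gmult G y z)) * ktr \<phi> (gmult G y z) \<omega>)"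
      proof (cases "z \<in> rfibre G v")
        case True
        then have z: "z \<in> arrows G" "grng G z = gdom G y" by (auto simp: rfibre_def v_def)
        then have "ktr \<phi> (gmult G y z) \<omega> = ktr \<phi> z ?\<omega>"
          using \<omega> \<omega>' y by (simp add: ktr_def fibprod_iff u_def v_def inv_mult_distrib coset_act_act)
        then show ?thesis using True c'y[OF True] by simp
      next
        case False
        then have "(z, ?\<omega>) \<notin> fibprod" using \<omega>' by (auto simp: fibprod_iff rfibre_def)
        then show ?thesis using False by (simp add: ktr_def)
      qed
    qed
    also have "\<dots> = (LINT w|M. complex_of_real (c' w) * ktr \<phi> w \<omega>)"
      unfolding M_def v_def
      by (rule integral_translate_measure[symmetric, OF y])
        (use sv c'm measurable_ktr1[OF \<phi>(1) \<omega>(1)] in \<open>auto simp: v_def\<close>)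
    also have "\<dots> = (LINT w|Q. a w *\<^sub>R (complex_of_real (c' w) * ktr \<phi> w \<omega>))"
      unfolding Q(7) by (rule integral_density)
        (use Q c'm measurable_ktr1[OF \<phi>(1) \<omega>(1)] in \<open>auto simp: mQ\<close>)
    finally have 1: "ktr g y \<omega> = (LINT w|Q. a w *\<^sub>R (complex_of_real (c' w) * ktr \<phi> w \<omega>))" .
    have "g \<omega> = (LINT w|m u. complex_of_real (c w) * ktr \<phi> w \<omega>)"
      unfolding g_def L_Cc_eq[OF \<omega>(1)] \<omega>(2) ..
    also have "\<dots> = (LINT w|Q. b w *\<^sub>R (complex_of_real (c w) * ktr \<phi> w \<omega>))"
      unfolding Q(8) by (rule integral_density)
        (use Q cm measurable_ktr1[OF \<phi>(1) \<omega>(1)] in \<open>auto simp: mQ\<close>)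
    finally have 2: "g \<omega> = (LINT w|Q. b w *\<^sub>R (complex_of_real (c w) * ktr \<phi> w \<omega>))" .
    show ?thesis
      unfolding 1 2
      by (subst Bochner_Integration.integral_diff[symmetric,
            OF int[OF Q(9,5) c'm c' \<omega>(1)] int[OF Q(10,6) cm c(2,3) \<omega>(1)]])
        (auto intro!: Bochner_Integration.integral_cong
          simp: k_def scaleR_conv_of_real algebra_simps)
  qed
  have i: "integrable Q (\<lambda>w. (1 - s w) * r w)"
    if "integrable Q r" "\<And>w. 0 \<le> r w" "s \<in> borel_measurable (borel_of (gtop G))" "\<And>w. 0 \<le> s w" "\<And>w. s w \<le> 1" for r s :: "'a \<Rightarrow> real"
  proof (rule Bochner_Integration.integrable_bound[OF that(1)])
    show "(\<lambda>w. (1 - s w) * r w) \<in> borel_measurable Q"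
      using borel_measurable_integrable[OF that(1)] that(3) unfolding mQ by simp
    show "AE w in Q. norm ((1 - s w) * r w) \<le> norm (r w)"
      using that by (intro AE_I2) (auto simp: abs_mult intro!: mult_left_le_one_le)
  qed
  note i1 = i[OF Q(9,5) c'm c'] and i2 = i[OF Q(10,6) cm c(2,3)]
  have i3: "integrable Q (\<lambda>w. \<bar>a w - b w\<bar>)" using Q by simp
  have pos: "0 \<le> (1 - c' w) * a w + \<bar>a w - b w\<bar> + (1 - c w) * b w" for w
    using c' c Q(5,6) by simp
  have "(LINT w|M. 1 - c' w) = (LINT w|Q. a w *\<^sub>R (1 - c' w))"
    unfolding Q(7) by (rule integral_density) (use Q c'm in \<open>auto simp: mQ\<close>)
  then have ia: "(LINT w|Q. (1 - c' w) * a w) = (LINT w|M. 1 - c' w)" by (simp add: mult.commute)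
  have "(LINT w|m u. 1 - c w) = (LINT w|Q. b w *\<^sub>R (1 - c w))"
    unfolding Q(8) by (rule integral_density) (use Q cm in \<open>auto simp: mQ\<close>)
  then have ib: "(LINT w|Q. (1 - c w) * b w) = (LINT w|m u. 1 - c w)" by (simp add: mult.commute)
  have "integrable (m u) c" by (rule F.Cc_real_integrable[OF c(1)]) (use u in simp)
  then have ic: "(LINT w|m u. 1 - c w) = 1 - (LINT x|m u. c x)"
    by (simp add: mass)
  have "integrable M c'"
    by (rule M.integrable_const_bound[where B=1]) (use c' c'm in \<open>auto simp: mM\<close>)
  then have "(LINT w|M. 1 - c' w) = 1 - (LINT w|M. c' w)" by (simp add: mass)
  also have "(LINT w|M. c' w) = (LINT z|m v. indicator (rfibre G v) z *\<^sub>R c' (gmult G y z))"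
    unfolding M_def v_def by (rule integral_translate_measure[OF y]) (use sv c'm in \<open>auto simp: v_def\<close>)
  also have "\<dots> = (LINT z|m v. indicator (rfibre G v) z *\<^sub>R c z)"
    using c'y by (intro Bochner_Integration.integral_cong refl) (auto simp: indicator_def)
  also have "\<dots> = (LINT z|m v. c z)"
  proof (rule integral_cong_AE)
    have cv: "c \<in> borel_measurable (m v)" using cm v by (simp add: F.measurable_m)
    moreover have "rfibre G v \<in> sets (m v)"
      unfolding sv by (rule closedin_sets_borel_of[OF closedin_rfibre[OF v]])
    ultimately show "(\<lambda>z. indicator (rfibre G v) z *\<^sub>R c z) \<in> borel_measurable (m v)"
      "c \<in> borel_measurable (m v)" by auto
    have "AE z in m v. z \<in> arrows G" using F.space_m[of v] v by (intro AE_I2) (simp add: topspace_gtop)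
    then show "AE z in m v. indicator (rfibre G v) z *\<^sub>R c z = c z"
      using aev by eventually_elim (auto simp: rfibre_def v_def)
  qed
  finally have id: "(LINT w|M. 1 - c' w) = 1 - (LINT x|m v. c x)" .
  have tot: "(LINT w|Q. (1 - c' w) * a w + \<bar>a w - b w\<bar> + (1 - c w) * b w)
      = (1 - (LINT x|m v. c x)) + (LINT w|Q. \<bar>a w - b w\<bar>) + (1 - (LINT x|m u. c x))"
    using i1 i2 i3 by (simp add: ia ib ic id)
  have "(\<integral>\<^sup>+\<omega>. ennreal (norm (ktr g y \<omega> - g \<omega>)) \<partial>mu u) = (\<integral>\<^sup>+\<omega>. ennreal (norm (LINT w|Q. k w * ktr \<phi> w \<omega>)) \<partial>mu u)"
  proof (rule nn_integral_cong_AE)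
    have "AE \<omega> in mu u. coset_rng G \<omega> = u" using Mu.AE_fibre u by simp
    moreover have "AE \<omega> in mu u. \<omega> \<in> topspace CT" using Mu.space_m[of u] u by (intro AE_I2) simp
    ultimately show "AE \<omega> in mu u. ennreal (norm (ktr g y \<omega> - g \<omega>)) = ennreal (norm (LINT w|Q. k w * ktr \<phi> w \<omega>))"
      by eventually_elim (simp add: eq)
  qed
  also have "\<dots> \<le> (\<integral>\<^sup>+w. (\<integral>\<^sup>+\<omega>. ennreal (norm (k w * ktr \<phi> w \<omega>)) \<partial>mu u) \<partial>Q)"
    using nn_integral_norm_integral_le[OF Q.sigma_finite_measure_axioms Mu.sigma_finite
        measurable_pair_mult_ktr[OF u km \<phi>(1) sQ]] u by simp
  also have "\<dots> \<le> (\<integral>\<^sup>+w. ennreal ((1 - c' w) * a w + \<bar>a w - b w\<bar> + (1 - c w) * b w) \<partial>Q)"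
  proof (rule nn_integral_mono)
    fix w assume "w \<in> space Q"
    then have w: "w \<in> arrows G" using sets_eq_imp_space_eq[OF sQ] by (simp add: topspace_gtop)
    have "ktr \<phi> w \<in> borel_measurable (mu u)"
      using measurable_ktr2[OF \<phi>(1) w] u by (simp add: Mu.measurable_m)
    then have "(\<integral>\<^sup>+\<omega>. ennreal (norm (k w * ktr \<phi> w \<omega>)) \<partial>mu u)
        = ennreal (norm (k w)) * (\<integral>\<^sup>+\<omega>. ennreal (norm (ktr \<phi> w \<omega>)) \<partial>mu u)"
      by (simp add: norm_mult ennreal_mult nn_integral_cmult)
    also have "\<dots> \<le> ennreal (norm (k w)) * 1"
      using nn_integral_ktr_le[OF \<phi> w u] by (intro mult_left_mono) auto
    also have "\<dots> \<le> ennreal ((1 - c' w) * a w + \<bar>a w - b w\<bar> + (1 - c w) * b w)"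
    proof -
      have "a w * c' w - b w * c w = - ((1 - c' w) * a w) + (a w - b w) + (1 - c w) * b w"
        by (simp add: algebra_simps)
      moreover have "0 \<le> (1 - c' w) * a w" "0 \<le> (1 - c w) * b w" using c' c Q(5,6) by simp_all
      ultimately have "\<bar>a w * c' w - b w * c w\<bar> \<le> (1 - c' w) * a w + \<bar>a w - b w\<bar> + (1 - c w) * b w"
        by linarith
      then show ?thesis by (simp add: k_def ennreal_leI del: of_real_diff of_real_mult)
    qed
    finally show "(\<integral>\<^sup>+\<omega>. ennreal (norm (k w * ktr \<phi> w \<omega>)) \<partial>mu u)
        \<le> ennreal ((1 - c' w) * a w + \<bar>a w - b w\<bar> + (1 - c w) * b w)" .
  qed
  also have "\<dots> = ennreal (LINT w|Q. (1 - c' w) * a w + \<bar>a w - b w\<bar> + (1 - c w) * b w)"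
    using i1 i2 i3 pos by (intro nn_integral_eq_integral) auto
  also have "\<dots> \<le> ennreal ((1 - (LINT x|m v. c x)) + tv_norm_diff M (m u) + (1 - (LINT x|m u. c x)))"
    unfolding tot using Q(11) by (intro ennreal_leI) simp
  finally show ?thesis by (simp add: u_def v_def M_def)
qed

end

context coset_system
begin

lemma continuous_haar_integral:
  assumes F: "fibred (gtop G) (grng G) (unit_top G) lam" and f: "f \<in> Cc (gtop G)"
  shows "continuous_map CT euclidean (\<lambda>\<omega>. haar_integral lam f (coset_rng G \<omega>))"
proof -
  interpret F: fibred "gtop G" "grng G" "unit_top G" lam by (rule F)
  from continuous_map_compose[OF continuous_coset_rng F.continuous_integral[OF f]]
  show ?thesis by (simp add: o_def haar_integral_def)
qed

text \<open>\<open>L(f)g - \<lambda>(f)g\<close> is the integral of \<open>f(y) (g(y\<inverse>\<omega>) - g(\<omega>))\<close> in \<open>y\<close>.\<close>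

lemma almost_invariant_convolution:
  assumes F: "fibred (gtop G) (grng G) (unit_top G) lam" and f: "f \<in> Cc (gtop G)" and g: "g \<in> Cc CT"
    and B: "0 \<le> B" "\<And>y. y \<in> arrows G \<Longrightarrow> f y \<noteq> 0 \<Longrightarrow>
      (\<integral>\<^sup>+\<omega>. ennreal (norm (ktr g y \<omega> - g \<omega>)) \<partial>mu (grng G y)) \<le> ennreal B"
    and u: "u \<in> gunits G"
  shows "(LINT \<omega>|mu u. norm (L_Cc G H lam f g \<omega> - haar_integral lam f (coset_rng G \<omega>) * g \<omega>))
    \<le> B * (LINT y|lam u. norm (f y))"
proof -
  interpret F: fibred "gtop G" "grng G" "unit_top G" lam by (rule F)
  define h where "h = (\<lambda>\<omega>. L_Cc G H lam f g \<omega> - haar_integral lam f (coset_rng G \<omega>) * g \<omega>)"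
  have h: "h \<in> Cc CT"
    unfolding h_def by (intro C.Cc_diff L_Cc_in_Cc[OF F f g] C.Cc_mult_continuous[OF g] continuous_haar_integral[OF F f])
  define k where "k p = f (fst p) * ktr g (fst p) (snd p) - f (fst p) * g (snd p)" for p
  have su: "sets (lam u) = sets (borel_of (gtop G))" using F.sets_m u by simp
  have fm: "f \<in> borel_measurable (lam u)" using F.Cc_measurable[OF _ f] u by simp
  have gm: "g \<in> borel_measurable (mu u)" using Mu.Cc_measurable[OF _ g] u by simp
  have km: "k \<in> borel_measurable (lam u \<Otimes>\<^sub>M mu u)"
    unfolding k_def
  proof (rule borel_measurable_diff)
    show "(\<lambda>p. f (fst p) * ktr g (fst p) (snd p)) \<in> borel_measurable (lam u \<Otimes>\<^sub>M mu u)"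
      by (rule measurable_pair_mult_ktr[OF u _ g su]) (use F.Cc_measurable[OF _ f, of u] F.measurable_m[of u] u in auto)
    show "(\<lambda>p. f (fst p) * g (snd p)) \<in> borel_measurable (lam u \<Otimes>\<^sub>M mu u)"
      by (rule borel_measurable_times[OF measurable_compose[OF measurable_fst fm]
            measurable_compose[OF measurable_snd gm]])
  qed
  have "ennreal (LINT \<omega>|mu u. norm (h \<omega>)) = (\<integral>\<^sup>+\<omega>. ennreal (norm (h \<omega>)) \<partial>mu u)"
    using Mu.nn_integral_norm_Cc[OF _ h, of u] u by simp
  also have "\<dots> = (\<integral>\<^sup>+\<omega>. ennreal (norm (LINT y|lam u. k (y, \<omega>))) \<partial>mu u)"
  proof (rule nn_integral_cong_AE)
    have "AE \<omega> in mu u. coset_rng G \<omega> = u" using Mu.AE_fibre u by simp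
    moreover have "AE \<omega> in mu u. \<omega> \<in> topspace CT" using Mu.space_m[of u] u by (intro AE_I2) simp
    ultimately show "AE \<omega> in mu u. ennreal (norm (h \<omega>)) = ennreal (norm (LINT y|lam u. k (y, \<omega>)))"
    proof eventually_elim
      case (elim \<omega>)
      have "(LINT y|lam u. k (y, \<omega>)) = (LINT y|lam u. f y * ktr g y \<omega>) - (LINT y|lam u. f y * g \<omega>)"
        unfolding k_def fst_conv snd_conv
        by (intro Bochner_Integration.integral_diff integrable_mult_ktr[OF F f g elim(2) u]
            integrable_mult_left F.Cc_integrable[OF _ f]) (use u in simp)
      then have "h \<omega> = (LINT y|lam u. k (y, \<omega>))"
        using elim by (simp add: h_def L_Cc_eq haar_integral_def)
      then show ?case by simp
    qed
  qed
  also have "\<dots> \<le> (\<integral>\<^sup>+y. (\<integral>\<^sup>+\<omega>. ennreal (norm (k (y, \<omega>))) \<partial>mu u) \<partial>lam u)"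
    by (rule nn_integral_norm_integral_le[OF F.sigma_finite Mu.sigma_finite km]) (use u in simp_all)
  also have "\<dots> \<le> (\<integral>\<^sup>+y. ennreal (B * norm (f y)) \<partial>lam u)"
  proof (rule nn_integral_mono_AE)
    have "AE y in lam u. grng G y = u" using F.AE_fibre[of u] u by simp
    moreover have "AE y in lam u. y \<in> arrows G"
      using F.space_m[of u] u by (intro AE_I2) (simp add: topspace_gtop)
    ultimately show "AE y in lam u. (\<integral>\<^sup>+\<omega>. ennreal (norm (k (y, \<omega>))) \<partial>mu u) \<le> ennreal (B * norm (f y))"
    proof eventually_elim
      case (elim y)
      have km2: "(\<lambda>\<omega>. ktr g y \<omega> - g \<omega>) \<in> borel_measurable (mu u)"
        using measurable_ktr2[OF g elim(2)] u gm by (simp add: Mu.measurable_m)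
      have "(\<integral>\<^sup>+\<omega>. ennreal (norm (k (y, \<omega>))) \<partial>mu u)
          = (\<integral>\<^sup>+\<omega>. ennreal (norm (f y)) * ennreal (norm (ktr g y \<omega> - g \<omega>)) \<partial>mu u)"
        by (simp add: k_def ennreal_mult[symmetric] norm_mult[symmetric] right_diff_distrib)
      also have "\<dots> = ennreal (norm (f y)) * (\<integral>\<^sup>+\<omega>. ennreal (norm (ktr g y \<omega> - g \<omega>)) \<partial>mu u)"
        by (rule nn_integral_cmult) (use km2 in measurable)
      also have "\<dots> \<le> ennreal (norm (f y)) * ennreal B"
        using B(2)[OF elim(2)] elim(1) by (cases "f y = 0") (auto intro: mult_left_mono)
      finally show ?case using B(1) by (simp add: ennreal_mult mult.commute)
    qed
  qed
  also have "\<dots> = ennreal (B * (LINT y|lam u. norm (f y)))"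
    using integrable_norm[OF F.Cc_integrable[OF _ f], of u] u B(1)
    by (subst nn_integral_eq_integral) auto
  finally have "(LINT \<omega>|mu u. norm (h \<omega>)) \<le> B * (LINT y|lam u. norm (f y))"
    using B(1) by (subst (asm) ennreal_le_iff) auto
  then show ?thesis by (simp add: h_def)
qed

end

lemma (in lc_groupoid) fibred_continuous_mean:
  assumes "continuous_mean G m" shows "fibred (gtop G) (grng G) (unit_top G) m"
proof (intro fibred.intro fibred_axioms.intro lcsc_gtop continuous_rng_unit)
  show "fibred_system (gtop G) (grng G) (unit_top G) m"
  proof (rule fibred_systemI_msupport[OF lcsc_gtop])
    fix u assume "u \<in> topspace (unit_top G)"
    then have u: "probability_on (gtop G) (m u)" "msupport (gtop G) (m u) \<subseteq> rfibre G u"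
      using assms by (auto simp: continuous_mean_def)
    show "sets (m u) = sets (borel_of (gtop G))" using u by (simp add: probability_on_def)
    show "msupport (gtop G) (m u) \<subseteq> {x. grng G x = u}" using u by (auto simp: rfibre_def)
    fix K
    have "emeasure (m u) K \<le> 1"
      using u(1) emeasure_space[of "m u" K] by (simp add: probability_on_def)
    then show "emeasure (m u) K < \<infinity>" using le_less_trans ennreal_one_less_top by fastforce
  qed (use assms in \<open>auto simp: continuous_mean_def\<close>)
qed

context coset_system
begin

text \<open>The condition \<open>g \<omega> = complex_of_real (norm (g \<omega>))\<close> says that \<open>g\<close> is real and nonnegative.\<close>

definition almost_invariant ::
  "('a \<Rightarrow> 'a measure) \<Rightarrow> 'a set \<Rightarrow> ('a \<Rightarrow> complex) set \<Rightarrow> real \<Rightarrow> ('a set \<Rightarrow> complex) set" where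
  "almost_invariant lam K \<F> e = {g \<in> Cc CT. (\<forall>\<omega>. g \<omega> = complex_of_real (norm (g \<omega>))) \<and>
     (\<forall>u\<in>gunits G. (LINT \<omega>|mu u. norm (g \<omega>)) \<le> 1) \<and>
     (\<forall>u\<in>K. 1 - e \<le> (LINT \<omega>|mu u. norm (g \<omega>))) \<and>
     (\<forall>f\<in>\<F>. \<forall>u\<in>gunits G.
        (LINT \<omega>|mu u. norm (L_Cc G H lam f g \<omega> - haar_integral lam f (coset_rng G \<omega>) * g \<omega>)) \<le> e)}"

text \<open>Convolve a normalised function on \<open>G/H\<close> with a cut-off of an almost invariant mean, chosen with error
  \<open>d\<close> over \<open>K\<close> and over the ranges and sources of the supports of the functions in \<open>\<F>\<close>.\<close>

lemma almost_invariant_nonempty: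
  assumes am: "amenable G" and lam: "haar_system G lam"
    and K: "compactin (unit_top G) K" and fin: "finite \<F>" and \<F>: "\<F> \<subseteq> Cc (gtop G)" and e: "0 < e"
  shows "almost_invariant lam K \<F> e \<noteq> {}"
proof -
  note FL = fibred_haar[OF lam]
  interpret L: fibred "gtop G" "grng G" "unit_top G" lam by (rule FL)
  have "\<exists>C\<ge>0. \<forall>u\<in>gunits G. (LINT y|lam u. norm (f y)) \<le> C" if "f \<in> \<F>" for f
    by (rule L.integral_norm_bounded[of f]) (use that \<F> in auto)
  then obtain C where C: "\<And>f. f \<in> \<F> \<Longrightarrow> 0 \<le> C f"
      "\<And>f u. f \<in> \<F> \<Longrightarrow> u \<in> gunits G \<Longrightarrow> (LINT y|lam u. norm (f y)) \<le> C f" by metis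
  have "\<exists>A. compactin (gtop G) A \<and> (\<forall>y. y \<notin> A \<longrightarrow> f y = 0)" if "f \<in> \<F>" for f
    by (rule T.Cc_E[of f]) (use that \<F> in auto)
  then obtain A where A: "\<And>f. f \<in> \<F> \<Longrightarrow> compactin (gtop G) (A f)"
      "\<And>f y. f \<in> \<F> \<Longrightarrow> y \<notin> A f \<Longrightarrow> f y = 0" by metis
  \<comment> \<open>\<open>D\<close> bounds the \<open>L\<^sup>1\<close> norms of all \<open>f \<in> \<F>\<close>, and \<open>D \<ge> 1\<close> ensures \<open>d \<le> e\<close>; the factor 3 accounts for two
    cut-offs and one total variation\<close>
  define D where "D = 1 + (\<Sum>f\<in>\<F>. C f)"
  have D: "1 \<le> D" "\<And>f. f \<in> \<F> \<Longrightarrow> C f \<le> D"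
    using C(1) fin member_le_sum[of _ \<F> C] by (auto simp: D_def sum_nonneg intro: add_increasing)
  define d where "d = e / (3 * D)"
  have d: "0 < d" "3 * d * D = e" using e D by (auto simp: d_def)
  have "d * 1 \<le> d * (3 * D)" using d D by (intro mult_left_mono) auto
  also have "\<dots> = e" using d(2) by (simp add: mult_ac)
  finally have de: "d \<le> e" by simp
  define AA where "AA = (\<Union>f\<in>\<F>. A f)"
  have AA: "compactin (gtop G) AA"
    unfolding AA_def using A fin by (intro compactin_Union) auto
  have AAs: "AA \<subseteq> arrows G" using compactin_subset_topspace[OF AA] by (simp add: topspace_gtop)
  define K' where "K' = K \<union> grng G ` AA \<union> gdom G ` AA"
  have K': "compactin (unit_top G) K'"
    unfolding K'_def using K image_compactin[OF AA continuous_rng_unit] image_compactin[OF AA continuous_dom_unit]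
    by (intro compactin_Un)
  obtain F where F: "F \<noteq> bot" "\<forall>\<^sub>F m in F. continuous_mean G m"
      "\<And>K e. compactin (gtop G) K \<Longrightarrow> e > 0 \<Longrightarrow> \<forall>\<^sub>F m in F. \<forall>g\<in>K.
        tv_norm_diff (translate_measure G (ginv G g) (m (grng G g))) (m (gdom G g)) < e"
    using am unfolding amenable_def by blast
  have "compactin (gtop G) (ginv G ` AA)" by (rule image_compactin[OF AA continuous_inv])
  from eventually_conj[OF F(2) F(3)[OF this d(1)]]
  obtain m where m: "continuous_mean G m"
      "\<forall>g\<in>ginv G ` AA. tv_norm_diff (translate_measure G (ginv G g) (m (grng G g))) (m (gdom G g)) < d"
    using eventually_happens'[OF F(1)] by blast
  \<comment> \<open>amenability is applied to the inverse of \<open>y\<close>\<close>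
  have tv: "tv_norm_diff (translate_measure G y (m (gdom G y))) (m (grng G y)) < d" if "y \<in> AA" for y
    using m(2)[rule_format, of "ginv G y"] that AAs by auto
  note FM = fibred_continuous_mean[OF m(1)]
  interpret M: fibred "gtop G" "grng G" "unit_top G" m by (rule FM)
  have prob: "emeasure (m u) (space (m u)) = 1" if "u \<in> gunits G" for u
    using m(1) that by (simp add: continuous_mean_def probability_on_def)
  obtain c where c: "(\<lambda>x. complex_of_real (c x)) \<in> Cc (gtop G)" "\<And>x. 0 \<le> c x" "\<And>x. c x \<le> 1"
      "\<And>u. u \<in> K' \<Longrightarrow> 1 - d < (LINT x|m u. c x)"
    by (rule M.uniformly_tight[OF _ K' d(1)]) (use prob in auto)
  obtain S where S: "compactin (gtop G) S" "\<And>x. x \<notin> S \<Longrightarrow> c x = 0"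
    by (rule T.Cc_E[OF c(1)]) auto
  have "msupport CT (mu u) \<noteq> {}" if "u \<in> gunits G" for u
  proof -
    have "coset u \<in> msupport CT (mu u)"
      using equivariant_system that gunits_arrows[OF that]
      by (auto simp: full_equivariant_system_def coset_fibre_def)
    then show ?thesis by blast
  qed
  then obtain \<phi> where \<phi>: "(\<lambda>x. complex_of_real (\<phi> x)) \<in> Cc CT" "\<And>x. 0 \<le> \<phi> x"
    "\<And>u. u \<in> gunits G \<Longrightarrow> (LINT x|mu u. \<phi> x) \<le> 1" "\<And>u. u \<in> gdom G ` S \<Longrightarrow> (LINT x|mu u. \<phi> x) = 1"
    using Mu.normalised_function[OF _ image_compactin[OF S(1) continuous_dom_unit]] by auto
  define g where "g = L_Cc G H m (\<lambda>x. complex_of_real (c x)) (\<lambda>x. complex_of_real (\<phi> x))"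
  have gC: "g \<in> Cc CT" unfolding g_def by (rule L_Cc_in_Cc[OF FM c(1) \<phi>(1)])
  have gpos: "g \<omega> = complex_of_real (norm (g \<omega>))" for \<omega>
    unfolding g_def by (rule L_Cc_eq_norm[OF FM c(1) _ \<phi>(1)]) (use c \<phi> in auto)
  have gint: "(LINT \<omega>|mu u. norm (g \<omega>)) = (LINT x|m u. c x)" if u: "u \<in> gunits G" for u
  proof -
    have "ennreal (LINT \<omega>|mu u. norm (g \<omega>)) = (\<integral>\<^sup>+\<omega>. ennreal (norm (g \<omega>)) \<partial>mu u)"
      using Mu.nn_integral_norm_Cc[OF _ gC, of u] u by simp
    also have "\<dots> = (\<integral>\<^sup>+y. ennreal (norm (complex_of_real (c y)) *
        (LINT \<omega>|mu (gdom G y). norm (complex_of_real (\<phi> \<omega>)))) \<partial>m u)"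
      unfolding g_def by (rule nn_integral_L_Cc_eq[OF FM c(1) _ \<phi>(1) _ u]) (use c \<phi> in auto)
    also have "\<dots> = (\<integral>\<^sup>+y. ennreal (c y) \<partial>m u)"
    proof (rule nn_integral_cong)
      fix y
      show "ennreal (norm (complex_of_real (c y)) * (LINT \<omega>|mu (gdom G y). norm (complex_of_real (\<phi> \<omega>)))) = ennreal (c y)"
        using S(2)[of y] \<phi>(2,4) c(2) by (cases "y \<in> S") auto
    qed
    also have "\<dots> = ennreal (LINT x|m u. c x)"
      using M.Cc_real_integrable[OF c(1), of u] u c(2) by (intro nn_integral_eq_integral) auto
    finally show ?thesis using c(2) by (subst (asm) ennreal_inj) (auto intro: integral_nonneg_AE)
  qed
  have cle: "(LINT x|m u. c x) \<le> 1" if u: "u \<in> gunits G" for u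
  proof -
    interpret P: finite_measure "m u" by (rule finite_measureI) (simp add: prob[OF u])
    have "(LINT x|m u. c x) \<le> (LINT x|m u. 1)"
      using M.Cc_real_integrable[OF c(1), of u] u c(3) by (intro integral_mono) auto
    then show ?thesis using prob[OF u] by (simp add: measure_def)
  qed
  have inv: "(\<integral>\<^sup>+\<omega>. ennreal (norm (ktr g y \<omega> - g \<omega>)) \<partial>mu (grng G y)) \<le> ennreal (3 * d)" if y: "y \<in> AA" for y
  proof -
    have yA: "y \<in> arrows G" using y AAs by blast
    have "(\<integral>\<^sup>+\<omega>. ennreal (norm (ktr g y \<omega> - g \<omega>)) \<partial>mu (grng G y))
      \<le> ennreal ((1 - (LINT x|m (gdom G y). c x))
        + tv_norm_diff (translate_measure G y (m (gdom G y))) (m (grng G y))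
        + (1 - (LINT x|m (grng G y). c x)))"
      unfolding g_def by (rule almost_invariant_translate[OF FM prob c(1-3) \<phi>(1) _ yA])
        (use \<phi> in auto)
    also have "\<dots> \<le> ennreal (3 * d)"
      using tv[OF y] c(4)[of "gdom G y"] c(4)[of "grng G y"] y
      by (intro ennreal_leI) (auto simp: K'_def)
    finally show ?thesis .
  qed
  have "g \<in> almost_invariant lam K \<F> e"
    unfolding almost_invariant_def
  proof (intro CollectI conjI ballI allI gC gpos)
    fix u assume "u \<in> gunits G"
    then show "(LINT \<omega>|mu u. norm (g \<omega>)) \<le> 1" using gint cle by simp
  next
    fix u assume u: "u \<in> K"
    then have "u \<in> gunits G" using compactin_subset_topspace[OF K] by auto
    then show "1 - e \<le> (LINT \<omega>|mu u. norm (g \<omega>))"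
      using gint[of u] c(4)[of u] u de by (auto simp: K'_def)
  next
    fix f u assume f: "f \<in> \<F>" and u: "u \<in> gunits G"
    have "(LINT \<omega>|mu u. norm (L_Cc G H lam f g \<omega> - haar_integral lam f (coset_rng G \<omega>) * g \<omega>))
        \<le> 3 * d * (LINT y|lam u. norm (f y))"
    proof (rule almost_invariant_convolution[OF FL _ gC _ _ u])
      fix y assume "f y \<noteq> 0"
      then have "y \<in> AA" using A(2)[OF f, of y] f by (auto simp: AA_def)
      then show "(\<integral>\<^sup>+\<omega>. ennreal (norm (ktr g y \<omega> - g \<omega>)) \<partial>mu (grng G y)) \<le> ennreal (3 * d)"
        by (rule inv)
    qed (use f \<F> d in auto)
    also have "\<dots> \<le> 3 * d * D"
      using C(2)[OF f u] D(2)[OF f] d(1) by (intro mult_left_mono) auto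
    finally show "(LINT \<omega>|mu u. norm (L_Cc G H lam f g \<omega> - haar_integral lam f (coset_rng G \<omega>) * g \<omega>)) \<le> e"
      using d by simp
  qed
  then show ?thesis by blast
qed

end

section \<open>Completions and duals of seminormed function spaces\<close>

locale function_seminorm =
  fixes V :: "('b \<Rightarrow> complex) cnormed"
  assumes vadd_V: "vadd V = (\<lambda>f g x. f x + g x)"
    and vscale_V: "vscale V = (\<lambda>c f x. c * f x)"
    and zero_V: "(\<lambda>x. 0) \<in> vcarrier V"
    and add_closed: "f \<in> vcarrier V \<Longrightarrow> g \<in> vcarrier V \<Longrightarrow> (\<lambda>x. f x + g x) \<in> vcarrier V"
    and scale_closed: "f \<in> vcarrier V \<Longrightarrow> (\<lambda>x. c * f x) \<in> vcarrier V"
    and norm_triangle: "f \<in> vcarrier V \<Longrightarrow> g \<in> vcarrier V \<Longrightarrow> vnorm V (\<lambda>x. f x + g x) \<le> vnorm V f + vnorm V g"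
    and norm_scale: "f \<in> vcarrier V \<Longrightarrow> vnorm V (\<lambda>x. c * f x) \<le> norm c * vnorm V f"
begin

abbreviation E where "E \<equiv> completion V"

lemma diff_closed: "f \<in> vcarrier V \<Longrightarrow> g \<in> vcarrier V \<Longrightarrow> (\<lambda>x. f x - g x) \<in> vcarrier V"
  using add_closed[OF _ scale_closed[of g "- 1"], of f] by simp

lemma vdist_V: "vdist V f g = vnorm V (\<lambda>x. f x - g x)"
  by (simp add: vdist_def vadd_V vscale_V)

lemma norm_nonneg: assumes "f \<in> vcarrier V" shows "0 \<le> vnorm V f"
proof -
  have "vnorm V (\<lambda>x. 0) \<le> vnorm V (\<lambda>x. 0) + vnorm V (\<lambda>x. 0)"
    using norm_triangle[OF zero_V zero_V] by simp
  moreover have "vnorm V (\<lambda>x. 0) \<le> vnorm V f + vnorm V (\<lambda>x. - 1 * f x)"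
    using norm_triangle[OF assms scale_closed[OF assms, of "- 1"]] by simp
  moreover have "vnorm V (\<lambda>x. - 1 * f x) \<le> norm (- 1 :: complex) * vnorm V f"
    by (rule norm_scale[OF assms])
  ultimately show ?thesis by simp
qed

lemma vdist_nonneg: "f \<in> vcarrier V \<Longrightarrow> g \<in> vcarrier V \<Longrightarrow> 0 \<le> vdist V f g"
  by (simp add: vdist_V norm_nonneg diff_closed)

lemma vdist_self: "vdist V f f = 0"
  using norm_scale[OF zero_V, of 0] norm_nonneg[OF zero_V] by (simp add: vdist_V)

lemma vdist_commute: assumes "f \<in> vcarrier V" "g \<in> vcarrier V" shows "vdist V f g = vdist V g f"
  using norm_scale[OF diff_closed[OF assms], of "- 1"] norm_scale[OF diff_closed[OF assms(2,1)], of "- 1"]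
  by (simp add: vdist_V)

lemma vdist_triangle:
  assumes "f \<in> vcarrier V" "g \<in> vcarrier V" "h \<in> vcarrier V"
  shows "vdist V f h \<le> vdist V f g + vdist V g h"
  using norm_triangle[OF diff_closed[OF assms(1,2)] diff_closed[OF assms(2,3)]] by (simp add: vdist_V)

lemma norm_diff_le:
  assumes "f \<in> vcarrier V" "g \<in> vcarrier V" shows "\<bar>vnorm V f - vnorm V g\<bar> \<le> vdist V f g"
  using norm_triangle[OF diff_closed[OF assms] assms(2)] norm_triangle[OF diff_closed[OF assms(2,1)] assms(1)]
    vdist_commute[OF assms] by (simp add: vdist_V)

lemma vdist_add_le:
  assumes "f \<in> vcarrier V" "g \<in> vcarrier V" "f' \<in> vcarrier V" "g' \<in> vcarrier V"
  shows "vdist V (\<lambda>x. f x + g x) (\<lambda>x. f' x + g' x) \<le> vdist V f f' + vdist V g g'"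
proof -
  have "(\<lambda>x. f x + g x - (f' x + g' x)) = (\<lambda>x. (f x - f' x) + (g x - g' x))" by (auto simp: algebra_simps)
  then show ?thesis
    using norm_triangle[OF diff_closed[OF assms(1,3)] diff_closed[OF assms(2,4)]] by (simp add: vdist_V)
qed

lemma Cauchy_carrier: "vCauchy V X \<Longrightarrow> X n \<in> vcarrier V"
  by (simp add: vCauchy_def)

lemma cauchy_rel_iff: "(X, Y) \<in> cauchy_rel V \<longleftrightarrow>
    vCauchy V X \<and> vCauchy V Y \<and> (\<lambda>n. vdist V (X n) (Y n)) \<longlonglongrightarrow> 0"
  by (simp add: cauchy_rel_def)

lemma equiv_cauchy_rel: "equiv (Collect (vCauchy V)) (cauchy_rel V)"
proof (rule equivI)
  show "cauchy_rel V \<subseteq> Collect (vCauchy V) \<times> Collect (vCauchy V)" by (auto simp: cauchy_rel_iff)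
  show "refl_on (Collect (vCauchy V)) (cauchy_rel V)"
    by (auto simp: refl_on_def cauchy_rel_iff vdist_self)
  show "sym (cauchy_rel V)"
  proof (rule symI)
    fix X Y assume XY: "(X, Y) \<in> cauchy_rel V"
    then have "(\<lambda>n. vdist V (X n) (Y n)) = (\<lambda>n. vdist V (Y n) (X n))"
      by (intro ext vdist_commute) (auto simp: cauchy_rel_iff Cauchy_carrier)
    then show "(Y, X) \<in> cauchy_rel V" using XY by (simp add: cauchy_rel_iff)
  qed
  show "trans (cauchy_rel V)"
  proof (rule transI)
    fix X Y Z assume a: "(X, Y) \<in> cauchy_rel V" "(Y, Z) \<in> cauchy_rel V"
    then have c: "X n \<in> vcarrier V" "Y n \<in> vcarrier V" "Z n \<in> vcarrier V" for n
      by (auto simp: cauchy_rel_iff Cauchy_carrier)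
    have "(\<lambda>n. vdist V (X n) (Y n) + vdist V (Y n) (Z n)) \<longlonglongrightarrow> 0 + 0"
      using a by (intro tendsto_add) (auto simp: cauchy_rel_iff)
    then have "(\<lambda>n. vdist V (X n) (Z n)) \<longlonglongrightarrow> 0"
      by (intro tendsto_sandwich[of "\<lambda>_. 0" "\<lambda>n. vdist V (X n) (Z n)" _ "\<lambda>n. vdist V (X n) (Y n) + vdist V (Y n) (Z n)"])
        (use c vdist_nonneg vdist_triangle in auto)
    then show "(X, Z) \<in> cauchy_rel V" using a by (simp add: cauchy_rel_iff)
  qed
qed

lemma class_in: "vCauchy V X \<Longrightarrow> cauchy_class V X \<in> vcarrier E"
  by (simp add: completion_def cauchy_class_def quotientI)

lemma class_eq: "(X, Y) \<in> cauchy_rel V \<Longrightarrow> cauchy_class V X = cauchy_class V Y"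
  unfolding cauchy_class_def by (rule equiv_class_eq[OF equiv_cauchy_rel])

lemma rep_class: assumes "vCauchy V X" shows "(X, cauchy_rep (cauchy_class V X)) \<in> cauchy_rel V"
proof -
  have "X \<in> cauchy_class V X"
    unfolding cauchy_class_def using equiv_class_self[OF equiv_cauchy_rel] assms by simp
  then have "cauchy_rep (cauchy_class V X) \<in> cauchy_class V X"
    unfolding cauchy_rep_def by (rule someI[where P="\<lambda>Z. Z \<in> cauchy_class V X"])
  then show ?thesis by (simp add: cauchy_class_def)
qed

lemma E_cases:
  assumes "A \<in> vcarrier E" obtains X where "vCauchy V X" "A = cauchy_class V X"
  using assms by (auto simp: completion_def quotient_def cauchy_class_def)

lemma Cauchy_lipschitz:
  assumes X: "vCauchy V X" and Z: "\<And>n. Z n \<in> vcarrier V"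
    and le: "\<And>m n. vdist V (Z m) (Z n) \<le> C * vdist V (X m) (X n)"
  shows "vCauchy V Z"
  unfolding vCauchy_def
proof (intro conjI allI impI Z)
  fix e :: real assume "0 < e"
  then have e: "0 < e / (\<bar>C\<bar> + 1)" by simp
  then obtain N where N: "\<And>m n. m \<ge> N \<Longrightarrow> n \<ge> N \<Longrightarrow> vdist V (X m) (X n) < e / (\<bar>C\<bar> + 1)"
    using X unfolding vCauchy_def by blast
  have "vdist V (Z m) (Z n) < e" if "m \<ge> N" "n \<ge> N" for m n
  proof -
    have d: "0 \<le> vdist V (X m) (X n)" by (intro vdist_nonneg Cauchy_carrier X)
    have "vdist V (Z m) (Z n) \<le> (\<bar>C\<bar> + 1) * vdist V (X m) (X n)"
      using le[of m n] d by (smt (verit) mult_right_mono)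
    also have "\<dots> < (\<bar>C\<bar> + 1) * (e / (\<bar>C\<bar> + 1))"
      by (rule mult_strict_left_mono[OF N[OF that]]) simp
    finally show ?thesis by simp
  qed
  then show "\<exists>N. \<forall>m\<ge>N. \<forall>n\<ge>N. vdist V (Z m) (Z n) < e" by blast
qed

lemma Cauchy_const: "f \<in> vcarrier V \<Longrightarrow> vCauchy V (\<lambda>_. f)"
  by (simp add: vCauchy_def vdist_self)

lemma Cauchy_add:
  assumes X: "vCauchy V X" and Y: "vCauchy V Y" shows "vCauchy V (\<lambda>n x. X n x + Y n x)"
  unfolding vCauchy_def
proof (intro conjI allI impI)
  show "(\<lambda>x. X n x + Y n x) \<in> vcarrier V" for n
    by (intro add_closed Cauchy_carrier X Y)
  fix e :: real assume "0 < e"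
  then have e: "0 < e / 2" by simp
  obtain N where N: "\<And>m n. m \<ge> N \<Longrightarrow> n \<ge> N \<Longrightarrow> vdist V (X m) (X n) < e / 2"
    using X e unfolding vCauchy_def by blast
  obtain N' where N': "\<And>m n. m \<ge> N' \<Longrightarrow> n \<ge> N' \<Longrightarrow> vdist V (Y m) (Y n) < e / 2"
    using Y e unfolding vCauchy_def by blast
  have "vdist V (\<lambda>x. X m x + Y m x) (\<lambda>x. X n x + Y n x) < e" if "m \<ge> max N N'" "n \<ge> max N N'" for m n
    using vdist_add_le[OF Cauchy_carrier[OF X, of m] Cauchy_carrier[OF Y, of m]
        Cauchy_carrier[OF X, of n] Cauchy_carrier[OF Y, of n]] N[of m n] N'[of m n] that by simp
  then show "\<exists>N. \<forall>m\<ge>N. \<forall>n\<ge>N. vdist V (\<lambda>x. X m x + Y m x) (\<lambda>x. X n x + Y n x) < e" by blast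
qed

lemma vadd_class:
  assumes X: "vCauchy V X" and Y: "vCauchy V Y"
  shows "vadd E (cauchy_class V X) (cauchy_class V Y) = cauchy_class V (\<lambda>n x. X n x + Y n x)"
proof -
  let ?X = "cauchy_rep (cauchy_class V X)" and ?Y = "cauchy_rep (cauchy_class V Y)"
  have r: "(X, ?X) \<in> cauchy_rel V" "(Y, ?Y) \<in> cauchy_rel V" by (rule rep_class[OF X], rule rep_class[OF Y])
  then have c: "vCauchy V ?X" "vCauchy V ?Y" by (auto simp: cauchy_rel_iff)
  have "(\<lambda>n. vdist V (X n) (?X n) + vdist V (Y n) (?Y n)) \<longlonglongrightarrow> 0 + 0"
    using r by (intro tendsto_add) (auto simp: cauchy_rel_iff)
  then have "(\<lambda>n. vdist V (\<lambda>x. X n x + Y n x) (\<lambda>x. ?X n x + ?Y n x)) \<longlonglongrightarrow> 0"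
    by (intro tendsto_sandwich[of "\<lambda>_. 0" "\<lambda>n. vdist V (\<lambda>x. X n x + Y n x) (\<lambda>x. ?X n x + ?Y n x)" _
          "\<lambda>n. vdist V (X n) (?X n) + vdist V (Y n) (?Y n)"])
      (use Cauchy_carrier[OF X] Cauchy_carrier[OF Y] Cauchy_carrier[OF c(1)] Cauchy_carrier[OF c(2)]
        in \<open>auto intro!: always_eventually vdist_nonneg vdist_add_le add_closed\<close>)
  then have "((\<lambda>n x. X n x + Y n x), (\<lambda>n x. ?X n x + ?Y n x)) \<in> cauchy_rel V"
    using Cauchy_add[OF X Y] Cauchy_add[OF c] by (simp add: cauchy_rel_iff)
  then show ?thesis by (simp add: completion_def vadd_V class_eq)
qed

definition bounded_op :: "(('b \<Rightarrow> complex) \<Rightarrow> 'b \<Rightarrow> complex) \<Rightarrow> bool" where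
  "bounded_op S \<longleftrightarrow> (\<forall>f\<in>vcarrier V. S f \<in> vcarrier V) \<and>
     (\<forall>f\<in>vcarrier V. \<forall>g\<in>vcarrier V. S (\<lambda>x. f x + g x) = (\<lambda>x. S f x + S g x)) \<and>
     (\<forall>c. \<forall>f\<in>vcarrier V. S (\<lambda>x. c * f x) = (\<lambda>x. c * S f x)) \<and>
     (\<exists>C\<ge>0. \<forall>f\<in>vcarrier V. vnorm V (S f) \<le> C * vnorm V f)"

lemma bounded_opD:
  assumes "bounded_op S"
  shows "f \<in> vcarrier V \<Longrightarrow> S f \<in> vcarrier V"
    and "f \<in> vcarrier V \<Longrightarrow> g \<in> vcarrier V \<Longrightarrow> S (\<lambda>x. f x + g x) = (\<lambda>x. S f x + S g x)"
    and "f \<in> vcarrier V \<Longrightarrow> S (\<lambda>x. c * f x) = (\<lambda>x. c * S f x)"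
  using assms by (simp_all add: bounded_op_def)

lemma bounded_op_diff:
  assumes "bounded_op S" "f \<in> vcarrier V" "g \<in> vcarrier V"
  shows "S (\<lambda>x. f x - g x) = (\<lambda>x. S f x - S g x)"
proof -
  have "S (\<lambda>x. f x + - 1 * g x) = (\<lambda>x. S f x + S (\<lambda>x. - 1 * g x) x)"
    by (rule bounded_opD(2)[OF assms(1,2) scale_closed[OF assms(3)]])
  also have "S (\<lambda>x. - 1 * g x) = (\<lambda>x. - 1 * S g x)" by (rule bounded_opD(3)[OF assms(1,3)])
  finally show ?thesis by simp
qed

lemma bounded_op_lipschitz:
  assumes S: "bounded_op S"
  obtains C where "\<And>f g. f \<in> vcarrier V \<Longrightarrow> g \<in> vcarrier V \<Longrightarrow> vdist V (S f) (S g) \<le> C * vdist V f g"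
proof -
  obtain C where C: "\<And>f. f \<in> vcarrier V \<Longrightarrow> vnorm V (S f) \<le> C * vnorm V f"
    using S unfolding bounded_op_def by blast
  show ?thesis
    by (rule that[of C]) (use C[OF diff_closed] bounded_op_diff[OF S] in \<open>auto simp: vdist_V\<close>)
qed

lemma Cauchy_op: assumes S: "bounded_op S" and X: "vCauchy V X" shows "vCauchy V (\<lambda>n. S (X n))"
proof -
  obtain C where C: "\<And>f g. f \<in> vcarrier V \<Longrightarrow> g \<in> vcarrier V \<Longrightarrow> vdist V (S f) (S g) \<le> C * vdist V f g"
    by (rule bounded_op_lipschitz[OF S]) blast
  show ?thesis
    by (rule Cauchy_lipschitz[OF X, of _ C])
      (use S C Cauchy_carrier[OF X] in \<open>auto simp: bounded_op_def\<close>)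
qed

lemma extend_op_class:
  assumes S: "bounded_op S" and X: "vCauchy V X"
  shows "extend_op V S (cauchy_class V X) = cauchy_class V (\<lambda>n. S (X n))"
proof -
  let ?X = "cauchy_rep (cauchy_class V X)"
  have r: "(X, ?X) \<in> cauchy_rel V" by (rule rep_class[OF X])
  then have c: "vCauchy V ?X" by (auto simp: cauchy_rel_iff)
  obtain C where C: "\<And>f g. f \<in> vcarrier V \<Longrightarrow> g \<in> vcarrier V \<Longrightarrow> vdist V (S f) (S g) \<le> C * vdist V f g"
    by (rule bounded_op_lipschitz[OF S]) blast
  have SV: "S f \<in> vcarrier V" if "f \<in> vcarrier V" for f using S that by (simp add: bounded_op_def)
  have "(\<lambda>n. C * vdist V (X n) (?X n)) \<longlonglongrightarrow> C * 0"
    using r by (intro tendsto_mult tendsto_const) (auto simp: cauchy_rel_iff)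
  then have "(\<lambda>n. vdist V (S (X n)) (S (?X n))) \<longlonglongrightarrow> 0"
    by (intro tendsto_sandwich[of "\<lambda>_. 0" "\<lambda>n. vdist V (S (X n)) (S (?X n))" _ "\<lambda>n. C * vdist V (X n) (?X n)"])
      (use Cauchy_carrier[OF X] Cauchy_carrier[OF c]
        in \<open>auto intro!: always_eventually vdist_nonneg C SV\<close>)
  then have "((\<lambda>n. S (X n)), (\<lambda>n. S (?X n))) \<in> cauchy_rel V"
    using Cauchy_op[OF S X] Cauchy_op[OF S c] by (simp add: cauchy_rel_iff)
  then show ?thesis by (simp add: extend_op_def class_eq)
qed

lemma bounded_op_scale: "bounded_op (\<lambda>f x. c * f x)"
  unfolding bounded_op_def using norm_scale[of _ c] scale_closed
  by (auto simp: algebra_simps intro!: exI[of _ "norm c"])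

text \<open>Scalar multiplication is a bounded operator, and the one on the completion is its extension.\<close>

lemma vscale_class:
  assumes X: "vCauchy V X"
  shows "vscale E c (cauchy_class V X) = cauchy_class V (\<lambda>n x. c * X n x)"
  using extend_op_class[OF bounded_op_scale X, of c]
  by (simp add: completion_def extend_op_def vscale_V)

text \<open>A Lipschitz function extends to the completion: its values along a Cauchy sequence converge,
  with the same limit for the chosen representative of the class.\<close>

lemma lipschitz_limit:
  fixes \<phi> :: "('b \<Rightarrow> complex) \<Rightarrow> 'd::banach"
  assumes X: "vCauchy V X"
    and lip: "\<And>f g. f \<in> vcarrier V \<Longrightarrow> g \<in> vcarrier V \<Longrightarrow> norm (\<phi> f - \<phi> g) \<le> C * vdist V f g"
  shows "(\<lambda>n. \<phi> (X n)) \<longlonglongrightarrow> lim (\<lambda>n. \<phi> (cauchy_rep (cauchy_class V X) n))"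
proof -
  let ?X = "cauchy_rep (cauchy_class V X)"
  have r: "(X, ?X) \<in> cauchy_rel V" by (rule rep_class[OF X])
  then have c: "vCauchy V ?X" by (auto simp: cauchy_rel_iff)
  have lip': "norm (\<phi> f - \<phi> g) \<le> (\<bar>C\<bar> + 1) * vdist V f g" if "f \<in> vcarrier V" "g \<in> vcarrier V" for f g
    using lip[OF that] vdist_nonneg[OF that] by (smt (verit) mult_right_mono)
  have "Cauchy (\<lambda>n. \<phi> (?X n))"
    unfolding Cauchy_def dist_norm
  proof (intro allI impI)
    fix e :: real assume "0 < e"
    then have "0 < e / (\<bar>C\<bar> + 1)" by simp
    then obtain N where N: "\<And>m n. m \<ge> N \<Longrightarrow> n \<ge> N \<Longrightarrow> vdist V (?X m) (?X n) < e / (\<bar>C\<bar> + 1)"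
      using c unfolding vCauchy_def by blast
    have "norm (\<phi> (?X m) - \<phi> (?X n)) < e" if "m \<ge> N" "n \<ge> N" for m n
    proof -
      have "norm (\<phi> (?X m) - \<phi> (?X n)) \<le> (\<bar>C\<bar> + 1) * vdist V (?X m) (?X n)"
        by (intro lip' Cauchy_carrier c)
      also have "\<dots> < (\<bar>C\<bar> + 1) * (e / (\<bar>C\<bar> + 1))"
        by (rule mult_strict_left_mono[OF N[OF that]]) simp
      finally show ?thesis by simp
    qed
    then show "\<exists>M. \<forall>m\<ge>M. \<forall>n\<ge>M. norm (\<phi> (?X m) - \<phi> (?X n)) < e" by blast
  qed
  then have "(\<lambda>n. \<phi> (?X n)) \<longlonglongrightarrow> lim (\<lambda>n. \<phi> (?X n))"
    by (simp add: Cauchy_convergent_iff convergent_LIMSEQ_iff)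
  moreover have "(\<lambda>n. \<phi> (X n) - \<phi> (?X n)) \<longlonglongrightarrow> 0"
  proof (rule Lim_null_comparison[of _ "\<lambda>n. C * vdist V (X n) (?X n)"])
    show "(\<lambda>n. C * vdist V (X n) (?X n)) \<longlonglongrightarrow> 0"
      using r tendsto_mult_left[of "\<lambda>n. vdist V (X n) (?X n)" 0 sequentially C] by (simp add: cauchy_rel_iff)
  qed (use lip[OF Cauchy_carrier[OF X] Cauchy_carrier[OF c]] in auto)
  ultimately have "(\<lambda>n. \<phi> (?X n) + (\<phi> (X n) - \<phi> (?X n))) \<longlonglongrightarrow> lim (\<lambda>n. \<phi> (?X n)) + 0"
    by (rule tendsto_add)
  then show ?thesis by simp
qed

lemma vnorm_class:
  assumes X: "vCauchy V X"
  shows "(\<lambda>n. vnorm V (X n)) \<longlonglongrightarrow> vnorm E (cauchy_class V X)"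
  using lipschitz_limit[OF X, of "vnorm V" 1] norm_diff_le by (simp add: completion_def)

lemma vnorm_E_nonneg: "A \<in> vcarrier E \<Longrightarrow> 0 \<le> vnorm E A"
  by (erule E_cases) (auto intro!: LIMSEQ_le_const[OF vnorm_class] norm_nonneg Cauchy_carrier)

lemma embed_in: "f \<in> vcarrier V \<Longrightarrow> embed V f \<in> vcarrier E"
  by (simp add: embed_def class_in Cauchy_const)

lemma vnorm_embed: "f \<in> vcarrier V \<Longrightarrow> vnorm E (embed V f) = vnorm V f"
  using LIMSEQ_unique[OF vnorm_class[OF Cauchy_const] tendsto_const] by (simp add: embed_def)

lemma extend_op_embed: "bounded_op S \<Longrightarrow> f \<in> vcarrier V \<Longrightarrow> extend_op V S (embed V f) = embed V (S f)"
  by (simp add: embed_def extend_op_class Cauchy_const)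

lemma dual_iff: "\<nu> \<in> vcarrier (dual E) \<longleftrightarrow>
       (\<forall>x\<in>vcarrier E. \<forall>y\<in>vcarrier E. \<nu> (vadd E x y) = \<nu> x + \<nu> y) \<and>
       (\<forall>c. \<forall>x\<in>vcarrier E. \<nu> (vscale E c x) = c * \<nu> x) \<and>
       (\<exists>C. \<forall>x\<in>vcarrier E. norm (\<nu> x) \<le> C * vnorm E x) \<and>
       (\<forall>x. x \<notin> vcarrier E \<longrightarrow> \<nu> x = 0)"
  by (simp add: dual_def)

lemma dual_class_add:
  assumes "\<nu> \<in> vcarrier (dual E)" "vCauchy V X" "vCauchy V Y"
  shows "\<nu> (cauchy_class V (\<lambda>n x. X n x + Y n x)) = \<nu> (cauchy_class V X) + \<nu> (cauchy_class V Y)"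
  using assms(1) class_in[OF assms(2)] class_in[OF assms(3)] vadd_class[OF assms(2,3)]
  unfolding dual_iff by metis

lemma dual_class_scale:
  assumes "\<nu> \<in> vcarrier (dual E)" "vCauchy V X"
  shows "\<nu> (cauchy_class V (\<lambda>n x. c * X n x)) = c * \<nu> (cauchy_class V X)"
  using assms(1) class_in[OF assms(2)] vscale_class[OF assms(2), of c]
  unfolding dual_iff by metis

lemma dual_embed_diff:
  assumes \<nu>: "\<nu> \<in> vcarrier (dual E)" and f: "f \<in> vcarrier V" and g: "g \<in> vcarrier V"
  shows "\<nu> (embed V (\<lambda>x. f x - g x)) = \<nu> (embed V f) - \<nu> (embed V g)"
  using dual_class_add[OF \<nu> Cauchy_const[OF f] Cauchy_const[OF scale_closed[OF g, of "- 1"]]]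
    dual_class_scale[OF \<nu> Cauchy_const[OF g], of "- 1"]
  by (simp add: embed_def)

lemma dual_bound:
  assumes "\<nu> \<in> vcarrier (dual E)"
  obtains C where "0 \<le> C" "\<And>A. A \<in> vcarrier E \<Longrightarrow> norm (\<nu> A) \<le> C * vnorm E A"
proof -
  obtain C where C: "\<And>A. A \<in> vcarrier E \<Longrightarrow> norm (\<nu> A) \<le> C * vnorm E A"
    using assms unfolding dual_iff by blast
  have "norm (\<nu> A) \<le> \<bar>C\<bar> * vnorm E A" if "A \<in> vcarrier E" for A
    using C[OF that] vnorm_E_nonneg[OF that] by (smt (verit) mult_right_mono)
  then show ?thesis by (intro that[of "\<bar>C\<bar>"]) auto
qed

lemma dual_add_closed:
  assumes \<nu>: "\<nu> \<in> vcarrier (dual E)" "\<nu>' \<in> vcarrier (dual E)"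
  shows "vadd (dual E) \<nu> \<nu>' \<in> vcarrier (dual E)"
proof -
  obtain C where C: "\<And>A. A \<in> vcarrier E \<Longrightarrow> norm (\<nu> A) \<le> C * vnorm E A"
    by (rule dual_bound[OF \<nu>(1)]) blast
  obtain C' where C': "\<And>A. A \<in> vcarrier E \<Longrightarrow> norm (\<nu>' A) \<le> C' * vnorm E A"
    by (rule dual_bound[OF \<nu>(2)]) blast
  have "norm (\<nu> A + \<nu>' A) \<le> (C + C') * vnorm E A" if "A \<in> vcarrier E" for A
    using norm_triangle_ineq[of "\<nu> A" "\<nu>' A"] C[OF that] C'[OF that] by (simp add: distrib_right)
  then have "\<exists>C. \<forall>A\<in>vcarrier E. norm (\<nu> A + \<nu>' A) \<le> C * vnorm E A" by blast
  then show ?thesis using \<nu> unfolding dual_iff by (simp add: dual_def distrib_left)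
qed

lemma dual_scale_closed:
  assumes \<nu>: "\<nu> \<in> vcarrier (dual E)"
  shows "vscale (dual E) c \<nu> \<in> vcarrier (dual E)"
proof -
  obtain C where C: "\<And>A. A \<in> vcarrier E \<Longrightarrow> norm (\<nu> A) \<le> C * vnorm E A"
    by (rule dual_bound[OF \<nu>]) blast
  have "norm (c * \<nu> A) \<le> (norm c * C) * vnorm E A" if "A \<in> vcarrier E" for A
    using mult_left_mono[OF C[OF that], of "norm c"] by (simp add: norm_mult mult.assoc)
  then have "\<exists>C. \<forall>A\<in>vcarrier E. norm (c * \<nu> A) \<le> C * vnorm E A" by blast
  then show ?thesis using \<nu> unfolding dual_iff by (simp add: dual_def distrib_left mult.left_commute)
qed

lemma dual_norm_bound:
  assumes \<nu>: "\<nu> \<in> vcarrier (dual E)" and f: "f \<in> vcarrier V" "vnorm V f \<le> 1"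
  shows "norm (\<nu> (embed V f)) \<le> vnorm (dual E) \<nu>"
proof -
  obtain C where C: "0 \<le> C" "\<And>A. A \<in> vcarrier E \<Longrightarrow> norm (\<nu> A) \<le> C * vnorm E A"
    by (rule dual_bound[OF \<nu>]) blast
  have "norm (\<nu> (embed V f)) \<le> (SUP x\<in>{x \<in> vcarrier E. vnorm E x \<le> 1}. norm (\<nu> x))"
  proof (rule cSUP_upper)
    show "embed V f \<in> {x \<in> vcarrier E. vnorm E x \<le> 1}" using f by (simp add: embed_in vnorm_embed)
    have "norm (\<nu> x) \<le> C" if "x \<in> vcarrier E" "vnorm E x \<le> 1" for x
      using C(2)[OF that(1)] mult_left_mono[OF that(2) C(1)] by simp
    then show "bdd_above ((\<lambda>x. norm (\<nu> x)) ` {x \<in> vcarrier E. vnorm E x \<le> 1})"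
      by (intro bdd_aboveI2[of _ _ C]) auto
  qed
  then show ?thesis by (simp add: dual_def)
qed

text \<open>A bounded operator acts termwise on Cauchy sequences, so linearity and boundedness of the transpose
  can be read off on classes.\<close>

lemma transpose_in_dual:
  assumes S: "bounded_op S" and \<nu>: "\<nu> \<in> vcarrier (dual E)"
  shows "transpose_op E (extend_op V S) \<nu> \<in> vcarrier (dual E)"
proof -
  let ?t = "transpose_op E (extend_op V S) \<nu>"
  have t: "?t (cauchy_class V X) = \<nu> (cauchy_class V (\<lambda>n. S (X n)))" if "vCauchy V X" for X
    using that by (simp add: transpose_op_def class_in extend_op_class[OF S])
  note add = bounded_opD(2)[OF S] and scale = bounded_opD(3)[OF S]
  obtain C where C: "0 \<le> C" "\<And>A. A \<in> vcarrier E \<Longrightarrow> norm (\<nu> A) \<le> C * vnorm E A"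
    by (rule dual_bound[OF \<nu>]) blast
  obtain D where D: "0 \<le> D" "\<And>f. f \<in> vcarrier V \<Longrightarrow> vnorm V (S f) \<le> D * vnorm V f"
    using S unfolding bounded_op_def by blast
  show ?thesis
    unfolding dual_iff
  proof (intro conjI ballI allI impI)
    fix A B assume "A \<in> vcarrier E" "B \<in> vcarrier E"
    then obtain X Y where X: "vCauchy V X" "A = cauchy_class V X" and Y: "vCauchy V Y" "B = cauchy_class V Y"
      by (elim E_cases)
    have "(\<lambda>n. S (\<lambda>x. X n x + Y n x)) = (\<lambda>n x. S (X n) x + S (Y n) x)"
      by (intro ext fun_cong[OF add] Cauchy_carrier X Y)
    then show "?t (vadd E A B) = ?t A + ?t B"
      using X Y by (simp add: vadd_class t Cauchy_add dual_class_add[OF \<nu>] Cauchy_op[OF S])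
  next
    fix c A assume "A \<in> vcarrier E"
    then obtain X where X: "vCauchy V X" "A = cauchy_class V X" by (rule E_cases)
    have "(\<lambda>n. S (\<lambda>x. c * X n x)) = (\<lambda>n x. c * S (X n) x)"
      by (intro ext fun_cong[OF scale] Cauchy_carrier X)
    then show "?t (vscale E c A) = c * ?t A"
      using X Cauchy_op[OF bounded_op_scale X(1), of c]
      by (simp add: vscale_class t dual_class_scale[OF \<nu>] Cauchy_op[OF S])
  next
    have "norm (?t A) \<le> (C * D) * vnorm E A" if "A \<in> vcarrier E" for A
    proof -
      from that obtain X where X: "vCauchy V X" "A = cauchy_class V X" by (rule E_cases)
      have "vnorm E (cauchy_class V (\<lambda>n. S (X n))) \<le> D * vnorm E (cauchy_class V X)"
        by (rule LIMSEQ_le[OF vnorm_class[OF Cauchy_op[OF S X(1)]] tendsto_mult_left[OF vnorm_class[OF X(1)]]])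
          (use D(2) Cauchy_carrier[OF X(1)] in auto)
      then have "C * vnorm E (cauchy_class V (\<lambda>n. S (X n))) \<le> C * (D * vnorm E (cauchy_class V X))"
        by (rule mult_left_mono[OF _ C(1)])
      then show ?thesis
        using C(2)[OF class_in[OF Cauchy_op[OF S X(1)]]] X by (simp add: t mult.assoc)
    qed
    then show "\<exists>C. \<forall>x\<in>vcarrier E. norm (?t x) \<le> C * vnorm E x" by blast
  qed (simp add: transpose_op_def)
qed

definition bounded_functional :: "(('b \<Rightarrow> complex) \<Rightarrow> complex) \<Rightarrow> bool" where
  "bounded_functional \<phi> \<longleftrightarrow>
     (\<forall>f\<in>vcarrier V. \<forall>g\<in>vcarrier V. \<phi> (\<lambda>x. f x + g x) = \<phi> f + \<phi> g) \<and>
     (\<forall>c. \<forall>f\<in>vcarrier V. \<phi> (\<lambda>x. c * f x) = c * \<phi> f) \<and>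
     (\<exists>C. \<forall>f\<in>vcarrier V. norm (\<phi> f) \<le> C * vnorm V f)"

lemma bounded_functionalD:
  assumes "bounded_functional \<phi>"
  shows "f \<in> vcarrier V \<Longrightarrow> g \<in> vcarrier V \<Longrightarrow> \<phi> (\<lambda>x. f x + g x) = \<phi> f + \<phi> g"
    and "f \<in> vcarrier V \<Longrightarrow> \<phi> (\<lambda>x. c * f x) = c * \<phi> f"
  using assms by (simp_all add: bounded_functional_def)

lemma extend_functional_class:
  assumes \<phi>: "bounded_functional \<phi>" and X: "vCauchy V X"
  shows "(\<lambda>n. \<phi> (X n)) \<longlonglongrightarrow> extend_functional V \<phi> (cauchy_class V X)"
proof -
  obtain C where C: "\<And>f. f \<in> vcarrier V \<Longrightarrow> norm (\<phi> f) \<le> C * vnorm V f"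
    using \<phi> unfolding bounded_functional_def by blast
  have diff: "\<phi> f - \<phi> g = \<phi> (\<lambda>x. f x - g x)" if "f \<in> vcarrier V" "g \<in> vcarrier V" for f g
  proof -
    have "\<phi> (\<lambda>x. f x + - 1 * g x) = \<phi> f + \<phi> (\<lambda>x. - 1 * g x)"
      by (rule bounded_functionalD(1)[OF \<phi> that(1) scale_closed[OF that(2)]])
    also have "\<phi> (\<lambda>x. - 1 * g x) = - 1 * \<phi> g" by (rule bounded_functionalD(2)[OF \<phi> that(2)])
    finally show ?thesis by simp
  qed
  have "norm (\<phi> f - \<phi> g) \<le> C * vdist V f g" if "f \<in> vcarrier V" "g \<in> vcarrier V" for f g
    unfolding diff[OF that] vdist_V by (rule C[OF diff_closed[OF that]])
  from lipschitz_limit[OF X this] show ?thesis by (simp add: extend_functional_def class_in[OF X])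
qed

lemma extend_functional_embed:
  "bounded_functional \<phi> \<Longrightarrow> f \<in> vcarrier V \<Longrightarrow> extend_functional V \<phi> (embed V f) = \<phi> f"
  using LIMSEQ_unique[OF extend_functional_class[OF _ Cauchy_const] tendsto_const] by (simp add: embed_def)

lemma extend_functional_in_dual:
  assumes \<phi>: "bounded_functional \<phi>"
  shows "extend_functional V \<phi> \<in> vcarrier (dual E)"
proof -
  let ?e = "extend_functional V \<phi>"
  note add = bounded_functionalD(1)[OF \<phi>] and scale = bounded_functionalD(2)[OF \<phi>]
  obtain C where C: "\<And>f. f \<in> vcarrier V \<Longrightarrow> norm (\<phi> f) \<le> C * vnorm V f"
    using \<phi> unfolding bounded_functional_def by blast
  show ?thesis
    unfolding dual_iff
  proof (intro conjI ballI allI impI)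
    fix A B assume "A \<in> vcarrier E" "B \<in> vcarrier E"
    then obtain X Y where X: "vCauchy V X" "A = cauchy_class V X" and Y: "vCauchy V Y" "B = cauchy_class V Y"
      by (elim E_cases)
    have "(\<lambda>n. \<phi> (X n) + \<phi> (Y n)) \<longlonglongrightarrow> ?e A + ?e B"
      unfolding X Y by (intro tendsto_add extend_functional_class \<phi> X Y)
    moreover have "(\<lambda>n. \<phi> (X n) + \<phi> (Y n)) = (\<lambda>n. \<phi> (\<lambda>x. X n x + Y n x))"
      by (simp add: add Cauchy_carrier X Y)
    ultimately show "?e (vadd E A B) = ?e A + ?e B"
      using extend_functional_class[OF \<phi> Cauchy_add[OF X(1) Y(1)]] LIMSEQ_unique X Y
      by (simp add: vadd_class) blast
  next
    fix c A assume "A \<in> vcarrier E"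
    then obtain X where X: "vCauchy V X" "A = cauchy_class V X" by (rule E_cases)
    have "(\<lambda>n. c * \<phi> (X n)) \<longlonglongrightarrow> c * ?e A"
      unfolding X by (intro tendsto_mult tendsto_const extend_functional_class \<phi> X)
    moreover have "(\<lambda>n. c * \<phi> (X n)) = (\<lambda>n. \<phi> (\<lambda>x. c * X n x))"
      by (simp add: scale Cauchy_carrier X)
    ultimately show "?e (vscale E c A) = c * ?e A"
      using extend_functional_class[OF \<phi> Cauchy_op[OF bounded_op_scale X(1), of c]] LIMSEQ_unique X
      by (simp add: vscale_class) blast
  next
    have "norm (?e A) \<le> C * vnorm E A" if "A \<in> vcarrier E" for A
    proof -
      from that obtain X where X: "vCauchy V X" "A = cauchy_class V X" by (rule E_cases)
      show ?thesis
        unfolding X(2)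
        by (rule LIMSEQ_le[OF tendsto_norm[OF extend_functional_class[OF \<phi> X(1)]]
              tendsto_mult_left[OF vnorm_class[OF X(1)]]])
          (use C Cauchy_carrier[OF X(1)] in auto)
    qed
    then show "\<exists>C. \<forall>x\<in>vcarrier E. norm (?e x) \<le> C * vnorm E x" by blast
  qed (simp add: extend_functional_def)
qed

end

section \<open>The invariant mean\<close>

context coset_system
begin

lemma vcarrier_Cc_mu: "vcarrier (Cc_mu G H mu) = Cc CT"
  and vnorm_Cc_mu: "vnorm (Cc_mu G H mu) f = (SUP u\<in>gunits G. LINT \<omega>|mu u. norm (f \<omega>))"
  by (simp_all add: Cc_mu_def)

lemma integral_le_vnorm:
  assumes f: "f \<in> Cc CT" and u: "u \<in> gunits G"
  shows "(LINT \<omega>|mu u. norm (f \<omega>)) \<le> vnorm (Cc_mu G H mu) f"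
proof -
  obtain C where "\<And>u. u \<in> gunits G \<Longrightarrow> (LINT x|mu u. norm (f x)) \<le> C"
    by (rule Mu.integral_norm_bounded[OF f]) auto
  then show ?thesis
    unfolding vnorm_Cc_mu by (intro cSUP_upper[OF u] bdd_aboveI2)
qed

lemma vnorm_le:
  assumes "gunits G \<noteq> {}" "\<And>u. u \<in> gunits G \<Longrightarrow> (LINT \<omega>|mu u. norm (f \<omega>)) \<le> C"
  shows "vnorm (Cc_mu G H mu) f \<le> C"
  unfolding vnorm_Cc_mu using assms by (intro cSUP_least)

lemma function_seminorm_Cc_mu:
  assumes ne: "gunits G \<noteq> {}" shows "function_seminorm (Cc_mu G H mu)"
proof
  show "vadd (Cc_mu G H mu) = (\<lambda>f g x. f x + g x)" "vscale (Cc_mu G H mu) = (\<lambda>c f x. c * f x)"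
    by (simp_all add: Cc_mu_def)
  show "(\<lambda>x. 0) \<in> vcarrier (Cc_mu G H mu)" by (simp add: vcarrier_Cc_mu C.Cc_zero)
  fix f assume "f \<in> vcarrier (Cc_mu G H mu)"
  then have f: "f \<in> Cc CT" by (simp add: vcarrier_Cc_mu)
  show "(\<lambda>x. c * f x) \<in> vcarrier (Cc_mu G H mu)" for c
    by (simp add: vcarrier_Cc_mu C.Cc_scale[OF f])
  show "vnorm (Cc_mu G H mu) (\<lambda>x. c * f x) \<le> norm c * vnorm (Cc_mu G H mu) f" for c
    by (rule vnorm_le[OF ne]) (auto simp: norm_mult intro!: mult_left_mono integral_le_vnorm[OF f])
  fix g assume "g \<in> vcarrier (Cc_mu G H mu)"
  then have g: "g \<in> Cc CT" by (simp add: vcarrier_Cc_mu)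
  show "(\<lambda>x. f x + g x) \<in> vcarrier (Cc_mu G H mu)"
    by (simp add: vcarrier_Cc_mu C.Cc_add[OF f g])
  show "vnorm (Cc_mu G H mu) (\<lambda>x. f x + g x) \<le> vnorm (Cc_mu G H mu) f + vnorm (Cc_mu G H mu) g"
  proof (rule vnorm_le[OF ne])
    fix u assume u: "u \<in> gunits G"
    have i: "integrable (mu u) f" "integrable (mu u) g" using Mu.Cc_integrable[of u] f g u by auto
    have "(LINT x|mu u. norm (f x + g x)) \<le> (LINT x|mu u. norm (f x) + norm (g x))"
      using i by (intro integral_mono) (auto intro: norm_triangle_ineq)
    also have "\<dots> = (LINT x|mu u. norm (f x)) + (LINT x|mu u. norm (g x))" using i by simp
    also have "\<dots> \<le> vnorm (Cc_mu G H mu) f + vnorm (Cc_mu G H mu) g"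
      by (intro add_mono integral_le_vnorm f g u)
    finally show "(LINT x|mu u. norm (f x + g x)) \<le> vnorm (Cc_mu G H mu) f + vnorm (Cc_mu G H mu) g" .
  qed
qed

lemma ktr_add: "ktr (\<lambda>x. f x + g x) y \<omega> = ktr f y \<omega> + ktr g y \<omega>"
  and ktr_scale: "ktr (\<lambda>x. c * f x) y \<omega> = c * ktr f y \<omega>"
  by (simp_all add: ktr_def)

lemma bounded_op_L_Cc:
  assumes ne: "gunits G \<noteq> {}" and lam: "haar_system G lam" and f: "f \<in> Cc (gtop G)"
  shows "function_seminorm.bounded_op (Cc_mu G H mu) (L_Cc G H lam f)"
proof -
  note FL = fibred_haar[OF lam]
  interpret L: fibred "gtop G" "grng G" "unit_top G" lam by (rule FL)
  interpret V: function_seminorm "Cc_mu G H mu" by (rule function_seminorm_Cc_mu[OF ne])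
  obtain C where C: "0 \<le> C" "\<And>u. u \<in> gunits G \<Longrightarrow> (LINT y|lam u. norm (f y)) \<le> C"
    by (rule L.integral_norm_bounded[OF f]) auto
  show ?thesis
    unfolding V.bounded_op_def vcarrier_Cc_mu
  proof (intro conjI ballI allI)
    fix g assume g: "g \<in> Cc CT"
    show "L_Cc G H lam f g \<in> Cc CT" by (rule L_Cc_in_Cc[OF FL f g])
    show "L_Cc G H lam f (\<lambda>x. c * g x) = (\<lambda>x. c * L_Cc G H lam f g x)" for c
    proof
      fix \<omega> show "L_Cc G H lam f (\<lambda>x. c * g x) \<omega> = c * L_Cc G H lam f g \<omega>"
      proof (cases "\<omega> \<in> topspace CT")
        case True
        then show ?thesis by (simp add: L_Cc_eq ktr_scale mult.left_commute)
      qed (simp add: L_Cc_def)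
    qed
    fix h assume h: "h \<in> Cc CT"
    show "L_Cc G H lam f (\<lambda>x. g x + h x) = (\<lambda>x. L_Cc G H lam f g x + L_Cc G H lam f h x)"
    proof
      fix \<omega> show "L_Cc G H lam f (\<lambda>x. g x + h x) \<omega> = L_Cc G H lam f g \<omega> + L_Cc G H lam f h \<omega>"
      proof (cases "\<omega> \<in> topspace CT")
        case True
        then show ?thesis
          using integrable_mult_ktr[OF FL f g True, of "coset_rng G \<omega>"]
            integrable_mult_ktr[OF FL f h True, of "coset_rng G \<omega>"]
          by (simp add: L_Cc_eq ktr_add distrib_left)
      qed (simp add: L_Cc_def)
    qed
  next
    have "vnorm (Cc_mu G H mu) (L_Cc G H lam f g) \<le> C * vnorm (Cc_mu G H mu) g" if g: "g \<in> Cc CT" for g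
    proof (rule vnorm_le[OF ne])
      fix u assume u: "u \<in> gunits G"
      let ?n = "vnorm (Cc_mu G H mu) g"
      have n0: "0 \<le> ?n" using V.norm_nonneg g by (simp add: vcarrier_Cc_mu)
      have "ennreal (LINT \<omega>|mu u. norm (L_Cc G H lam f g \<omega>)) = (\<integral>\<^sup>+\<omega>. ennreal (norm (L_Cc G H lam f g \<omega>)) \<partial>mu u)"
        using Mu.nn_integral_norm_Cc[OF _ L_Cc_in_Cc[OF FL f g], of u] u by simp
      also have "\<dots> \<le> (\<integral>\<^sup>+y. ennreal (norm (f y) * (LINT \<omega>|mu (gdom G y). norm (g \<omega>))) \<partial>lam u)"
        by (rule nn_integral_L_Cc_le[OF FL f g u])
      also have "\<dots> \<le> (\<integral>\<^sup>+y. ennreal (norm (f y) * ?n) \<partial>lam u)"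
      proof (rule nn_integral_mono)
        fix y assume "y \<in> space (lam u)"
        then have "gdom G y \<in> gunits G" using L.space_m[of u] u by (simp add: topspace_gtop)
        then show "ennreal (norm (f y) * (LINT \<omega>|mu (gdom G y). norm (g \<omega>))) \<le> ennreal (norm (f y) * ?n)"
          by (intro ennreal_leI mult_left_mono integral_le_vnorm g) auto
      qed
      also have "\<dots> = ennreal ((LINT y|lam u. norm (f y)) * ?n)"
        using integrable_norm[OF L.Cc_integrable[OF _ f], of u] u n0
        by (subst nn_integral_eq_integral) auto
      finally have "(LINT \<omega>|mu u. norm (L_Cc G H lam f g \<omega>)) \<le> (LINT y|lam u. norm (f y)) * ?n"
        using n0 by (subst (asm) ennreal_le_iff) auto
      also have "\<dots> \<le> C * ?n" by (rule mult_right_mono[OF C(2)[OF u] n0])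
      finally show "(LINT \<omega>|mu u. norm (L_Cc G H lam f g \<omega>)) \<le> C * ?n" .
    qed
    then show "\<exists>C\<ge>0. \<forall>g\<in>Cc CT. vnorm (Cc_mu G H mu) (L_Cc G H lam f g) \<le> C * vnorm (Cc_mu G H mu) g"
      using C(1) by blast
  qed
qed

lemma bounded_op_mult:
  assumes ne: "gunits G \<noteq> {}" and k: "continuous_map CT euclidean (\<lambda>\<omega>. k (coset_rng G \<omega>))"
    and C: "0 \<le> C" "\<And>u. u \<in> gunits G \<Longrightarrow> norm (k u) \<le> C"
  shows "function_seminorm.bounded_op (Cc_mu G H mu) (\<lambda>g \<omega>. k (coset_rng G \<omega>) * g \<omega>)"
proof -
  interpret V: function_seminorm "Cc_mu G H mu" by (rule function_seminorm_Cc_mu[OF ne])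
  have "vnorm (Cc_mu G H mu) (\<lambda>\<omega>. k (coset_rng G \<omega>) * g \<omega>) \<le> C * vnorm (Cc_mu G H mu) g"
    if g: "g \<in> Cc CT" for g
  proof (rule vnorm_le[OF ne])
    fix u assume u: "u \<in> gunits G"
    have "(LINT \<omega>|mu u. norm (k (coset_rng G \<omega>) * g \<omega>)) \<le> (LINT \<omega>|mu u. C * norm (g \<omega>))"
    proof (rule integral_mono_AE)
      show "integrable (mu u) (\<lambda>\<omega>. norm (k (coset_rng G \<omega>) * g \<omega>))"
        by (rule integrable_norm[OF Mu.Cc_integrable[OF _ C.Cc_mult_continuous[OF g k]]]) (use u in simp)
      show "integrable (mu u) (\<lambda>\<omega>. C * norm (g \<omega>))" using Mu.Cc_integrable[OF _ g, of u] u by simp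
      have "AE \<omega> in mu u. coset_rng G \<omega> = u" using Mu.AE_fibre u by simp
      then show "AE \<omega> in mu u. norm (k (coset_rng G \<omega>) * g \<omega>) \<le> C * norm (g \<omega>)"
        by eventually_elim (simp add: norm_mult mult_right_mono C(2)[OF u])
    qed
    also have "\<dots> = C * (LINT \<omega>|mu u. norm (g \<omega>))" by simp
    also have "\<dots> \<le> C * vnorm (Cc_mu G H mu) g" by (rule mult_left_mono[OF integral_le_vnorm[OF g u] C(1)])
    finally show "(LINT \<omega>|mu u. norm (k (coset_rng G \<omega>) * g \<omega>)) \<le> C * vnorm (Cc_mu G H mu) g" .
  qed
  then show ?thesis
    unfolding V.bounded_op_def vcarrier_Cc_mu
    using C.Cc_mult_continuous[OF _ k] C(1) by (auto simp: algebra_simps)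
qed

lemma bounded_functional_comp_measure:
  assumes ne: "gunits G \<noteq> {}" and \<eta>: "probability_on (unit_top G) \<eta>"
  shows "function_seminorm.bounded_functional (Cc_mu G H mu) (\<lambda>g. LINT u|\<eta>. (LINT \<omega>|mu u. g \<omega>))"
    and "g \<in> Cc CT \<Longrightarrow> integrable \<eta> (\<lambda>u. LINT \<omega>|mu u. g \<omega>)"
proof -
  interpret V: function_seminorm "Cc_mu G H mu" by (rule function_seminorm_Cc_mu[OF ne])
  have s\<eta>: "sets \<eta> = sets (borel_of (unit_top G))" and 1: "emeasure \<eta> (space \<eta>) = 1"
    using \<eta> by (auto simp: probability_on_def)
  have sp: "space \<eta> = gunits G" using sets_eq_imp_space_eq[OF s\<eta>] by simp
  interpret P: finite_measure \<eta> by (rule finite_measureI) (simp add: 1)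
  have b: "norm (LINT \<omega>|mu u. g \<omega>) \<le> vnorm (Cc_mu G H mu) g" if "g \<in> Cc CT" "u \<in> gunits G" for g u
    using integral_norm_bound[of "mu u" g] integral_le_vnorm[OF that] by linarith
  show int: "integrable \<eta> (\<lambda>u. LINT \<omega>|mu u. g \<omega>)" if g: "g \<in> Cc CT" for g
  proof (rule P.integrable_const_bound)
    show "AE u in \<eta>. norm (LINT \<omega>|mu u. g \<omega>) \<le> vnorm (Cc_mu G H mu) g"
      by (rule AE_I2) (use b[OF g] sp in simp)
    have "(\<lambda>u. LINT \<omega>|mu u. g \<omega>) \<in> borel_measurable (borel_of (unit_top G))"
      by (rule borel_measurable_continuous_map[OF Mu.continuous_integral[OF g]])
    moreover have "borel_measurable \<eta> = borel_measurable (borel_of (unit_top G))"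
      by (rule measurable_cong_sets) (use s\<eta> in auto)
    ultimately show "(\<lambda>u. LINT \<omega>|mu u. g \<omega>) \<in> borel_measurable \<eta>" by blast
  qed
  show "V.bounded_functional (\<lambda>g. LINT u|\<eta>. (LINT \<omega>|mu u. g \<omega>))"
    unfolding V.bounded_functional_def vcarrier_Cc_mu
  proof (intro conjI ballI allI)
    fix f g assume f: "f \<in> Cc CT" and g: "g \<in> Cc CT"
    have "(LINT u|\<eta>. (LINT \<omega>|mu u. f \<omega> + g \<omega>)) = (LINT u|\<eta>. (LINT \<omega>|mu u. f \<omega>) + (LINT \<omega>|mu u. g \<omega>))"
      using Mu.Cc_integrable[OF _ f] Mu.Cc_integrable[OF _ g]
      by (intro Bochner_Integration.integral_cong refl) (simp add: sp)
    then show "(LINT u|\<eta>. (LINT \<omega>|mu u. f \<omega> + g \<omega>)) = (LINT u|\<eta>. (LINT \<omega>|mu u. f \<omega>)) + (LINT u|\<eta>. (LINT \<omega>|mu u. g \<omega>))"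
      using int[OF f] int[OF g] by simp
  next
    have "norm (LINT u|\<eta>. (LINT \<omega>|mu u. g \<omega>)) \<le> 1 * vnorm (Cc_mu G H mu) g" if g: "g \<in> Cc CT" for g
    proof -
      have "norm (LINT u|\<eta>. (LINT \<omega>|mu u. g \<omega>)) \<le> (LINT u|\<eta>. norm (LINT \<omega>|mu u. g \<omega>))"
        by (rule integral_norm_bound)
      also have "\<dots> \<le> (LINT u|\<eta>. vnorm (Cc_mu G H mu) g)"
        using int[OF g] b[OF g] by (intro integral_mono) (auto simp: sp)
      finally show ?thesis using 1 by (simp add: measure_def)
    qed
    then show "\<exists>C. \<forall>g\<in>Cc CT. norm (LINT u|\<eta>. (LINT \<omega>|mu u. g \<omega>)) \<le> C * vnorm (Cc_mu G H mu) g" by blast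
  qed simp
qed

text \<open>A probability measure on the unit space is concentrated up to \<open>d\<close> on a compact set \<open>K\<close>, and there the
  fibre integrals of \<open>g\<close> are between \<open>1 - d\<close> and 1.\<close>

lemma almost_invariant_comp_measure:
  assumes ne: "gunits G \<noteq> {}" and \<eta>: "probability_on (unit_top G) \<eta>" and e: "0 < e"
  obtains K d where "compactin (unit_top G) K" "0 < d"
    "\<And>g. g \<in> almost_invariant lam K {} d \<Longrightarrow> norm ((LINT u|\<eta>. (LINT \<omega>|mu u. g \<omega>)) - 1) \<le> e"
proof -
  interpret U: lcsc "unit_top G" by (rule lcsc_unit_top)
  have s\<eta>: "sets \<eta> = sets (borel_of (unit_top G))" and 1: "emeasure \<eta> (space \<eta>) = 1"
    using \<eta> by (auto simp: probability_on_def)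
  have sp: "space \<eta> = gunits G" using sets_eq_imp_space_eq[OF s\<eta>] by simp
  interpret P: finite_measure \<eta> by (rule finite_measureI) (simp add: 1)
  \<comment> \<open>the integral is at least \<open>(1 - d)\<^sup>2 \<ge> 1 - 2 * d\<close>, where \<open>d \<le> 1\<close> keeps the factors nonnegative\<close>
  define d where "d = min (e / 2) 1"
  have d: "0 < d" "d \<le> 1" "d \<le> e / 2" using e by (auto simp: d_def)
  obtain K where K: "\<And>n::nat. compactin (unit_top G) (K n)" "(\<Union>n. K n) = topspace (unit_top G)" "incseq K"
    by (rule U.sigma_compact) blast
  have Ks: "K n \<in> sets \<eta>" for n
    using U.compactin_imp_closedin[OF K(1)] by (simp add: s\<eta> closedin_sets_borel_of)
  have "(\<lambda>n. measure \<eta> (K n)) \<longlonglongrightarrow> measure \<eta> (\<Union>n. K n)"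
    by (rule P.finite_Lim_measure_incseq) (use Ks K in auto)
  also have "measure \<eta> (\<Union>n. K n) = 1" using K(2) 1 sp by (simp add: measure_def)
  finally have "\<forall>\<^sub>F n in sequentially. 1 - d < measure \<eta> (K n)"
    by (rule order_tendstoD) (use d in simp)
  then obtain n where n: "1 - d < measure \<eta> (K n)"
    by (meson eventually_happens' sequentially_bot)
  show ?thesis
  proof (rule that[OF K(1) d(1)])
    fix g assume g: "g \<in> almost_invariant lam (K n) {} d"
    have gC: "g \<in> Cc CT" and gp: "\<And>\<omega>. g \<omega> = complex_of_real (norm (g \<omega>))"
      and g1: "\<And>u. u \<in> gunits G \<Longrightarrow> (LINT \<omega>|mu u. norm (g \<omega>)) \<le> 1"
      and g2: "\<And>u. u \<in> K n \<Longrightarrow> 1 - d \<le> (LINT \<omega>|mu u. norm (g \<omega>))"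
      using g by (auto simp: almost_invariant_def)
    let ?N = "\<lambda>u. LINT \<omega>|mu u. norm (g \<omega>)"
    have gi: "(LINT \<omega>|mu u. g \<omega>) = complex_of_real (?N u)" for u
      by (subst gp) (rule integral_complex_of_real)
    have iN: "integrable \<eta> ?N"
      using integrable_Re[OF bounded_functional_comp_measure(2)[OF ne \<eta> gC]] by (simp add: gi)
    have "(LINT u|\<eta>. ?N u) \<le> (LINT u|\<eta>. 1)"
      using iN g1 by (intro integral_mono) (auto simp: sp)
    then have up: "(LINT u|\<eta>. ?N u) \<le> 1" using 1 by (simp add: measure_def)
    have "(1 - d) * (1 - d) \<le> (1 - d) * measure \<eta> (K n)"
      using n d by (intro mult_left_mono) auto
    also have "\<dots> = (LINT u|\<eta>. (1 - d) * indicator (K n) u)" using Ks by simp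
    also have "\<dots> \<le> (LINT u|\<eta>. ?N u)"
    proof (rule integral_mono)
      show "integrable \<eta> (\<lambda>u. (1 - d) * indicator (K n) u)"
        using Ks[of n] by (simp add: P.emeasure_finite less_top[symmetric])
      show "(1 - d) * indicator (K n) u \<le> ?N u" for u
        using g2[of u] by (auto simp: indicator_def)
    qed (rule iN)
    finally have "1 - 2 * d \<le> (LINT u|\<eta>. ?N u)"
      using d by (simp add: algebra_simps) (smt (verit) mult_nonneg_nonneg)
    then have "\<bar>(LINT u|\<eta>. ?N u) - 1\<bar> \<le> e" using up d(3) by simp
    moreover have "(LINT u|\<eta>. (LINT \<omega>|mu u. g \<omega>)) = complex_of_real (LINT u|\<eta>. ?N u)"
      unfolding gi by (rule integral_complex_of_real)
    ultimately show "norm ((LINT u|\<eta>. (LINT \<omega>|mu u. g \<omega>)) - 1) \<le> e"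
      by (metis norm_of_real of_real_1 of_real_diff)
  qed
qed

lemma almost_invariant_mono:
  "K \<subseteq> K' \<Longrightarrow> \<F> \<subseteq> \<F>' \<Longrightarrow> e' \<le> e \<Longrightarrow> almost_invariant lam K' \<F>' e' \<subseteq> almost_invariant lam K \<F> e"
  unfolding almost_invariant_def by (auto; force)

text \<open>On the dual of \<open>E\<close> the evaluation at a function of norm at most 1 is bounded by the dual norm, so all
  evaluations lie in a product of discs, which is compact. The finite intersection property holds
  since finitely many sets of almost invariant functions contain a common one.\<close>

lemma cluster_point_exists:
  assumes ne: "gunits G \<noteq> {}" and am: "amenable G" and lam: "haar_system G lam"
  defines "V \<equiv> Cc_mu G H mu"
  defines "ev \<equiv> (\<lambda>g \<nu>. if \<nu> \<in> vcarrier (dual (completion V)) then \<nu> (embed V g) else 0)"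
  obtains m where "\<And>\<nu>. \<nu> \<notin> vcarrier (dual (completion V)) \<Longrightarrow> m \<nu> = 0"
    "\<And>\<nu>. \<nu> \<in> vcarrier (dual (completion V)) \<Longrightarrow> norm (m \<nu>) \<le> vnorm (dual (completion V)) \<nu>"
    "\<And>K \<F> e. compactin (unit_top G) K \<Longrightarrow> finite \<F> \<Longrightarrow> \<F> \<subseteq> Cc (gtop G) \<Longrightarrow> 0 < e \<Longrightarrow>
       m \<in> closure (ev ` almost_invariant lam K \<F> e)"
proof -
  interpret V: function_seminorm V unfolding V_def by (rule function_seminorm_Cc_mu[OF ne])
  define b where "b \<nu> = (if \<nu> \<in> vcarrier (dual V.E) then vnorm (dual V.E) \<nu> else 0)" for \<nu>
  define S where "S = PiE UNIV (\<lambda>\<nu>. cball (0::complex) (b \<nu>))"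
  have "compactin (product_topology (\<lambda>\<nu>::'a E_dual. euclidean :: complex topology) UNIV) S"
    unfolding S_def compactin_PiE by simp
  then have S: "compact S" by (simp add: euclidean_product_topology)
  define I where "I = {(K, \<F>, e). compactin (unit_top G) K \<and> finite \<F> \<and> \<F> \<subseteq> Cc (gtop G) \<and> (0::real) < e}"
  define A where "A = (\<lambda>(K, \<F>, e). ev ` almost_invariant lam K \<F> e)"
  have AS: "A i \<subseteq> S" for i
  proof
    fix m assume "m \<in> A i"
    then obtain K \<F> e g where g: "g \<in> almost_invariant lam K \<F> e" "m = ev g"
      by (auto simp: A_def split: prod.splits)
    then have gV: "g \<in> vcarrier V" "vnorm V g \<le> 1"
      using vnorm_le[OF ne, of g 1] by (auto simp: almost_invariant_def V_def vcarrier_Cc_mu)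
    show "m \<in> S"
      using V.dual_norm_bound[OF _ gV] by (auto simp: S_def b_def g(2) ev_def)
  qed
  have fip: "S \<inter> (\<Inter>i\<in>I'. closure (A i)) \<noteq> {}" if I': "finite I'" "I' \<subseteq> I" for I'
  proof -
    define K where "K = (\<Union>i\<in>I'. fst i)"
    define \<F> where "\<F> = (\<Union>i\<in>I'. fst (snd i))"
    define e where "e = Min (insert 1 ((\<lambda>i. snd (snd i)) ` I'))"
    have i: "compactin (unit_top G) (fst i)" "finite (fst (snd i))" "fst (snd i) \<subseteq> Cc (gtop G)" "0 < snd (snd i)"
      if "i \<in> I'" for i
      using subsetD[OF I'(2) that] by (auto simp: I_def split: prod.splits)
    have "almost_invariant lam K \<F> e \<noteq> {}"
    proof (rule almost_invariant_nonempty[OF am lam])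
      show "compactin (unit_top G) K"
        unfolding K_def using I'(1) i(1) by (intro compactin_Union) auto
      show "finite \<F>" unfolding \<F>_def using I'(1) i(2) by auto
      show "\<F> \<subseteq> Cc (gtop G)" unfolding \<F>_def by (rule UN_least) (rule i(3))
      show "0 < e" unfolding e_def using I'(1) i(4) by (subst Min_gr_iff) auto
    qed
    then obtain g where g: "g \<in> almost_invariant lam K \<F> e" by blast
    have "ev g \<in> A i" if "i \<in> I'" for i
    proof -
      have "almost_invariant lam K \<F> e \<subseteq> almost_invariant lam (fst i) (fst (snd i)) (snd (snd i))"
        using that I'(1) by (intro almost_invariant_mono) (auto simp: K_def \<F>_def e_def intro: Min_le)
      then show ?thesis using g by (auto simp: A_def split: prod.splits)
    qed
    moreover have "ev g \<in> S" using AS[of "(K, \<F>, e)"] g by (auto simp: A_def)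
    ultimately show ?thesis using closure_subset by blast
  qed
  have "S \<inter> (\<Inter>i\<in>I. closure (A i)) \<noteq> {}"
    by (rule compact_imp_fip_image[OF S]) (use fip in auto)
  then obtain m where m: "m \<in> S" "\<And>i. i \<in> I \<Longrightarrow> m \<in> closure (A i)" by blast
  show ?thesis
  proof (rule that[of m])
    fix \<nu>
    have "norm (m \<nu>) \<le> b \<nu>" using m(1) by (auto simp: S_def PiE_iff)
    then show "\<nu> \<notin> vcarrier (dual (completion V)) \<Longrightarrow> m \<nu> = 0"
      "\<nu> \<in> vcarrier (dual (completion V)) \<Longrightarrow> norm (m \<nu>) \<le> vnorm (dual (completion V)) \<nu>"
      by (auto simp: b_def)
  next
    fix K \<F> and e :: real
    assume "compactin (unit_top G) K" "finite \<F>" "\<F> \<subseteq> Cc (gtop G)" "0 < e"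
    then show "m \<in> closure (ev ` almost_invariant lam K \<F> e)"
      using m(2)[of "(K, \<F>, e)"] by (simp add: I_def A_def)
  qed
qed

text \<open>Every closed condition on functionals that the evaluations at almost invariant functions satisfy
  passes to the cluster point.\<close>

lemma invariant_mean_exists:
  assumes ne: "gunits G \<noteq> {}" and am: "amenable G" and lam: "haar_system G lam"
  shows "\<exists>m. topological_invariant_mean G H lam mu m"
proof -
  define V where "V = Cc_mu G H mu"
  interpret V: function_seminorm V unfolding V_def by (rule function_seminorm_Cc_mu[OF ne])
  have E: "E_space G H mu = V.E" by (simp add: E_space_def V_def)
  have VC: "vcarrier V = Cc CT" by (simp add: V_def vcarrier_Cc_mu)
  note FL = fibred_haar[OF lam]
  interpret L: fibred "gtop G" "grng G" "unit_top G" lam by (rule FL)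
  define ev where "ev = (\<lambda>g \<nu>. if \<nu> \<in> vcarrier (dual V.E) then \<nu> (embed V g) else 0)"
  obtain m where m0: "\<And>\<nu>. \<nu> \<notin> vcarrier (dual V.E) \<Longrightarrow> m \<nu> = 0"
    and mb: "\<And>\<nu>. \<nu> \<in> vcarrier (dual V.E) \<Longrightarrow> norm (m \<nu>) \<le> vnorm (dual V.E) \<nu>"
    and mcl: "\<And>K \<F> e. compactin (unit_top G) K \<Longrightarrow> finite \<F> \<Longrightarrow> \<F> \<subseteq> Cc (gtop G) \<Longrightarrow> 0 < e \<Longrightarrow>
       m \<in> closure (ev ` almost_invariant lam K \<F> e)"
    by (rule cluster_point_exists[OF ne am lam]) (unfold V_def[symmetric] ev_def[symmetric], blast)
  have cl: "m \<in> P" if "closed P" "compactin (unit_top G) K" "finite \<F>" "\<F> \<subseteq> Cc (gtop G)" "0 < e"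
    "\<And>g. g \<in> almost_invariant lam K \<F> e \<Longrightarrow> ev g \<in> P" for P K \<F> e
    using mcl[OF that(2-5)] closure_minimal[of "ev ` almost_invariant lam K \<F> e" P] that(1,6) by blast
  have cl0: "m \<in> P" if "closed P" "\<And>g. g \<in> almost_invariant lam {} {} 1 \<Longrightarrow> ev g \<in> P" for P
    by (rule cl[OF that(1), of "{}" "{}" 1]) (use that(2) in auto)
  have coord: "continuous_on UNIV (\<lambda>m::'a E_bidual. m \<nu>)" for \<nu> by simp
  have aiC: "g \<in> vcarrier V" if "g \<in> almost_invariant lam K \<F> e" for g K \<F> e
    using that by (simp add: almost_invariant_def VC)
  have add: "m (vadd (dual V.E) \<nu> \<nu>') = m \<nu> + m \<nu>'"
    if \<nu>: "\<nu> \<in> vcarrier (dual V.E)" "\<nu>' \<in> vcarrier (dual V.E)" for \<nu> \<nu>'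
  proof -
    have s: "vadd (dual V.E) \<nu> \<nu>' \<in> vcarrier (dual V.E)" by (rule V.dual_add_closed[OF \<nu>])
    have "m \<in> {m. m (vadd (dual V.E) \<nu> \<nu>') = m \<nu> + m \<nu>'}"
    proof (rule cl0)
      show "closed {m::'a E_bidual. m (vadd (dual V.E) \<nu> \<nu>') = m \<nu> + m \<nu>'}"
        by (intro closed_Collect_eq continuous_on_add coord)
      fix g
      have "vadd (dual V.E) \<nu> \<nu>' (embed V g) = \<nu> (embed V g) + \<nu>' (embed V g)" by (simp add: dual_def)
      then show "ev g \<in> {m. m (vadd (dual V.E) \<nu> \<nu>') = m \<nu> + m \<nu>'}"
        using \<nu> s by (simp add: ev_def)
    qed
    then show ?thesis by simp
  qed
  have scale: "m (vscale (dual V.E) c \<nu>) = c * m \<nu>" if \<nu>: "\<nu> \<in> vcarrier (dual V.E)" for c \<nu>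
  proof -
    have s: "vscale (dual V.E) c \<nu> \<in> vcarrier (dual V.E)" by (rule V.dual_scale_closed[OF \<nu>])
    have "m \<in> {m. m (vscale (dual V.E) c \<nu>) = c * m \<nu>}"
    proof (rule cl0)
      show "closed {m::'a E_bidual. m (vscale (dual V.E) c \<nu>) = c * m \<nu>}"
        by (intro closed_Collect_eq continuous_on_mult continuous_on_const coord)
      fix g
      have "vscale (dual V.E) c \<nu> (embed V g) = c * \<nu> (embed V g)" by (simp add: dual_def)
      then show "ev g \<in> {m. m (vscale (dual V.E) c \<nu>) = c * m \<nu>}"
        using \<nu> s by (simp add: ev_def)
    qed
    then show ?thesis by simp
  qed
  have "m \<in> vcarrier (dual (dual V.E))"
    unfolding dual_def[of "dual V.E"] using add scale m0 mb
    by (simp add: exI[of _ 1])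
  moreover have "m \<nu> \<in> \<real>\<^sub>\<ge>\<^sub>0" if \<nu>: "\<nu> \<in> vcarrier (dual V.E)" "positive_functional G H mu \<nu>" for \<nu>
  proof -
    obtain M where M: "\<And>\<phi>. \<phi> \<in> Cc CT \<Longrightarrow> \<nu> (embed V \<phi>) = (LINT \<omega>|M. \<phi> \<omega>)"
      using \<nu>(2) unfolding positive_functional_def V_def by blast
    have "m \<in> {m. m \<nu> \<in> \<real>\<^sub>\<ge>\<^sub>0}"
    proof (rule cl0)
      show "closed {m::'a E_bidual. m \<nu> \<in> \<real>\<^sub>\<ge>\<^sub>0}"
        using closed_vimage[OF closed_nonneg_Reals_complex coord[of \<nu>]] by (simp add: vimage_def)
      fix g assume g: "g \<in> almost_invariant lam {} {} 1"
      then have gp: "\<And>\<omega>. g \<omega> = complex_of_real (norm (g \<omega>))" by (simp add: almost_invariant_def)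
      have "(LINT \<omega>|M. g \<omega>) = complex_of_real (LINT \<omega>|M. norm (g \<omega>))"
        by (subst gp) (rule integral_complex_of_real)
      moreover have "0 \<le> (LINT \<omega>|M. norm (g \<omega>))" by (rule integral_nonneg_AE) auto
      ultimately have "(LINT \<omega>|M. g \<omega>) \<in> \<real>\<^sub>\<ge>\<^sub>0" by simp
      then show "ev g \<in> {m. m \<nu> \<in> \<real>\<^sub>\<ge>\<^sub>0}"
        using \<nu>(1) M[of g] aiC[OF g] by (simp add: ev_def VC)
    qed
    then show ?thesis by simp
  qed
  moreover have "m (comp_measure G H mu \<eta>) = 1" if \<eta>: "probability_on (unit_top G) \<eta>" for \<eta>
  proof -
    let ?\<phi> = "\<lambda>g. LINT u|\<eta>. (LINT \<omega>|mu u. g \<omega>)"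
    have b: "V.bounded_functional ?\<phi>"
      unfolding V_def by (rule bounded_functional_comp_measure(1)[OF ne \<eta>])
    have cm: "comp_measure G H mu \<eta> = extend_functional V ?\<phi>" by (simp add: comp_measure_def V_def)
    have d: "comp_measure G H mu \<eta> \<in> vcarrier (dual V.E)"
      unfolding cm by (rule V.extend_functional_in_dual[OF b])
    have "norm (m (comp_measure G H mu \<eta>) - 1) \<le> e" if e: "0 < e" for e
    proof -
      obtain K d' where K: "compactin (unit_top G) K" "0 < d'"
        "\<And>g. g \<in> almost_invariant lam K {} d' \<Longrightarrow> norm (?\<phi> g - 1) \<le> e"
        by (rule almost_invariant_comp_measure[OF ne \<eta> e, of lam]) blast
      \<comment> \<open>approximate normalisation with error \<open>e\<close> is closed and holds for suitable \<open>K\<close>\<close>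
      have "m \<in> {m. norm (m (comp_measure G H mu \<eta>) - 1) \<le> e}"
      proof (rule cl[OF _ K(1) _ _ K(2)])
        show "closed {m::'a E_bidual. norm (m (comp_measure G H mu \<eta>) - 1) \<le> e}"
          by (intro closed_Collect_le continuous_on_norm continuous_on_diff continuous_on_const coord)
        fix g assume g: "g \<in> almost_invariant lam K {} d'"
        have "comp_measure G H mu \<eta> (embed V g) = ?\<phi> g"
          unfolding cm by (rule V.extend_functional_embed[OF b aiC[OF g]])
        then show "ev g \<in> {m. norm (m (comp_measure G H mu \<eta>) - 1) \<le> e}"
          using K(3)[OF g] d by (simp add: ev_def)
      qed auto
      then show ?thesis by simp
    qed
    then have "norm (m (comp_measure G H mu \<eta>) - 1) \<le> 0 + e" if "0 < e" for e
      using that by simp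
    then have "norm (m (comp_measure G H mu \<eta>) - 1) \<le> 0" by (rule field_le_epsilon)
    then show ?thesis by simp
  qed
  moreover have "conv_act G H lam mu f m = mul_bidual G H mu (haar_integral lam f) m"
    if f: "f \<in> Cc (gtop G)" for f
  proof
    fix \<nu>
    let ?L = "L_Cc G H lam f" and ?k = "\<lambda>g \<omega>. haar_integral lam f (coset_rng G \<omega>) * g \<omega>"
    have bL: "V.bounded_op ?L" unfolding V_def by (rule bounded_op_L_Cc[OF ne lam f])
    obtain C where C: "0 \<le> C" "\<And>u. u \<in> gunits G \<Longrightarrow> (LINT y|lam u. norm (f y)) \<le> C"
      by (rule L.integral_norm_bounded[OF f]) auto
    have "norm (haar_integral lam f u) \<le> C" if "u \<in> gunits G" for u
      unfolding haar_integral_def by (rule order_trans[OF integral_norm_bound C(2)[OF that]])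
    then have bk: "V.bounded_op ?k"
      unfolding V_def by (intro bounded_op_mult[OF ne continuous_haar_integral[OF FL f] C(1)])
    show "conv_act G H lam mu f m \<nu> = mul_bidual G H mu (haar_integral lam f) m \<nu>"
    proof (cases "\<nu> \<in> vcarrier (dual V.E)")
      case True
      define \<nu>1 where "\<nu>1 = transpose_op V.E (extend_op V ?L) \<nu>"
      define \<nu>2 where "\<nu>2 = transpose_op V.E (extend_op V ?k) \<nu>"
      have d1: "\<nu>1 \<in> vcarrier (dual V.E)" unfolding \<nu>1_def by (rule V.transpose_in_dual[OF bL True])
      have d2: "\<nu>2 \<in> vcarrier (dual V.E)" unfolding \<nu>2_def by (rule V.transpose_in_dual[OF bk True])
      obtain D where D: "0 \<le> D" "\<And>A. A \<in> vcarrier V.E \<Longrightarrow> norm (\<nu> A) \<le> D * vnorm V.E A"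
        by (rule V.dual_bound[OF True]) blast
      have "norm (m \<nu>1 - m \<nu>2) \<le> D * e" if e: "0 < e" for e
      proof -
        have "m \<in> {m. norm (m \<nu>1 - m \<nu>2) \<le> D * e}"
        proof (rule cl[of _ "{}" "{f}", OF _ _ _ _ e])
          show "closed {m::'a E_bidual. norm (m \<nu>1 - m \<nu>2) \<le> D * e}"
            by (intro closed_Collect_le continuous_on_norm continuous_on_diff continuous_on_const coord)
          fix g assume g: "g \<in> almost_invariant lam {} {f} e"
          have gV: "g \<in> vcarrier V" by (rule aiC[OF g])
          have LV: "?L g \<in> vcarrier V" "?k g \<in> vcarrier V"
            using V.bounded_opD(1)[OF bL gV] V.bounded_opD(1)[OF bk gV] .
          have "ev g \<nu>1 - ev g \<nu>2 = \<nu> (embed V (?L g)) - \<nu> (embed V (?k g))"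
            using d1 d2 gV by (simp add: ev_def \<nu>1_def \<nu>2_def transpose_op_def V.embed_in
                V.extend_op_embed[OF bL] V.extend_op_embed[OF bk])
          also have "\<dots> = \<nu> (embed V (\<lambda>\<omega>. ?L g \<omega> - ?k g \<omega>))"
            by (rule V.dual_embed_diff[OF True LV, symmetric])
          finally have "norm (ev g \<nu>1 - ev g \<nu>2) \<le> D * vnorm V (\<lambda>\<omega>. ?L g \<omega> - ?k g \<omega>)"
            using D(2)[OF V.embed_in[OF V.diff_closed[OF LV]]] V.vnorm_embed[OF V.diff_closed[OF LV]] by simp
          also have "\<dots> \<le> D * e"
          proof (rule mult_left_mono[OF _ D(1)])
            show "vnorm V (\<lambda>\<omega>. ?L g \<omega> - ?k g \<omega>) \<le> e"
              unfolding V_def by (rule vnorm_le[OF ne]) (use g in \<open>simp add: almost_invariant_def\<close>)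
          qed
          finally show "ev g \<in> {m. norm (m \<nu>1 - m \<nu>2) \<le> D * e}" by simp
        qed (use f in auto)
        then show ?thesis by simp
      qed
      note le = this
      have "norm (m \<nu>1 - m \<nu>2) \<le> 0"
      proof (rule field_le_epsilon)
        fix e :: real assume e: "0 < e"
        have "norm (m \<nu>1 - m \<nu>2) \<le> D * (e / (D + 1))" by (rule le) (use e D(1) in simp)
        also have "\<dots> \<le> e" using e D(1) by (simp add: field_simps)
        finally show "norm (m \<nu>1 - m \<nu>2) \<le> 0 + e" by simp
      qed
      then have "m \<nu>1 = m \<nu>2" by simp
      then show ?thesis
        using True by (simp add: conv_act_def mul_bidual_def mul_dual_def L_op_def mul_E_def E
            transpose_op_def[of "dual V.E"] V_def[symmetric] \<nu>1_def \<nu>2_def)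
    next
      case False
      then show ?thesis
        by (simp add: conv_act_def mul_bidual_def E transpose_op_def[of "dual V.E"])
    qed
  qed
  ultimately show ?thesis
    unfolding topological_invariant_mean_def E by blast
qed

end

theorem proposition4p3:
  fixes G :: "'a groupoid" and H :: "'a set"
    and lam lamH :: "'a \<Rightarrow> 'a measure" and mu :: "'a \<Rightarrow> 'a set measure"
  assumes "lc_groupoid G" and "amenable G" and "haar_system G lam"
    and "closed_wide_subgroupoid G H" and "haar_system (sub_groupoid G H) lamH"
    and "full_equivariant_system G H mu"
  shows "\<exists>m. topological_invariant_mean G H lam mu m"
\<comment> \<open>over an empty unit space the supremum that defines the norm of \<open>C\<^sub>c(G/H)\<close> is unspecified; there are no
  probability measures then, and the zero functional satisfies the conditions\<close>
proof (cases "gunits G = {}")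
  case True
  have "\<not> probability_on (unit_top G) \<eta>" for \<eta>
  proof
    assume "probability_on (unit_top G) \<eta>"
    then have "sets \<eta> = sets (borel_of (unit_top G))" "emeasure \<eta> (space \<eta>) = 1"
      unfolding probability_on_def by blast+
    moreover have "topspace (unit_top G) = {}"
      using lc_groupoid.topspace_unit_top[OF assms(1)] True by simp
    ultimately show False using sets_eq_imp_space_eq[of \<eta> "borel_of (unit_top G)"] by simp
  qed
  moreover have "(\<lambda>_. 0) \<in> vcarrier (dual (dual (E_space G H mu)))"
    unfolding dual_def[of "dual (E_space G H mu)"] by (simp add: exI[of _ 0])
  moreover have "conv_act G H lam mu f (\<lambda>_. 0) = mul_bidual G H mu (haar_integral lam f) (\<lambda>_. 0)" for f
    by (simp add: conv_act_def mul_bidual_def transpose_op_def[of "dual (E_space G H mu)"])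
  ultimately have "topological_invariant_mean G H lam mu (\<lambda>_. 0)"
    unfolding topological_invariant_mean_def by simp
  then show ?thesis by blast
next
  case False
  have "coset_system G H lamH mu"
    by (intro coset_system.intro coset_space.intro coset_space_axioms.intro coset_system_axioms.intro assms)
  then show ?thesis
    by (rule coset_system.invariant_mean_exists[OF _ False assms(2,3)])
qed

end
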